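(* Let $Y\ne0$ be a bounded, self-adjoint and positive element of a tracial $W^*$-probability space $(\mathcal A,E)$, let $u=1-\mu_Y(\{0\})$, and let $\{P_t\}$ be a family of projections in $\mathcal A$ which are free of $Y$ and such that $E(P_t)=t$. Then for $0<t<u$, $$\log S_Y(-t)=-\frac{d}{dt}\left[\lim_{\lambda\downarrow0}E\log^{+\lambda}\left(P_tYP_t\right)\right]=-2\frac{d}{dt}\left[\log\det\left(\sqrt Y\,P_t\right)\right].$$
   Context: A tracial $W^*$-probability space $(\mathcal A,E)$ is a finite von Neumann algebra $\mathcal A$ with a normal faithful tracial state $E$, $E(I)=1$. The spectral probability measure of self-adjoint $Y$ is $\mu_Y(S)=E(1_S(Y))$. Freeness: (unital) subalgebras $\mathcal A_1,\dots,\mathcal A_n$ of $\mathcal A$ are free if $E(a_1\cdots a_m)=0$ whenever $a_i\in\mathcal A_{k(i)}$, $E(a_i)=0$ for every $i$, and $k(i)\ne k(i+1)$ for every $i<m$. Operators are free if the subalgebras they generate are free. Here each $P_t$ is free of $Y$. For $\lambda\in(0,1)$, $\log^{+\lambda}(t)=\log t$ if $t>\lambda$ and $0$ if $t\le\lambda$. The extended Fuglede–Kadison determinant is $\det(X)=\exp\left(\frac12\lim_{\lambda\downarrow0}E\log^{+\lambda}(X^*X)\right)$. $S$-transform: for bounded non-negative $A\ne0$, $\psi_A(z)=\sum_{k\ge1}E(A^k)z^k$ near $0$, and $S_A(z)=(1+z^{-1})\psi_A^{(-1)}(z)$, with $\psi_A^{(-1)}$ the functional inverse near $0$. With $\psi_A(z)=\int\frac{zx}{1-zx}\,\mu_A(dx)$,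 $\psi_A$ is a strictly increasing bijection of $(-\infty,0)$ onto $(-(1-\mu_A(\{0\})),0)$, and $\psi_A^{(-1)}$, $S_A$ are understood on that whole interval through this inverse. *)

theory Defs
  imports "HOL-Analysis.Analysis"
begin

section \<open>Complex Hilbert spaces and bounded operators\<close>

text \<open>The inner product is conjugate-linear in its first argument. The norm, the topology
  and completeness come from the underlying real Hilbert space.\<close>

class complex_hilbert = real_inner + banach +
  fixes scaleC :: "complex \<Rightarrow> 'a \<Rightarrow> 'a"
    and cinner :: "'a \<Rightarrow> 'a \<Rightarrow> complex"
  assumes scaleC_of_real: "scaleC (of_real r) x = r *\<^sub>R x"
    and scaleC_add_right: "scaleC c (x + y) = scaleC c x + scaleC c y"
    and scaleC_add_left: "scaleC (c + d) x = scaleC c x + scaleC d x"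
    and scaleC_scaleC: "scaleC c (scaleC d x) = scaleC (c * d) x"
    and cinner_commute: "cinner x y = cnj (cinner y x)"
    and cinner_add_left: "cinner (x + y) z = cinner x z + cinner y z"
    and cinner_scaleC_left: "cinner (scaleC c x) y = cnj c * cinner x y"
    and inner_eq_Re_cinner: "inner x y = Re (cinner x y)"

lemma cinner_scaleC_right:
  fixes x y :: "'h::complex_hilbert"
  shows "cinner x (scaleC c y) = c * cinner x y"
  by (metis cinner_commute cinner_scaleC_left complex_cnj_cnj complex_cnj_mult)

lemma norm_scaleC:
  fixes x :: "'h::complex_hilbert"
  shows "norm (scaleC c x) = cmod c * norm x"
proof -
  have "inner (scaleC c x) (scaleC c x) = Re ((cnj c * c) * cinner x x)"
    by (simp only: inner_eq_Re_cinner cinner_scaleC_left cinner_scaleC_right ac_simps)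
  also have "cnj c * c = of_real ((cmod c)\<^sup>2)"
    by (simp only: complex_norm_square mult.commute)
  finally have "(norm (scaleC c x))\<^sup>2 = (cmod c * norm x)\<^sup>2"
    by (simp add: power2_norm_eq_inner power_mult_distrib inner_eq_Re_cinner)
  then show ?thesis
    by (simp add: power2_eq_iff_nonneg)
qed

text \<open>The elements of the blinfun type are the bounded real-linear operators;
  the complex-linear ones are singled out by a predicate.\<close>

definition clinear_op :: "('h::complex_hilbert \<Rightarrow>\<^sub>L 'h) \<Rightarrow> bool" where
  "clinear_op T \<longleftrightarrow> (\<forall>c x. blinfun_apply T (scaleC c x) = scaleC c (blinfun_apply T x))"

definition scaleC_op :: "complex \<Rightarrow> ('h::complex_hilbert \<Rightarrow>\<^sub>L 'h) \<Rightarrow> ('h \<Rightarrow>\<^sub>L 'h)" where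
  "scaleC_op c T = Blinfun (\<lambda>x. scaleC c (blinfun_apply T x))"

lemma blinfun_apply_scaleC_op:
  "blinfun_apply (scaleC_op c T) x = scaleC c (blinfun_apply T x)"
proof -
  have comm: "scaleC c (r *\<^sub>R y) = r *\<^sub>R scaleC c y" for r and y :: 'a
    by (metis mult.commute scaleC_of_real scaleC_scaleC)
  have "bounded_linear (scaleC c :: 'a \<Rightarrow> 'a)"
    by (rule bounded_linear_intro[where K = "cmod c"])
      (simp_all add: scaleC_add_right comm norm_scaleC)
  then have "bounded_linear (\<lambda>x. scaleC c (blinfun_apply T x))"
    by (rule bounded_linear_compose[OF _ blinfun.bounded_linear_right])
  then show ?thesis
    unfolding scaleC_op_def by (simp add: bounded_linear_Blinfun_apply)
qed

definition adj :: "('h::complex_hilbert \<Rightarrow>\<^sub>L 'h) \<Rightarrow> ('h \<Rightarrow>\<^sub>L 'h)" where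
  "adj T = (THE S. \<forall>x y. cinner (blinfun_apply S x) y = cinner x (blinfun_apply T y))"

definition self_adjoint :: "('h::complex_hilbert \<Rightarrow>\<^sub>L 'h) \<Rightarrow> bool" where
  "self_adjoint T \<longleftrightarrow> clinear_op T \<and> adj T = T"

definition positive_op :: "('h::complex_hilbert \<Rightarrow>\<^sub>L 'h) \<Rightarrow> bool" where
  "positive_op T \<longleftrightarrow> clinear_op T \<and> (\<forall>x. cinner x (blinfun_apply T x) \<in> \<real>\<^sub>\<ge>\<^sub>0)"

definition op_le :: "('h::complex_hilbert \<Rightarrow>\<^sub>L 'h) \<Rightarrow> ('h \<Rightarrow>\<^sub>L 'h) \<Rightarrow> bool" where
  "op_le S T \<longleftrightarrow> positive_op (T - S)"

definition projection :: "('h::complex_hilbert \<Rightarrow>\<^sub>L 'h) \<Rightarrow> bool" where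
  "projection T \<longleftrightarrow> self_adjoint T \<and> T o\<^sub>L T = T"

definition sqrt_op :: "('h::complex_hilbert \<Rightarrow>\<^sub>L 'h) \<Rightarrow> ('h \<Rightarrow>\<^sub>L 'h)" where
  "sqrt_op T = (THE R. positive_op R \<and> R o\<^sub>L R = T)"


section \<open>Spectral measure and Borel functional calculus of a self-adjoint operator\<close>

text \<open>The scalar measure of a projection-valued measure \<open>Q\<close> at the vector \<open>x\<close>.\<close>

definition pvm_scalar ::
    "(real set \<Rightarrow> ('h::complex_hilbert \<Rightarrow>\<^sub>L 'h)) \<Rightarrow> 'h \<Rightarrow> real measure" where
  "pvm_scalar Q x =
     measure_of UNIV (sets borel) (\<lambda>B. ennreal (Re (cinner x (blinfun_apply (Q B) x))))"

text \<open>\<open>Q\<close> is the resolution of the identity of \<open>T\<close>: a compactly supported projection-valued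
  Borel measure, countably additive in the strong operator topology, with \<open>T = \<integral> t dQ(t)\<close>.
  Off the Borel sets it is set to 0, so that it is unique.\<close>

definition resolution_of_identity ::
    "('h::complex_hilbert \<Rightarrow>\<^sub>L 'h) \<Rightarrow> (real set \<Rightarrow> ('h \<Rightarrow>\<^sub>L 'h)) \<Rightarrow> bool" where
  "resolution_of_identity T Q \<longleftrightarrow>
     (\<forall>B\<in>sets borel. projection (Q B)) \<and>
     (\<forall>B. B \<notin> sets borel \<longrightarrow> Q B = 0) \<and>
     (\<forall>F x. range F \<subseteq> sets borel \<longrightarrow> disjoint_family (F :: nat \<Rightarrow> real set) \<longrightarrow>
        (\<lambda>n. blinfun_apply (Q (F n)) x) sums blinfun_apply (Q (\<Union>n. F n)) x) \<and>
     (\<exists>K. Q {-K..K} = id_blinfun) \<and>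
     (\<forall>x. cinner x (blinfun_apply T x) = of_real (LINT t|pvm_scalar Q x. t))"

definition spectral_pvm ::
    "('h::complex_hilbert \<Rightarrow>\<^sub>L 'h) \<Rightarrow> real set \<Rightarrow> ('h \<Rightarrow>\<^sub>L 'h)" where
  "spectral_pvm T = (THE Q. resolution_of_identity T Q)"

text \<open>\<open>f(T)\<close> for self-adjoint \<open>T\<close> and a real Borel function \<open>f\<close> that is bounded on the
  spectrum of \<open>T\<close>.\<close>

definition borel_calculus ::
    "(real \<Rightarrow> real) \<Rightarrow> ('h::complex_hilbert \<Rightarrow>\<^sub>L 'h) \<Rightarrow> ('h \<Rightarrow>\<^sub>L 'h)" where
  "borel_calculus f T =
     (THE R. clinear_op R \<and>
        (\<forall>x. cinner x (blinfun_apply R x) =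
              of_real (LINT t|pvm_scalar (spectral_pvm T) x. f t)))"


section \<open>Tracial \<open>W\<^sup>*\<close>-probability spaces\<close>

definition commutant :: "('h::complex_hilbert \<Rightarrow>\<^sub>L 'h) set \<Rightarrow> ('h \<Rightarrow>\<^sub>L 'h) set" where
  "commutant M = {T. clinear_op T \<and> (\<forall>S\<in>M. T o\<^sub>L S = S o\<^sub>L T)}"

definition von_neumann_algebra :: "('h::complex_hilbert \<Rightarrow>\<^sub>L 'h) set \<Rightarrow> bool" where
  "von_neumann_algebra M \<longleftrightarrow>
     (\<forall>T\<in>M. clinear_op T) \<and> (\<forall>T\<in>M. adj T \<in> M) \<and> commutant (commutant M) = M"

definition finite_von_neumann_algebra :: "('h::complex_hilbert \<Rightarrow>\<^sub>L 'h) set \<Rightarrow> bool" where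
  "finite_von_neumann_algebra M \<longleftrightarrow>
     von_neumann_algebra M \<and>
     (\<forall>V\<in>M. adj V o\<^sub>L V = id_blinfun \<longrightarrow> V o\<^sub>L adj V = id_blinfun)"

text \<open>\<open>T\<close> is the least upper bound of \<open>D\<close> among the self-adjoint elements of \<open>M\<close>.\<close>

definition is_lub_in ::
    "('h::complex_hilbert \<Rightarrow>\<^sub>L 'h) set \<Rightarrow> ('h \<Rightarrow>\<^sub>L 'h) set \<Rightarrow> ('h \<Rightarrow>\<^sub>L 'h) \<Rightarrow> bool" where
  "is_lub_in M D T \<longleftrightarrow>
     T \<in> M \<and> self_adjoint T \<and> (\<forall>S\<in>D. op_le S T) \<and>
     (\<forall>R\<in>M. self_adjoint R \<longrightarrow> (\<forall>S\<in>D. op_le S R) \<longrightarrow> op_le T R)"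

text \<open>Only the values of \<open>E\<close> on \<open>M\<close> matter. Normality is preservation of suprema of
  upward directed bounded families of positive elements.\<close>

locale tracial_wstar_space =
  fixes M :: "('h::complex_hilbert \<Rightarrow>\<^sub>L 'h) set"
    and E :: "('h \<Rightarrow>\<^sub>L 'h) \<Rightarrow> complex"
  assumes finite_vna: "finite_von_neumann_algebra M"
    and E_add: "S \<in> M \<Longrightarrow> T \<in> M \<Longrightarrow> E (S + T) = E S + E T"
    and E_scaleC: "T \<in> M \<Longrightarrow> E (scaleC_op c T) = c * E T"
    and E_positive: "T \<in> M \<Longrightarrow> positive_op T \<Longrightarrow> E T \<in> \<real>\<^sub>\<ge>\<^sub>0"
    and E_id: "E id_blinfun = 1"
    and E_tracial: "S \<in> M \<Longrightarrow> T \<in> M \<Longrightarrow> E (S o\<^sub>L T) = E (T o\<^sub>L S)"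
    and E_faithful: "T \<in> M \<Longrightarrow> E (adj T o\<^sub>L T) = 0 \<Longrightarrow> T = 0"
    and E_normal: "D \<subseteq> M \<Longrightarrow> D \<noteq> {} \<Longrightarrow> (\<And>S. S \<in> D \<Longrightarrow> positive_op S) \<Longrightarrow>
        (\<And>S T. S \<in> D \<Longrightarrow> T \<in> D \<Longrightarrow> \<exists>R\<in>D. op_le S R \<and> op_le T R) \<Longrightarrow>
        is_lub_in M D T \<Longrightarrow> Re (E T) = (SUP S\<in>D. Re (E S))"

text \<open>The spectral probability measure \<open>B \<mapsto> E(1\<^sub>B(T))\<close>.\<close>

definition spectral_distribution ::
    "(('h::complex_hilbert \<Rightarrow>\<^sub>L 'h) \<Rightarrow> complex) \<Rightarrow> ('h \<Rightarrow>\<^sub>L 'h) \<Rightarrow> real measure" where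
  "spectral_distribution E T =
     measure_of UNIV (sets borel) (\<lambda>B. ennreal (Re (E (borel_calculus (indicator B) T))))"


section \<open>Freeness\<close>

inductive_set generated_algebra :: "('h::complex_hilbert \<Rightarrow>\<^sub>L 'h) set \<Rightarrow> ('h \<Rightarrow>\<^sub>L 'h) set"
  for G :: "('h \<Rightarrow>\<^sub>L 'h) set" where
  generator: "T \<in> G \<Longrightarrow> T \<in> generated_algebra G"
| unit: "id_blinfun \<in> generated_algebra G"
| add: "S \<in> generated_algebra G \<Longrightarrow> T \<in> generated_algebra G \<Longrightarrow> S + T \<in> generated_algebra G"
| scale: "T \<in> generated_algebra G \<Longrightarrow> scaleC_op c T \<in> generated_algebra G"
| mult: "S \<in> generated_algebra G \<Longrightarrow> T \<in> generated_algebra G \<Longrightarrow> S o\<^sub>L T \<in> generated_algebra G"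

definition free_subalgebras ::
    "(('h::complex_hilbert \<Rightarrow>\<^sub>L 'h) \<Rightarrow> complex) \<Rightarrow> 'i set \<Rightarrow> ('i \<Rightarrow> ('h \<Rightarrow>\<^sub>L 'h) set) \<Rightarrow> bool" where
  "free_subalgebras E I A \<longleftrightarrow>
     (\<forall>as ks. as \<noteq> [] \<longrightarrow> length ks = length as \<longrightarrow>
        (\<forall>j<length as. ks ! j \<in> I \<and> as ! j \<in> A (ks ! j) \<and> E (as ! j) = 0) \<longrightarrow>
        (\<forall>j. Suc j < length as \<longrightarrow> ks ! j \<noteq> ks ! Suc j) \<longrightarrow>
        E (foldr (o\<^sub>L) as id_blinfun) = 0)"

definition free_operators ::
    "(('h::complex_hilbert \<Rightarrow>\<^sub>L 'h) \<Rightarrow> complex) \<Rightarrow> 'i set \<Rightarrow> ('i \<Rightarrow> ('h \<Rightarrow>\<^sub>L 'h)) \<Rightarrow> bool" where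
  "free_operators E I X \<longleftrightarrow> free_subalgebras E I (\<lambda>i. generated_algebra {X i})"

definition free_pair ::
    "(('h::complex_hilbert \<Rightarrow>\<^sub>L 'h) \<Rightarrow> complex) \<Rightarrow> ('h \<Rightarrow>\<^sub>L 'h) \<Rightarrow> ('h \<Rightarrow>\<^sub>L 'h) \<Rightarrow> bool" where
  "free_pair E X Y \<longleftrightarrow> free_operators E {0, 1 :: nat} (\<lambda>i. if i = 0 then X else Y)"


section \<open>Fuglede--Kadison determinant\<close>

definition log_plus :: "real \<Rightarrow> real \<Rightarrow> real" where
  "log_plus l t = (if t > l then ln t else 0)"

text \<open>As \<open>l\<close> decreases to 0, \<open>E(log_plus l T)\<close> is eventually decreasing for positive \<open>T\<close>,
  hence has a limit, which may be \<open>-\<infinity>\<close>.\<close>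

definition E_log :: "(('h::complex_hilbert \<Rightarrow>\<^sub>L 'h) \<Rightarrow> complex) \<Rightarrow> ('h \<Rightarrow>\<^sub>L 'h) \<Rightarrow> ereal" where
  "E_log E T = Lim (at_right 0) (\<lambda>l. ereal (Re (E (borel_calculus (log_plus l) T))))"

definition FK_det :: "(('h::complex_hilbert \<Rightarrow>\<^sub>L 'h) \<Rightarrow> complex) \<Rightarrow> ('h \<Rightarrow>\<^sub>L 'h) \<Rightarrow> real" where
  "FK_det E X =
     (let L = E_log E (adj X o\<^sub>L X) in if L = -\<infinity> then 0 else exp (1/2 * real_of_ereal L))"


section \<open>S-transform\<close>

text \<open>On the negative half-line; for positive bounded \<open>A\<close> the integral is the continuation of
  the power series \<open>\<Sum>k\<ge>1. E(A\<^sup>k) z\<^sup>k\<close>. It maps \<open>(-\<infinity>, 0)\<close> bijectively onto \<open>(-(1 - \<mu>{0}), 0)\<close>,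
  where \<open>\<mu>\<close> is the spectral distribution of \<open>A\<close>, and the S-transform is meaningful on the
  latter interval.\<close>

definition psi_transform ::
    "(('h::complex_hilbert \<Rightarrow>\<^sub>L 'h) \<Rightarrow> complex) \<Rightarrow> ('h \<Rightarrow>\<^sub>L 'h) \<Rightarrow> real \<Rightarrow> real" where
  "psi_transform E A z = (LINT x|spectral_distribution E A. z * x / (1 - z * x))"

definition S_transform ::
    "(('h::complex_hilbert \<Rightarrow>\<^sub>L 'h) \<Rightarrow> complex) \<Rightarrow> ('h \<Rightarrow>\<^sub>L 'h) \<Rightarrow> real \<Rightarrow> real" where
  "S_transform E A z = (1 + 1 / z) * inv_into {..<0} (psi_transform E A) z"

end

theory Submission
  imports Defs "HOL-Probability.Helly_Selection" "HOL-Computational_Algebra.Polynomial"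
begin

text \<open>
  The proof computes the logarithmic determinant of the compression \<open>T = P Y P\<close>, where \<open>E P = t\<close>, in
  closed form. For a positive element \<open>T\<close> put \<open>F\<^sub>T(r) = E (ln (1 + r T))\<close> and
  \<open>w\<^sub>T(r) = 1 - E ((1 + r T)\<^sup>-\<^sup>1) = - \<psi>\<^sub>T(- r)\<close>, so that \<open>F\<^sub>T' = w\<^sub>T / r\<close>. Write \<open>w = w\<^sub>Y(q)\<close>.

  The analytic heart is the compression formula (\<open>w_compression\<close>)
  \<open>w\<^sub>T(q (1 - w) / (t - w)) = w\<close> whenever \<open>w < t\<close>,
  which is the multiplicativity of the \<open>S\<close>-transform for \<open>P\<close> and \<open>Y\<close>. It comes from a factorization
  \<open>1 + r P Y = B\<^sup>-\<^sup>1 Z A\<^sup>-\<^sup>1\<close>, in which \<open>A = (1 + q Y)\<^sup>-\<^sup>1\<close>, \<open>B\<close> is a combination of \<open>1\<close> and \<open>P\<close>, and \<open>Z\<close>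
  is a scalar plus a product of a centred function of \<open>P\<close> and a centred function of \<open>Y\<close>. By freeness
  \<open>E\<close> is multiplicative on the closed algebra generated by such products, and \<open>Z\<^sup>-\<^sup>1\<close> belongs to this
  algebra by a continuation argument starting at \<open>q = 0\<close>. This works for every \<open>q\<close> at once, so no power
  series and no analytic continuation enter.

  Integrating \<open>F\<^sub>T' = w\<^sub>T / r\<close> along the formula gives (\<open>F_compression\<close>)
  \<open>F\<^sub>T(r) = F\<^sub>Y(q) + ln (1 - w) - t ln (1 - w / t)\<close> with \<open>r = q (1 - w) / (t - w)\<close>. As \<open>w\<close> increases to
  \<open>t\<close>, \<open>r\<close> tends to infinity, \<open>q\<close> to the solution \<open>\<rho>(t)\<close> of \<open>w\<^sub>Y(\<rho>(t)) = t\<close>, and \<open>F\<^sub>T(r) - t ln r\<close> to the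
  integral of the logarithm over the positive part of the spectrum of \<open>T\<close>. Hence (\<open>E_log_compression\<close>)
  the logarithmic determinant of \<open>T\<close> is
  \<open>L(t) = F\<^sub>Y(\<rho>(t)) - t ln \<rho>(t) + (1 - t) ln (1 - t) + t ln t\<close>,
  and \<open>L'(t) = - ln (\<rho>(t) (1 - t) / t) = - ln S\<^sub>Y(- t)\<close>.

  The spectral theorem is proved on the way. A polynomial that is nonnegative on an interval containing the
  spectrum is nonnegative at the operator (\<open>poly_op_nonneg\<close>). A Riesz--Markov theorem for
  polynomials (\<open>positive_functional_measure\<close>) then provides the scalar measures, and the Borel functional calculus is
  the extension of the polynomial one under bounded pointwise limits. Normality of \<open>E\<close> makes the
  spectral distribution a measure for which \<open>E (f(T))\<close> is the integral of \<open>f\<close>.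
\<close>

section \<open>Hermitian operators and adjoints\<close>

lemma scaleC_one [simp]: "scaleC 1 (x::'h::complex_hilbert) = x"
  using scaleC_of_real[of 1 x] by simp

lemma scaleC_scaleR_commute: "scaleC c (r *\<^sub>R (x::'h::complex_hilbert)) = r *\<^sub>R scaleC c x"
  by (metis mult.commute scaleC_of_real scaleC_scaleC)

lemma bounded_linear_scaleC: "bounded_linear (scaleC c :: 'h::complex_hilbert \<Rightarrow> 'h)"
  by (rule bounded_linear_intro[where K = "cmod c"])
    (simp_all add: scaleC_add_right scaleC_scaleR_commute norm_scaleC)

lemma scaleC_zero_right [simp]: "scaleC c (0::'h::complex_hilbert) = 0"
  by (rule linear_simps(3)[OF bounded_linear_scaleC])

lemma scaleC_minus_right: "scaleC c (- (x::'h::complex_hilbert)) = - scaleC c x"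
  by (rule linear_simps(4)[OF bounded_linear_scaleC])

lemma scaleC_diff_right: "scaleC c ((x::'h::complex_hilbert) - y) = scaleC c x - scaleC c y"
  by (rule linear_simps(2)[OF bounded_linear_scaleC])

lemma scaleC_minus_one [simp]: "scaleC (-1) (x::'h::complex_hilbert) = - x"
  using scaleC_of_real[of "-1" x] by simp

lemma inner_scaleC_ii: "inner (scaleC \<i> x) (scaleC \<i> (y::'h::complex_hilbert)) = inner x y"
  by (simp add: inner_eq_Re_cinner cinner_scaleC_left cinner_scaleC_right mult.assoc [symmetric])

lemma inner_scaleC_i_left: "inner (scaleC \<i> x) (y::'h::complex_hilbert) = - inner x (scaleC \<i> y)"
  by (simp add: inner_eq_Re_cinner cinner_scaleC_left cinner_scaleC_right)

lemma Im_cinner: "Im (cinner x (y::'h::complex_hilbert)) = inner (scaleC \<i> x) y"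
  by (simp add: inner_eq_Re_cinner cinner_scaleC_left)

lemma cinner_eq_inner:
  "cinner x (y::'h::complex_hilbert) = Complex (inner x y) (inner (scaleC \<i> x) y)"
  by (simp add: complex_eq_iff Im_cinner inner_eq_Re_cinner)

lemma scaleC_eq: "scaleC c (x::'h::complex_hilbert) = Re c *\<^sub>R x + Im c *\<^sub>R scaleC \<i> x"
proof -
  have "c = of_real (Re c) + of_real (Im c) * \<i>"
    by (simp add: complex_eq_iff)
  then show ?thesis
    by (metis scaleC_add_left scaleC_of_real scaleC_scaleC)
qed

lemma clinear_op_iff_i:
  "clinear_op T \<longleftrightarrow> (\<forall>x. T (scaleC \<i> x) = scaleC \<i> (T x))"
proof
  assume *: "\<forall>x. T (scaleC \<i> x) = scaleC \<i> (T x)"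
  show "clinear_op T"
    unfolding clinear_op_def
  proof (intro allI)
    fix c x
    show "T (scaleC c x) = scaleC c (T x)"
      using * by (subst (1 2) scaleC_eq) (simp add: blinfun.bilinear_simps)
  qed
qed (simp add: clinear_op_def)

lemma clinear_op_closed [simp, intro]:
  "clinear_op 0" "clinear_op id_blinfun"
  "clinear_op S \<Longrightarrow> clinear_op T \<Longrightarrow> clinear_op (S + T)"
  "clinear_op S \<Longrightarrow> clinear_op T \<Longrightarrow> clinear_op (S - T)"
  "clinear_op T \<Longrightarrow> clinear_op (- T)"
  "clinear_op T \<Longrightarrow> clinear_op (r *\<^sub>R T)"
  "clinear_op S \<Longrightarrow> clinear_op T \<Longrightarrow> clinear_op (S o\<^sub>L T)"
  "clinear_op T \<Longrightarrow> clinear_op (scaleC_op c T)"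
  by (simp_all add: clinear_op_def blinfun.bilinear_simps scaleC_add_right scaleC_diff_right
      scaleC_minus_right scaleC_scaleR_commute blinfun_apply_scaleC_op scaleC_scaleC mult.commute)

lemma scaleC_op_of_real: "scaleC_op (of_real r) T = r *\<^sub>R T"
  by (rule blinfun_eqI) (simp add: blinfun_apply_scaleC_op scaleC_of_real blinfun.bilinear_simps)

text \<open>Symmetry expressed by the real inner product, so that the Hilbert space can be treated as a
  real one; for complex-linear operators it agrees with self-adjointness.\<close>

definition hermitian :: "('h::complex_hilbert \<Rightarrow>\<^sub>L 'h) \<Rightarrow> bool" where
  "hermitian T \<longleftrightarrow> clinear_op T \<and> (\<forall>x y. inner (T x) y = inner x (T y))"

lemma hermitian_clinear [simp]: "hermitian T \<Longrightarrow> clinear_op T"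
  by (simp add: hermitian_def)

lemma hermitian_inner: "hermitian T \<Longrightarrow> inner (T x) y = inner x (T y)"
  by (simp add: hermitian_def)

lemma hermitian_cinner:
  assumes "hermitian T"
  shows "cinner (T x) y = cinner x (T y)"
proof -
  have "scaleC \<i> (T x) = T (scaleC \<i> x)"
    using assms by (simp add: hermitian_def clinear_op_iff_i)
  then show ?thesis
    using assms by (simp add: cinner_eq_inner hermitian_inner)
qed

lemma hermitian_closed [simp, intro]:
  "hermitian 0" "hermitian id_blinfun"
  "hermitian S \<Longrightarrow> hermitian T \<Longrightarrow> hermitian (S + T)"
  "hermitian S \<Longrightarrow> hermitian T \<Longrightarrow> hermitian (S - T)"
  "hermitian T \<Longrightarrow> hermitian (- T)"
  "hermitian T \<Longrightarrow> hermitian (r *\<^sub>R T)"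
  by (simp_all add: hermitian_def blinfun.bilinear_simps inner_add_left inner_add_right
      inner_diff_left inner_diff_right)

lemma hermitian_quadratic_i:
  assumes "hermitian T"
  shows "inner (scaleC \<i> x) (T x) = 0"
proof -
  have "inner (scaleC \<i> x) (T x) = inner (T (scaleC \<i> x)) x"
    using assms by (simp add: hermitian_inner)
  also have "T (scaleC \<i> x) = scaleC \<i> (T x)"
    using assms by (simp add: hermitian_def clinear_op_iff_i)
  also have "inner (scaleC \<i> (T x)) x = - inner (scaleC \<i> x) (T x)"
    by (simp add: inner_scaleC_i_left[of "T x"] inner_commute[of "T x"])
  finally show ?thesis
    by simp
qed

lemma hermitian_cinner_quadratic:
  "hermitian T \<Longrightarrow> cinner x (T x) = of_real (inner x (T x))"
  by (simp add: cinner_eq_inner hermitian_quadratic_i complex_eq_iff)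

text \<open>The imaginary part of the quadratic form is \<open>inner (\<i> x) (T x)\<close>; polarizing its vanishing gives
  symmetry. Operators defined by their real quadratic forms are handled through this lemma.\<close>

lemma hermitianI_real_quadratic:
  assumes T: "clinear_op T" and r: "\<And>x. cinner x (T x) \<in> \<real>"
  shows "hermitian T"
proof -
  have q: "inner (scaleC \<i> x) (T x) = 0" for x
    using r[of x] by (simp add: complex_is_Real_iff Im_cinner)
  have c: "T (scaleC \<i> x) = scaleC \<i> (T x)" for x
    using T by (simp add: clinear_op_iff_i)
  have "inner (T x) y = inner x (T y)" for x y
  proof -
    \<comment> \<open>Polarize the vanishing imaginary part at the pair \<open>- \<i> x\<close>, \<open>y\<close>.\<close>
    let ?x = "- scaleC \<i> x"
    have ix: "scaleC \<i> ?x = x"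
      by (simp add: scaleC_minus_right scaleC_scaleC)
    have "inner (scaleC \<i> (?x + y)) (T (?x + y)) = 0"
      by (rule q)
    then have "inner x (T y) + inner (scaleC \<i> y) (T ?x) = 0"
      using q[of ?x] q[of y] by (simp only: ix scaleC_add_right blinfun.bilinear_simps inner_add_left inner_add_right)
    moreover have "inner (scaleC \<i> y) (T ?x) = - inner y (T x)"
      by (simp add: blinfun.bilinear_simps c inner_scaleC_ii)
    ultimately show ?thesis
      by (simp add: inner_commute)
  qed
  with T show ?thesis
    by (simp add: hermitian_def)
qed

lemma hermitian_polarization:
  assumes "hermitian T"
  shows "inner x (T y) = (inner (x + y) (T (x + y)) - inner (x - y) (T (x - y))) / 4"
  using hermitian_inner[OF assms, of x y]
  by (simp add: blinfun.bilinear_simps inner_add_left inner_add_right inner_diff_left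
      inner_diff_right inner_commute)

lemma hermitian_eqI:
  assumes "hermitian S" "hermitian T" and "\<And>x. inner x (S x) = inner x (T x)"
  shows "S = T"
proof (rule blinfun_eqI)
  fix y
  have "inner x (S y) = inner x (T y)" for x
    using assms(3)
    by (simp only: hermitian_polarization[OF assms(1), of x y] hermitian_polarization[OF assms(2), of x y])
  then show "S y = T y"
    by (metis inner_eq_zero_iff inner_diff_right eq_iff_diff_eq_0)
qed

lemma positive_op_iff: "positive_op T \<longleftrightarrow> hermitian T \<and> (\<forall>x. 0 \<le> inner x (T x))"
proof
  assume *: "positive_op T"
  then have "hermitian T"
    by (auto simp: positive_op_def complex_nonneg_Reals_iff complex_is_Real_iff
        intro!: hermitianI_real_quadratic)
  moreover have "0 \<le> inner x (T x)" for x
    using * by (simp add: positive_op_def inner_eq_Re_cinner complex_nonneg_Reals_iff)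
  ultimately show "hermitian T \<and> (\<forall>x. 0 \<le> inner x (T x))"
    by blast
next
  assume "hermitian T \<and> (\<forall>x. 0 \<le> inner x (T x))"
  then show "positive_op T"
    by (auto simp: positive_op_def hermitian_cinner_quadratic)
qed

lemma op_le_iff:
  assumes "hermitian S" "hermitian T"
  shows "op_le S T \<longleftrightarrow> (\<forall>x. inner x (S x) \<le> inner x (T x))"
  using assms by (simp add: op_le_def positive_op_iff blinfun.bilinear_simps inner_diff_right)

text \<open>The form bound of a symmetric operator is its norm: optimize the polarization identity
  over vectors of equal length.\<close>

lemma hermitian_inner_bound:
  assumes T: "hermitian T" and b: "\<And>x. \<bar>inner x (T x)\<bar> \<le> C * (norm x)\<^sup>2"
  shows "\<bar>inner x (T y)\<bar> \<le> C * norm x * norm y"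
proof (cases "x = 0 \<or> y = 0")
  case False
  define s where "s = norm y / norm x"
  have s: "s > 0"
    using False by (simp add: s_def)
  have aux: "\<bar>a\<bar> \<le> p \<Longrightarrow> \<bar>b\<bar> \<le> q \<Longrightarrow> \<bar>(a - b) / 4\<bar> \<le> (p + q) / 4" for a b p q :: real
    by (auto simp: abs_le_iff)
  have "\<bar>inner (s *\<^sub>R x) (T y)\<bar>
      \<le> (C * (norm (s *\<^sub>R x + y))\<^sup>2 + C * (norm (s *\<^sub>R x - y))\<^sup>2) / 4"
    unfolding hermitian_polarization[OF T, of "s *\<^sub>R x" y]
    using b[of "s *\<^sub>R x + y"] b[of "s *\<^sub>R x - y"] aux by blast
  also have "\<dots> = C * ((norm (s *\<^sub>R x))\<^sup>2 + (norm y)\<^sup>2) / 2"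
  proof -
    have "(norm (u + y))\<^sup>2 + (norm (u - y))\<^sup>2 = 2 * (norm u)\<^sup>2 + 2 * (norm y)\<^sup>2" for u
      unfolding power2_norm_eq_inner
      by (simp add: inner_add_left inner_add_right inner_diff_left inner_diff_right)
    from this[of "s *\<^sub>R x"] show ?thesis
      by (simp only: distrib_left[symmetric])
  qed
  also have "\<dots> = C * (norm y)\<^sup>2"
    using False s by (simp add: s_def power_mult_distrib power_divide)
  finally have "s * \<bar>inner x (T y)\<bar> \<le> s * (C * norm x * norm y)"
    using False s by (simp add: abs_mult s_def power2_eq_square ac_simps)
  then show ?thesis
    using s by (simp only: mult_le_cancel_left_pos)
qed (auto simp: blinfun.bilinear_simps)

lemma hermitian_norm_bound:
  assumes "hermitian T" "\<And>x. \<bar>inner x (T x)\<bar> \<le> C * (norm x)\<^sup>2" "0 \<le> C"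
  shows "norm T \<le> C"
proof (rule norm_blinfun_bound[OF assms(3)])
  fix y
  have "(norm (T y))\<^sup>2 \<le> C * norm (T y) * norm y"
    using hermitian_inner_bound[OF assms(1,2), of "T y" y] by (simp add: power2_norm_eq_inner)
  then show "norm (T y) \<le> C * norm y"
    by (cases "T y = 0") (auto simp: power2_eq_square assms(3) mult.assoc)
qed

lemma abs_inner_op_le: "\<bar>inner x (blinfun_apply T y)\<bar> \<le> norm T * norm x * norm (y::'h::complex_hilbert)"
proof -
  have "\<bar>inner x (T y)\<bar> \<le> norm x * norm (T y)"
    by (rule Cauchy_Schwarz_ineq2)
  also have "\<dots> \<le> norm x * (norm T * norm y)"
    by (intro mult_left_mono norm_blinfun) auto
  finally show ?thesis
    by (simp add: algebra_simps)
qed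

text \<open>Riesz representation. A minimizing sequence of \<open>\<parallel>x\<parallel>\<^sup>2 - 2 f x\<close> is Cauchy by the parallelogram
  law, and the minimum is stationary.\<close>

lemma riesz_representation:
  fixes f :: "'h::{real_inner,banach} \<Rightarrow> real"
  assumes f: "bounded_linear f"
  shows "\<exists>z. \<forall>x. f x = inner z x"
proof -
  interpret f: bounded_linear f by fact
  obtain K where K: "\<And>x. \<bar>f x\<bar> \<le> norm x * K"
    using f.nonneg_bounded by auto
  define J where "J x = (norm x)\<^sup>2 - 2 * f x" for x
  have J_lower: "J x \<ge> - K\<^sup>2" for x
  proof -
    have "0 \<le> (norm x - K)\<^sup>2"
      by simp
    then show ?thesis
      using K[of x] by (simp add: J_def power2_eq_square algebra_simps abs_le_iff)
  qed
  define m where "m = (INF x. J x)"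
  have m: "m \<le> J x" for x
    unfolding m_def by (rule cINF_lower) (auto intro!: bdd_belowI[of _ "- K\<^sup>2"] J_lower)
  have "\<exists>x. J x < m + inverse (real (Suc n))" for n
  proof (rule ccontr)
    assume "\<not> ?thesis"
    then have "m + inverse (real (Suc n)) \<le> m"
      unfolding m_def by (intro cINF_greatest) (auto simp: not_less)
    then show False
      by (simp del: of_nat_Suc)
  qed
  then obtain X where X: "\<And>n. J (X n) < m + inverse (real (Suc n))"
    by metis
  have par: "(norm (x - y))\<^sup>2 = 2 * J x + 2 * J y - 4 * J ((1/2) *\<^sub>R (x + y))" for x y
    unfolding J_def power2_norm_eq_inner f.add f.scaleR inner_scaleR_left inner_scaleR_right
    by (simp add: inner_add_left inner_add_right inner_diff_left inner_diff_right inner_commute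
        algebra_simps)
  have dist: "(norm (X p - X q))\<^sup>2 \<le> 2 * inverse (real (Suc p)) + 2 * inverse (real (Suc q))" for p q
    using par[of "X p" "X q"] m[of "(1/2) *\<^sub>R (X p + X q)"] X[of p] X[of q] by linarith
  have "Cauchy X"
  proof (rule metric_CauchyI)
    fix e :: real
    assume e: "0 < e"
    have "0 < e\<^sup>2 / 4"
      using e by simp
    then obtain N where N: "inverse (real (Suc N)) < e\<^sup>2 / 4"
      using reals_Archimedean by blast
    have "dist (X p) (X q) < e" if "p \<ge> N" "q \<ge> N" for p q
    proof -
      have "inverse (real (Suc p)) \<le> inverse (real (Suc N))"
        "inverse (real (Suc q)) \<le> inverse (real (Suc N))"
        using that by (auto intro!: le_imp_inverse_le)
      then have "(norm (X p - X q))\<^sup>2 < e\<^sup>2"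
        using dist[of p q] N by linarith
      then show ?thesis
        using e by (simp add: dist_norm power_less_imp_less_base)
    qed
    then show "\<exists>N. \<forall>p\<ge>N. \<forall>q\<ge>N. dist (X p) (X q) < e"
      by blast
  qed
  then obtain z where z: "X \<longlonglongrightarrow> z"
    using Cauchy_convergent convergent_def by blast
  have "(\<lambda>n. J (X n)) \<longlonglongrightarrow> J z"
    unfolding J_def by (intro tendsto_intros z f.tendsto)
  moreover have "(\<lambda>n. m + inverse (real (Suc n))) \<longlonglongrightarrow> m + 0"
    by (intro tendsto_intros LIMSEQ_inverse_real_of_nat)
  ultimately have "J z \<le> m"
    by (intro LIMSEQ_le[of "\<lambda>n. J (X n)" _ "\<lambda>n. m + inverse (real (Suc n))"])
      (use X in \<open>auto intro!: exI[of _ 0] less_imp_le\<close>)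
  then have Jz: "J z \<le> J y" for y
    using m order_trans by blast
  have "f x = inner z x" for x
  proof (rule ccontr)
    assume ne: "f x \<noteq> inner z x"
    define d where "d = f x - inner z x"
    have x0: "(norm x)\<^sup>2 > 0"
      using ne f.zero by auto
    define s where "s = d / (norm x)\<^sup>2"
    have "J (z + s *\<^sub>R x) = J z + s\<^sup>2 * (norm x)\<^sup>2 - 2 * s * d"
    proof -
      have "(norm (z + s *\<^sub>R x))\<^sup>2 = (norm z)\<^sup>2 + 2 * s * inner z x + s\<^sup>2 * (norm x)\<^sup>2"
        unfolding power2_norm_eq_inner
        by (simp add: inner_add_left inner_add_right inner_commute power2_eq_square algebra_simps)
      then show ?thesis
        by (simp add: J_def d_def f.add f.scaleR algebra_simps)
    qed
    also have "s\<^sup>2 * (norm x)\<^sup>2 = s * d"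
      using x0 by (simp add: s_def power2_eq_square)
    finally have "s * d \<le> 0"
      using Jz[of "z + s *\<^sub>R x"] by (simp add: mult.commute)
    moreover have "s * d > 0"
    proof -
      have "d \<noteq> 0"
        using ne by (simp add: d_def)
      then have "0 < d * d / (norm x)\<^sup>2"
        by (intro divide_pos_pos x0) (metis not_real_square_gt_zero)
      then show ?thesis
        by (simp add: s_def)
    qed
    ultimately show False
      by simp
  qed
  then show ?thesis
    by blast
qed

lemma bounded_form_representation:
  fixes B :: "'h::{real_inner,banach} \<Rightarrow> 'h \<Rightarrow> real"
  assumes add_l: "\<And>x y z. B (x + y) z = B x z + B y z"
    and sc_l: "\<And>r x z. B (r *\<^sub>R x) z = r * B x z"
    and add_r: "\<And>x y z. B x (y + z) = B x y + B x z"
    and sc_r: "\<And>r x z. B x (r *\<^sub>R z) = r * B x z"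
    and bd: "\<And>x y. \<bar>B x y\<bar> \<le> C * norm x * norm y"
  shows "\<exists>S::'h \<Rightarrow>\<^sub>L 'h. \<forall>x y. inner (S x) y = B x y"
proof -
  have "\<exists>z. \<forall>y. B x y = inner z y" for x
    by (rule riesz_representation, rule bounded_linear_intro[of _ "C * norm x"])
      (use add_r sc_r bd[of x] in \<open>auto simp: mult.commute\<close>)
  then obtain s where s: "\<And>x y. B x y = inner (s x) y"
    by metis
  have eqI: "u = v" if "\<And>y. inner u y = inner v y" for u v :: 'h
    using that by (metis inner_diff_left inner_eq_zero_iff eq_iff_diff_eq_0)
  have "bounded_linear s"
  proof (rule bounded_linear_intro[of _ C])
    show "s (x + y) = s x + s y" for x y
      by (rule eqI) (simp add: s[symmetric] add_l inner_add_left)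
    show "s (r *\<^sub>R x) = r *\<^sub>R s x" for r x
      by (rule eqI) (simp add: s[symmetric] sc_l)
    show "norm (s x) \<le> norm x * C" for x
    proof (cases "s x = 0")
      case False
      have "norm (s x) * norm (s x) \<le> norm (s x) * (norm x * C)"
        using bd[of x "s x"] by (simp add: s power2_norm_eq_inner[symmetric] power2_eq_square algebra_simps)
      then show ?thesis
        using False by simp
    next
      case True
      have "\<bar>B x x\<bar> \<le> C * norm x * norm x"
        by (rule bd)
      then have "0 \<le> (C * norm x) * norm x"
        by linarith
      then show ?thesis
        using True by (cases "x = 0") (auto simp: zero_le_mult_iff mult.commute)
    qed
  qed
  then show ?thesis
    by (intro exI[of _ "Blinfun s"]) (simp add: s bounded_linear_Blinfun_apply)
qed

lemma adj_eqI:
  fixes S T :: "'h::complex_hilbert \<Rightarrow>\<^sub>L 'h"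
  assumes "\<And>x y. cinner (S x) y = cinner x (T y)"
  shows "adj T = S"
  unfolding adj_def
proof (rule the_equality)
  fix R
  assume R: "\<forall>x y. cinner (blinfun_apply R x) y = cinner x (blinfun_apply T y)"
  show "R = S"
  proof (rule blinfun_eqI)
    fix x
    have "inner (R x - S x) y = 0" for y
      using R assms by (simp add: inner_diff_left) (simp add: inner_eq_Re_cinner)
    then show "R x = S x"
      by (metis inner_eq_zero_iff eq_iff_diff_eq_0)
  qed
qed (use assms in blast)

lemma adj_inner:
  assumes T: "clinear_op T"
  shows "inner (adj T x) y = inner x (T y)" and clinear_adj: "clinear_op (adj T)"
proof -
  obtain S :: "'a \<Rightarrow>\<^sub>L 'a" where S: "\<And>x y. inner (S x) y = inner x (T y)"
    using bounded_form_representation[of "\<lambda>x y. inner x (T y)" "norm T"]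
    by (auto simp: inner_add_left inner_add_right blinfun.bilinear_simps abs_inner_op_le)
  have Sc: "S (scaleC \<i> x) = scaleC \<i> (S x)" for x
  proof -
    have "inner (S (scaleC \<i> x) - scaleC \<i> (S x)) y = 0" for y
      using T by (simp add: inner_diff_left S inner_scaleC_i_left clinear_op_iff_i)
    then show ?thesis
      by (metis inner_eq_zero_iff eq_iff_diff_eq_0)
  qed
  have "adj T = S"
    by (rule adj_eqI) (simp add: cinner_eq_inner S flip: Sc)
  then show "inner (adj T x) y = inner x (T y)" "clinear_op (adj T)"
    using S Sc by (auto simp: clinear_op_iff_i)
qed

lemma self_adjoint_iff: "self_adjoint T \<longleftrightarrow> hermitian T"
proof
  assume "self_adjoint T"
  then show "hermitian T"
    using adj_inner[of T] by (simp add: self_adjoint_def hermitian_def)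
next
  assume "hermitian T"
  then show "self_adjoint T"
    by (auto simp: self_adjoint_def hermitian_cinner intro!: adj_eqI)
qed

lemma adj_hermitian: "hermitian T \<Longrightarrow> adj T = T"
  using self_adjoint_iff self_adjoint_def by blast

lemma adj_compose:
  assumes "clinear_op S" "clinear_op T"
  shows "adj (S o\<^sub>L T) = adj T o\<^sub>L adj S"
proof (rule blinfun_eqI)
  fix x
  have "inner (adj (S o\<^sub>L T) x - (adj T o\<^sub>L adj S) x) y = 0" for y
    using assms by (simp add: inner_diff_left adj_inner)
  then show "adj (S o\<^sub>L T) x = (adj T o\<^sub>L adj S) x"
    by (metis inner_eq_zero_iff eq_iff_diff_eq_0)
qed

lemma norm_adj_le:
  assumes "clinear_op T"
  shows "norm (adj T) \<le> norm T"
proof (rule norm_blinfun_bound)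
  fix x
  have "(norm (adj T x))\<^sup>2 \<le> norm T * norm x * norm (adj T x)"
    using abs_inner_op_le[of x T "adj T x"] assms by (simp add: power2_norm_eq_inner adj_inner)
  then show "norm (adj T x) \<le> norm T * norm x"
    by (cases "adj T x = 0") (auto simp: power2_eq_square)
qed simp

text \<open>By polarization the convergent quadratic forms give a bounded bilinear form in the limit, which
  is represented by an operator. This replaces monotone convergence of operators in
  the construction of the Borel functional calculus.\<close>

lemma hermitian_weak_limit:
  fixes S :: "nat \<Rightarrow> ('h::complex_hilbert \<Rightarrow>\<^sub>L 'h)"
  assumes S: "\<And>n. hermitian (S n)"
    and bd: "\<And>n x. \<bar>inner x (S n x)\<bar> \<le> C * (norm x)\<^sup>2"
    and lim: "\<And>x. (\<lambda>n. inner x (S n x)) \<longlonglongrightarrow> q x"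
  shows "\<exists>R. hermitian R \<and> (\<forall>x. inner x (R x) = q x)"
proof -
  define B where "B x y = (q (x + y) - q (x - y)) / 4" for x y
  have B: "(\<lambda>n. inner x (S n y)) \<longlonglongrightarrow> B x y" for x y
    by (subst hermitian_polarization[OF S]) (unfold B_def, intro tendsto_intros lim, simp)
  have uniq: "B x y = l" if "(\<lambda>n. inner x (S n y)) \<longlonglongrightarrow> l" for x y l
    using LIMSEQ_unique[OF B that] .
  have "\<exists>R::'h \<Rightarrow>\<^sub>L 'h. \<forall>x y. inner (R x) y = B x y"
  proof (rule bounded_form_representation)
    show "B (x + y) z = B x z + B y z" for x y z
      by (rule uniq) (auto simp: inner_add_left intro!: tendsto_intros B)
    show "B x (y + z) = B x y + B x z" for x y z
      by (rule uniq) (auto simp: blinfun.bilinear_simps inner_add_right intro!: tendsto_intros B)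
    show "B (r *\<^sub>R x) z = r * B x z" for r x z
      by (rule uniq) (auto intro!: tendsto_intros B)
    show "B x (r *\<^sub>R z) = r * B x z" for r x z
      by (rule uniq) (auto simp: blinfun.bilinear_simps intro!: tendsto_intros B)
    show "\<bar>B x y\<bar> \<le> C * norm x * norm y" for x y
      by (rule LIMSEQ_le_const2[OF tendsto_rabs[OF B]])
        (use hermitian_inner_bound[OF S bd] in blast)
  qed
  then obtain R :: "'h \<Rightarrow>\<^sub>L 'h" where R: "\<And>x y. inner (R x) y = B x y"
    by blast
  have sym: "B x y = B y x" for x y
  proof (rule uniq)
    have "inner y (S n x) = inner x (S n y)" for n
      using hermitian_inner[OF S, of n x y] by (metis inner_commute)
    then show "(\<lambda>n. inner x (S n y)) \<longlonglongrightarrow> B y x"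
      using B[of y x] by simp
  qed
  have "R (scaleC \<i> x) = scaleC \<i> (R x)" for x
  proof -
    have "B (scaleC \<i> x) y = - B x (scaleC \<i> y)" for y
    proof (rule uniq)
      have "inner (scaleC \<i> x) (S n y) = - inner x (S n (scaleC \<i> y))" for n
        using S[of n] by (simp add: inner_scaleC_i_left hermitian_def clinear_op_iff_i)
      then show "(\<lambda>n. inner (scaleC \<i> x) (S n y)) \<longlonglongrightarrow> - B x (scaleC \<i> y)"
        by (auto intro!: tendsto_intros B)
    qed
    then have "inner (R (scaleC \<i> x) - scaleC \<i> (R x)) y = 0" for y
      by (simp add: inner_diff_left R inner_scaleC_i_left)
    then show ?thesis
      by (metis inner_eq_zero_iff eq_iff_diff_eq_0)
  qed
  moreover have "inner (R x) y = inner x (R y)" for x y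
    using R[of x y] R[of y x] sym[of x y] by (simp add: inner_commute)
  ultimately have "hermitian R"
    by (simp add: hermitian_def clinear_op_iff_i)
  moreover have "inner x (R x) = q x" for x
    using R[of x x] uniq[OF lim] by (simp add: inner_commute)
  ultimately show ?thesis
    by blast
qed

section \<open>Positive functionals on the polynomials of an interval\<close>

definition measure_on_interval :: "real \<Rightarrow> real \<Rightarrow> real measure \<Rightarrow> bool" where
  "measure_on_interval a b \<mu> \<longleftrightarrow>
     finite_measure \<mu> \<and> sets \<mu> = sets borel \<and> emeasure \<mu> (- {a..b}) = 0"

lemma measure_on_interval_sets [measurable_cong]:
  "measure_on_interval a b \<mu> \<Longrightarrow> sets \<mu> = sets borel"
  by (simp add: measure_on_interval_def)

lemma measure_on_interval_space: "measure_on_interval a b \<mu> \<Longrightarrow> space \<mu> = UNIV"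
  using sets_eq_imp_space_eq[of \<mu> borel] by (simp add: measure_on_interval_def)

lemma measure_on_interval_AE:
  assumes "measure_on_interval a b \<mu>"
  shows "AE x in \<mu>. x \<in> {a..b}"
proof (rule AE_I)
  show "{x \<in> space \<mu>. \<not> x \<in> {a..b}} \<subseteq> - {a..b}" by auto
qed (use assms in \<open>auto simp: measure_on_interval_def\<close>)

lemma measure_on_interval_measurable:
  "measure_on_interval a b \<mu> \<Longrightarrow> borel_measurable \<mu> = borel_measurable borel"
  by (rule measurable_cong_sets) (auto simp: measure_on_interval_def)

lemma measure_on_interval_integrable:
  fixes f :: "real \<Rightarrow> real"
  assumes \<mu>: "measure_on_interval a b \<mu>" and f: "f \<in> borel_measurable borel"
    and bd: "\<And>x. x \<in> {a..b} \<Longrightarrow> \<bar>f x\<bar> \<le> C"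
  shows "integrable \<mu> f"
proof -
  interpret finite_measure \<mu>
    using \<mu> by (simp add: measure_on_interval_def)
  show ?thesis
  proof (rule integrable_const_bound[of _ C])
    show "AE x in \<mu>. norm (f x) \<le> C"
      using measure_on_interval_AE[OF \<mu>] by eventually_elim (use bd in auto)
  qed (use f \<mu> in \<open>simp add: measure_on_interval_measurable\<close>)
qed

lemma poly_borel_measurable [measurable]: "poly (p::real poly) \<in> borel_measurable borel"
  by (intro borel_measurable_continuous_onI continuous_intros)

lemma poly_bounded_on_interval:
  obtains C where "0 \<le> C" "\<And>x. x \<in> {a..b} \<Longrightarrow> \<bar>poly (p::real poly) x\<bar> \<le> C"
proof -
  have "compact (poly p ` {a..b})"
    by (intro compact_continuous_image continuous_intros) auto
  then obtain B where "\<forall>y\<in>poly p ` {a..b}. norm y \<le> B"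
    using compact_imp_bounded bounded_iff by metis
  then show thesis
    by (intro that[of "max 0 B"]) (auto simp: le_max_iff_disj)
qed

lemma measure_on_interval_tendsto:
  fixes f :: "real \<Rightarrow> real"
  assumes \<mu>: "measure_on_interval a b \<mu>"
    and f: "f \<in> borel_measurable borel" "\<And>n. g n \<in> borel_measurable borel"
    and bd: "\<And>n x. x \<in> {a..b} \<Longrightarrow> \<bar>g n x\<bar> \<le> C"
    and lim: "\<And>x. x \<in> {a..b} \<Longrightarrow> (\<lambda>n. g n x) \<longlonglongrightarrow> f x"
  shows "(\<lambda>n. LINT x|\<mu>. g n x) \<longlonglongrightarrow> (LINT x|\<mu>. f x)"
proof -
  interpret finite_measure \<mu>
    using \<mu> by (simp add: measure_on_interval_def)
  show ?thesis
  proof (rule integral_dominated_convergence[where w = "\<lambda>_. C"])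
    show "AE x in \<mu>. (\<lambda>n. g n x) \<longlonglongrightarrow> f x"
      using measure_on_interval_AE[OF \<mu>] by eventually_elim (rule lim)
    show "AE x in \<mu>. norm (g n x) \<le> C" for n
      using measure_on_interval_AE[OF \<mu>] by eventually_elim (use bd in simp)
  qed (use f \<mu> in \<open>simp_all add: measure_on_interval_measurable\<close>)
qed

lemma poly_approximation:
  fixes f :: "real \<Rightarrow> real"
  assumes "continuous_on {a..b} f" "0 < e"
  obtains p where "\<And>x. x \<in> {a..b} \<Longrightarrow> \<bar>f x - poly p x\<bar> < e"
proof -
  obtain g where g: "real_polynomial_function g" "\<And>x. x \<in> {a..b} \<Longrightarrow> \<bar>f x - g x\<bar> < e"
    by (rule Stone_Weierstrass_real_polynomial_function[OF _ assms]) auto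
  then obtain c n where c: "g = (\<lambda>x. \<Sum>i\<le>n. c i * x ^ i)"
    using real_polynomial_function_iff_sum by blast
  have "poly (\<Sum>i\<le>n. monom (c i) i) x = g x" for x
    by (simp add: c poly_sum poly_monom)
  with g show thesis
    by (intro that[of "\<Sum>i\<le>n. monom (c i) i"]) auto
qed

lemma poly_approximation_sequence:
  fixes f :: "real \<Rightarrow> real"
  assumes "continuous_on {a..b} f"
  obtains p where "\<And>n x. x \<in> {a..b} \<Longrightarrow> \<bar>f x - poly (p n) x\<bar> < inverse (real (Suc n))"
proof -
  have "\<exists>p. \<forall>x\<in>{a..b}. \<bar>f x - poly p x\<bar> < inverse (real (Suc n))" for n
    using poly_approximation[OF assms, of "inverse (real (Suc n))"] by (metis inverse_positive_iff_positive of_nat_0_less_iff zero_less_Suc)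
  then show thesis
    using that by metis
qed

text \<open>Approximate steep ramps uniformly. Since the half-lines generate the Borel sets, whatever is known
  for polynomials and stable under bounded limits reaches all Borel sets through this lemma.\<close>

lemma poly_tendsto_indicator_atMost:
  obtains q :: "nat \<Rightarrow> real poly" where
    "\<And>n x. x \<in> {a..b} \<Longrightarrow> \<bar>poly (q n) x\<bar> \<le> 2"
    "\<And>x. x \<in> {a..b} \<Longrightarrow> (\<lambda>n. poly (q n) x) \<longlonglongrightarrow> indicator {..l} x"
proof -
  define r where "r n x = max 0 (min 1 (1 - real n * (x - l)))" for n x
  have "\<exists>p. \<forall>x\<in>{a..b}. \<bar>r n x - poly p x\<bar> < inverse (real (Suc n))" for n
  proof -
    have "continuous_on {a..b} (r n)"
      unfolding r_def by (intro continuous_intros)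
    then show ?thesis
      using poly_approximation[of a b "r n" "inverse (real (Suc n))"]
      by (metis inverse_positive_iff_positive of_nat_0_less_iff zero_less_Suc)
  qed
  then obtain q where q: "\<And>n x. x \<in> {a..b} \<Longrightarrow> \<bar>r n x - poly (q n) x\<bar> < inverse (real (Suc n))"
    by metis
  have le1: "inverse (real (Suc n)) \<le> 1" for n
    by (simp add: field_simps)
  have r01: "0 \<le> r n x" "r n x \<le> 1" for n x
    by (auto simp: r_def)
  have "\<bar>poly (q n) x\<bar> \<le> 2" if "x \<in> {a..b}" for n x
    using q[OF that, of n] le1[of n] r01[of n x] by linarith
  moreover have "(\<lambda>n. poly (q n) x) \<longlonglongrightarrow> indicator {..l} x" if x: "x \<in> {a..b}" for x
  proof -
    have "\<forall>\<^sub>F n in sequentially. r n x = indicator {..l} x"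
    proof (cases "x \<le> l")
      case True
      have "real n * (x - l) \<le> 0" for n
        using True by (intro mult_nonneg_nonpos) auto
      then have "r n x = 1" for n
        by (simp add: r_def min_def max_def)
      with True show ?thesis
        by simp
    next
      case False
      then obtain N where N: "1 < real N * (x - l)"
        using reals_Archimedean3[of "x - l"] by auto
      have "r n x = 0" if "n \<ge> N" for n
      proof -
        have "real N * (x - l) \<le> real n * (x - l)"
          using that False by (intro mult_right_mono) auto
        then show ?thesis
          using N by (simp add: r_def min_def max_def)
      qed
      then show ?thesis
        using False by (auto simp: eventually_sequentially)
    qed
    then have "(\<lambda>n. r n x) \<longlonglongrightarrow> indicator {..l} x"
      by (rule tendsto_eventually)
    moreover have "(\<lambda>n. poly (q n) x - r n x) \<longlonglongrightarrow> 0"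
    proof (rule Lim_null_comparison)
      show "\<forall>\<^sub>F n in sequentially. norm (poly (q n) x - r n x) \<le> inverse (real (Suc n))"
        using q[OF x] by (auto intro!: always_eventually simp: abs_minus_commute less_imp_le)
    qed (rule LIMSEQ_inverse_real_of_nat)
    ultimately have "(\<lambda>n. (poly (q n) x - r n x) + r n x) \<longlonglongrightarrow> 0 + indicator {..l} x"
      by (intro tendsto_add)
    then show ?thesis
      by simp
  qed
  ultimately show thesis
    by (rule that)
qed

text \<open>Polynomial integrals determine the integrals of half-line indicators, by bounded convergence.\<close>

lemma measure_on_interval_eqI:
  assumes \<mu>: "measure_on_interval a b \<mu>" and \<nu>: "measure_on_interval a b \<nu>"
    and eq: "\<And>p. (LINT x|\<mu>. poly p x) = (LINT x|\<nu>. poly p x)"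
  shows "\<mu> = \<nu>"
proof (rule measure_eqI_lessThan)
  interpret \<mu>: finite_measure \<mu> using \<mu> by (simp add: measure_on_interval_def)
  interpret \<nu>: finite_measure \<nu> using \<nu> by (simp add: measure_on_interval_def)
  show s: "sets \<mu> = sets borel" "sets \<nu> = sets borel"
    using \<mu> \<nu> by (auto simp: measure_on_interval_def)
  have sp: "space \<mu> = UNIV" "space \<nu> = UNIV"
    using \<mu> \<nu> by (auto simp: measure_on_interval_space)
  show "emeasure \<mu> {l<..} < \<infinity>" for l
    by (simp add: \<mu>.emeasure_eq_measure)
  have at: "measure \<mu> {..l} = measure \<nu> {..l}" for l
  proof -
    obtain q where q: "\<And>n x. x \<in> {a..b} \<Longrightarrow> \<bar>poly (q n) x\<bar> \<le> 2"
      "\<And>x. x \<in> {a..b} \<Longrightarrow> (\<lambda>n. poly (q n) x) \<longlonglongrightarrow> indicator {..l} x"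
      using poly_tendsto_indicator_atMost[of a b l] by blast
    have "(\<lambda>n. LINT x|\<mu>. poly (q n) x) \<longlonglongrightarrow> (LINT x|\<mu>. indicator {..l} x)"
      by (rule measure_on_interval_tendsto[OF \<mu> _ _ q]) auto
    moreover have "(\<lambda>n. LINT x|\<nu>. poly (q n) x) \<longlonglongrightarrow> (LINT x|\<nu>. indicator {..l} x)"
      by (rule measure_on_interval_tendsto[OF \<nu> _ _ q]) auto
    ultimately show ?thesis
      using LIMSEQ_unique by (fastforce simp: eq sp)
  qed
  have "measure \<mu> UNIV = measure \<nu> UNIV"
    using eq[of 1] by (simp add: sp)
  then have "measure \<mu> (UNIV - {..l}) = measure \<nu> (UNIV - {..l})" for l
    using \<mu>.finite_measure_compl[of "{..l}"] \<nu>.finite_measure_compl[of "{..l}"] at[of l]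
    by (simp add: sp s)
  moreover have "UNIV - {..l} = {l<..}" for l :: real
    by auto
  ultimately show "emeasure \<mu> {l<..} = emeasure \<nu> {l<..}" for l
    by (simp add: \<mu>.emeasure_eq_measure \<nu>.emeasure_eq_measure)
qed

text \<open>The Riesz--Markov theorem for polynomials on an interval. The Bernstein polynomials turn the
  functional into finitely supported measures, whose integrals converge because the Bernstein
  operators converge uniformly; a weak limit point is the representing measure.\<close>

lemma positive_functional_measure:
  fixes \<Lambda> :: "real poly \<Rightarrow> real"
  assumes ab: "a < b"
    and add: "\<And>p q. \<Lambda> (p + q) = \<Lambda> p + \<Lambda> q"
    and smult: "\<And>c p. \<Lambda> (smult c p) = c * \<Lambda> p"
    and pos: "\<And>p. (\<And>x. x \<in> {a..b} \<Longrightarrow> 0 \<le> poly p x) \<Longrightarrow> 0 \<le> \<Lambda> p"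
  shows "\<exists>\<mu>. measure_on_interval a b \<mu> \<and> (\<forall>p. (LINT x|\<mu>. poly p x) = \<Lambda> p)"
proof -
  have zero: "\<Lambda> 0 = 0"
    using smult[of 0 0] by simp
  have diff: "\<Lambda> (p - q) = \<Lambda> p - \<Lambda> q" for p q
    using add[of "p - q" q] by simp
  have sum: "\<Lambda> (\<Sum>i\<in>A. f i) = (\<Sum>i\<in>A. \<Lambda> (f i))" for f :: "nat \<Rightarrow> real poly" and A
    by (induction A rule: infinite_finite_induct) (auto simp: zero add)
  have bound: "\<bar>\<Lambda> p\<bar> \<le> C * \<Lambda> 1" if "\<And>x. x \<in> {a..b} \<Longrightarrow> \<bar>poly p x\<bar> \<le> C" for p C
  proof -
    have "0 \<le> \<Lambda> (smult C 1 - p)" "0 \<le> \<Lambda> (smult C 1 + p)"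
      using that by (intro pos; force simp: abs_le_iff)+
    then show ?thesis
      using smult[of C 1] by (simp add: diff add abs_le_iff)
  qed
  define L where "L = \<Lambda> 1"
  have "0 \<le> L"
    unfolding L_def by (rule pos) auto
  show ?thesis
  proof (cases "L = 0")
    case True
    have "\<Lambda> p = 0" for p
    proof -
      obtain C where "\<And>x. x \<in> {a..b} \<Longrightarrow> \<bar>poly p x\<bar> \<le> C"
        using poly_bounded_on_interval by blast
      then show ?thesis
        using bound[of p C] True by (simp add: L_def)
    qed
    then show ?thesis
      by (intro exI[of _ "null_measure borel"])
        (auto simp: measure_on_interval_def finite_measureI)
  next
    case False
    with \<open>0 \<le> L\<close> have L: "0 < L" by simp
    define bern where "bern n k = smult (real (n choose k))
        ([:- a / (b - a), 1 / (b - a):] ^ k * [:b / (b - a), - 1 / (b - a):] ^ (n - k))" for n k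
    define pt where "pt n k = a + (b - a) * (real k / real n)" for n k :: nat
    have bern: "poly (bern n k) x = Bernstein n k ((x - a) / (b - a))" for n k x
    proof -
      have "1 = b / (b - a) - a / (b - a)"
        using ab by (simp flip: diff_divide_distrib)
      then have "b / (b - a) - x / (b - a) = 1 - (x - a) / (b - a)"
        by (simp add: diff_divide_distrib)
      then have "poly [:- a / (b - a), 1 / (b - a):] x = (x - a) / (b - a)"
        "poly [:b / (b - a), - 1 / (b - a):] x = 1 - (x - a) / (b - a)"
        by (simp_all add: diff_divide_distrib)
      then show ?thesis
        by (simp only: bern_def Bernstein_def poly_smult poly_mult poly_power mult.assoc)
    qed
    have pt: "pt n k \<in> {a..b}" if "k \<le> n" for n k
    proof -
      have "0 \<le> real k / real n" "real k / real n \<le> 1"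
        using that by (auto simp: divide_le_eq_1)
      then have "0 \<le> (b - a) * (real k / real n)" "(b - a) * (real k / real n) \<le> (b - a) * 1"
        using ab by (auto intro!: mult_nonneg_nonneg mult_left_mono simp del: mult_1_right times_divide_eq_right)
      then show ?thesis
        by (simp add: pt_def)
    qed
    define w where "w n k = \<Lambda> (bern n k) / L" for n k
    have w: "0 \<le> w n k" for n k
      unfolding w_def using L ab
      by (intro divide_nonneg_pos pos) (auto simp: bern intro!: Bernstein_nonneg)
    have sum_w: "(\<Sum>k\<le>n. w n k) = 1" for n
    proof -
      have "(\<Sum>k\<le>n. bern n k) = 1"
        by (intro poly_eq_poly_eq_iff[THEN iffD1] ext) (simp add: poly_sum bern)
      then show ?thesis
        using L sum[of "bern n" "{..n}"] by (simp add: w_def L_def flip: sum_divide_distrib)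
    qed
    define \<nu> where "\<nu> n = distr (point_measure {..n} (w n)) borel (pt n)" for n
    have rd: "real_distribution (\<nu> n)" for n
    proof -
      have "prob_space (point_measure {..n} (w n))"
        by (rule prob_spaceI)
          (simp add: space_point_measure emeasure_point_measure_finite sum_w w sum_ennreal)
      then have "prob_space (\<nu> n)"
        unfolding \<nu>_def by (rule prob_space.prob_space_distr) (simp add: point_measure_def)
      then show ?thesis
        by (simp add: real_distribution_def real_distribution_axioms_def \<nu>_def)
    qed
    have int: "(LINT x|\<nu> n. f x) = (\<Sum>k\<le>n. w n k * f (pt n k))"
      if "f \<in> borel_measurable borel" for n and f :: "real \<Rightarrow> real"
      unfolding \<nu>_def using that w
      by (subst integral_distr) (auto simp: lebesgue_integral_point_measure_finite point_measure_def[of _ "\<lambda>x. ennreal _"])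
    have "tight \<nu>"
      unfolding tight_def
    proof (intro conjI allI impI)
      fix e :: real
      assume e: "0 < e"
      have "measure (\<nu> n) {a - 1<..b} = 1" for n
      proof -
        interpret real_distribution "\<nu> n" by (rule rd)
        have "measure (\<nu> n) {a - 1<..b} = (LINT x|\<nu> n. indicator {a - 1<..b} x)"
          by simp
        also have "\<dots> = (\<Sum>k\<le>n. w n k * indicator {a - 1<..b} (pt n k))"
          by (rule int) simp
        also have "\<dots> = (\<Sum>k\<le>n. w n k)"
          using pt by (intro sum.cong) (auto simp: indicator_def, force)
        finally show ?thesis
          by (simp add: sum_w)
      qed
      with e ab show "\<exists>a b. a < b \<and> (\<forall>n. 1 - e < measure (\<nu> n) {a<..b})"
        by (intro exI[of _ "a - 1"] exI[of _ b]) auto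
    qed (rule rd)
    then obtain r M where r: "strict_mono r" and M: "real_distribution M"
      and wc: "weak_conv_m (\<nu> \<circ> id \<circ> r) M"
      using tight_imp_convergent_subsubsequence[of \<nu> id] strict_mono_id by blast
    interpret M: real_distribution M by (rule M)
    have conv: "(\<lambda>n. LINT x|\<nu> (r n). f x) \<longlonglongrightarrow> (LINT x|M. f x)"
      if "\<And>x. isCont f x" "\<And>x. norm (f x) \<le> B" for f :: "real \<Rightarrow> real" and B
      using weak_conv_imp_integral_bdd_continuous_conv[of "\<nu> \<circ> id \<circ> r" M f B, OF _ M wc that] rd
      by simp
    define clamp where "clamp x = max a (min b x)" for x :: real
    have clamp_in: "clamp x \<in> {a..b}" for x
      using ab by (auto simp: clamp_def)
    have clamp_cont: "isCont clamp x" for x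
      unfolding clamp_def by (intro continuous_intros)
    have clamp_id: "x \<in> {a..b} \<Longrightarrow> clamp x = x" for x
      by (auto simp: clamp_def)
    have AE_M: "AE x in M. x \<in> {a..b}"
    proof -
      define d where "d x = min 1 \<bar>x - clamp x\<bar>" for x
      have d_cont: "isCont d x" for x
        unfolding d_def by (intro continuous_intros clamp_cont)
      have d_meas [measurable]: "d \<in> borel_measurable borel"
        by (intro borel_measurable_continuous_onI continuous_at_imp_continuous_on ballI d_cont)
      have "(LINT x|\<nu> n. d x) = 0" for n
        unfolding int[OF d_meas] by (rule sum.neutral) (use pt clamp_id in \<open>auto simp: d_def\<close>)
      then have "(LINT x|M. d x) = 0"
        using LIMSEQ_unique[OF conv[of d 1]] d_cont by (auto simp: d_def)
      moreover have "integrable M d"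
        by (rule M.integrable_const_bound[of _ 1]) (auto simp: d_def)
      ultimately have "AE x in M. d x = 0"
        by (subst (asm) integral_nonneg_eq_0_iff_AE) (auto simp: d_def)
      then show ?thesis
      proof eventually_elim
        case (elim x)
        then have "x = clamp x"
          by (auto simp: d_def min_def split: if_splits)
        then show ?case
          using clamp_in[of x] by simp
      qed
    qed
    have poly_int: "(LINT x|M. poly p x) = \<Lambda> p / L" for p
    proof -
      define f where "f x = poly p (clamp x)" for x
      obtain C where C: "\<And>x. x \<in> {a..b} \<Longrightarrow> \<bar>poly p x\<bar> \<le> C"
        using poly_bounded_on_interval by blast
      have f_cont: "isCont f x" for x
        unfolding f_def by (intro continuous_intros clamp_cont)
      have f_meas: "f \<in> borel_measurable borel"
        by (intro borel_measurable_continuous_onI continuous_at_imp_continuous_on ballI f_cont)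
      have "(\<lambda>n. LINT x|\<nu> n. f x) \<longlonglongrightarrow> \<Lambda> p / L"
      proof (rule LIMSEQ_I)
        fix e :: real
        assume e: "0 < e"
        define g where "g y = poly p (a + (b - a) * y)" for y
        have "continuous_on {0..1} g"
          unfolding g_def by (intro continuous_intros)
        then obtain N where N: "\<And>n x. N \<le> n \<Longrightarrow> x \<in> {0..1} \<Longrightarrow>
            \<bar>g x - (\<Sum>k\<le>n. g (real k / real n) * Bernstein n k x)\<bar> < e / 2"
          using Bernstein_Weierstrass[of g "e / 2"] e by auto
        have "norm ((LINT x|\<nu> n. f x) - \<Lambda> p / L) < e" if "n \<ge> N" for n
        proof -
          define q where "q = (\<Sum>k\<le>n. smult (poly p (pt n k)) (bern n k))"
          have "\<bar>poly (p - q) x\<bar> \<le> e / 2" if x: "x \<in> {a..b}" for x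
          proof -
            have "(x - a) / (b - a) \<in> {0..1}"
              using x ab by auto
            moreover have "g ((x - a) / (b - a)) = poly p x"
              using ab by (simp add: g_def)
            moreover have "(\<Sum>k\<le>n. g (real k / real n) * Bernstein n k ((x - a) / (b - a))) = poly q x"
              by (simp add: q_def poly_sum bern g_def pt_def)
            ultimately show ?thesis
              using N[OF \<open>n \<ge> N\<close>, of "(x - a) / (b - a)"] by simp
          qed
          then have "\<bar>\<Lambda> (p - q)\<bar> \<le> e / 2 * L"
            unfolding L_def by (rule bound)
          moreover have "\<Lambda> q = L * (LINT x|\<nu> n. f x)"
            unfolding int[OF f_meas] q_def sum sum_distrib_left using L pt clamp_id
            by (intro sum.cong) (auto simp: smult w_def f_def)
          ultimately have "\<bar>\<Lambda> p - L * (LINT x|\<nu> n. f x)\<bar> / L \<le> e / 2"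
            using L by (simp add: diff pos_divide_le_eq)
          moreover have "\<Lambda> p / L - (LINT x|\<nu> n. f x) = (\<Lambda> p - L * (LINT x|\<nu> n. f x)) / L"
            using L by (simp add: diff_divide_distrib)
          ultimately have "\<bar>\<Lambda> p / L - (LINT x|\<nu> n. f x)\<bar> \<le> e / 2"
            using L by (simp add: abs_divide)
          then show ?thesis
            using e by (simp add: abs_minus_commute)
        qed
        then show "\<exists>N. \<forall>n\<ge>N. norm ((LINT x|\<nu> n. f x) - \<Lambda> p / L) < e"
          by blast
      qed
      then have "(\<lambda>n. LINT x|\<nu> (r n). f x) \<longlonglongrightarrow> \<Lambda> p / L"
        using LIMSEQ_subseq_LIMSEQ[OF _ r] by (force simp: o_def)
      moreover have "(\<lambda>n. LINT x|\<nu> (r n). f x) \<longlonglongrightarrow> (LINT x|M. f x)"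
        by (rule conv[of f C]) (use f_cont C clamp_in in \<open>auto simp: f_def\<close>)
      ultimately have "(LINT x|M. f x) = \<Lambda> p / L"
        using LIMSEQ_unique by blast
      moreover have "(LINT x|M. f x) = (LINT x|M. poly p x)"
      proof (rule integral_cong_AE)
        show "AE x in M. f x = poly p x"
          using AE_M by eventually_elim (simp add: f_def clamp_id)
      qed (use f_meas in auto)
      ultimately show ?thesis
        by simp
    qed
    define \<mu> where "\<mu> = density M (\<lambda>_. ennreal L)"
    have "emeasure M (- {a..b}) = 0"
    proof -
      have "emeasure M {x \<in> space M. \<not> x \<in> {a..b}} = 0"
        using AE_M by (subst (asm) AE_iff_measurable[OF _ refl]) auto
      then show ?thesis
        by (simp add: Compl_eq set_diff_eq)
    qed
    then have "measure_on_interval a b \<mu>"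
      using L by (auto simp: measure_on_interval_def \<mu>_def emeasure_density nn_integral_cmult
          M.emeasure_eq_measure ennreal_mult_eq_top_iff intro!: finite_measureI)
    moreover have "(LINT x|\<mu>. poly p x) = \<Lambda> p" for p
      unfolding \<mu>_def using L by (subst integral_density) (auto simp: poly_int)
    ultimately show ?thesis
      by blast
  qed
qed

section \<open>Polynomials in a symmetric operator\<close>

text \<open>Horner's scheme, with composition as the product and multiples of the identity as constants.\<close>

definition poly_op :: "real poly \<Rightarrow> ('h::complex_hilbert \<Rightarrow>\<^sub>L 'h) \<Rightarrow> ('h \<Rightarrow>\<^sub>L 'h)" where
  "poly_op p T = fold_coeffs (\<lambda>c S. c *\<^sub>R id_blinfun + (T o\<^sub>L S)) p 0"

lemma poly_op_0 [simp]: "poly_op 0 T = 0"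
  by (simp add: poly_op_def)

lemma poly_op_pCons [simp]: "poly_op (pCons c p) T = c *\<^sub>R id_blinfun + (T o\<^sub>L poly_op p T)"
  by (cases "p = 0 \<and> c = 0") (auto simp: poly_op_def)

lemma poly_op_add: "poly_op (p + q) T = poly_op p T + poly_op q T"
proof (induction p q rule: poly_induct2)
  case (pCons c p d q)
  then show ?case
    by (intro blinfun_eqI) (simp add: blinfun.bilinear_simps algebra_simps)
qed auto

lemma poly_op_smult: "poly_op (smult c p) T = c *\<^sub>R poly_op p T"
proof (induction p)
  case (pCons d p)
  then show ?case
    by (intro blinfun_eqI) (simp add: blinfun.bilinear_simps algebra_simps)
qed auto

lemma poly_op_uminus: "poly_op (- p) T = - poly_op p T"
  using poly_op_smult[of "-1" p T] by simp

lemma poly_op_mult: "poly_op (p * q) T = poly_op p T o\<^sub>L poly_op q T"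
proof (induction p)
  case (pCons d p)
  then show ?case
    by (intro blinfun_eqI) (simp add: poly_op_add poly_op_smult blinfun.bilinear_simps)
qed auto

lemma poly_op_1 [simp]: "poly_op 1 T = id_blinfun"
  by (simp add: one_pCons)

lemma poly_op_commute:
  assumes "S o\<^sub>L T = T o\<^sub>L S"
  shows "S o\<^sub>L poly_op p T = poly_op p T o\<^sub>L S"
proof (induction p)
  case (pCons d p)
  have "S (T y) = T (S y)" for y
    using assms by (metis blinfun_apply_blinfun_compose)
  moreover have "S (poly_op p T y) = poly_op p T (S y)" for y
    using pCons by (metis blinfun_apply_blinfun_compose)
  ultimately show ?case
    by (intro blinfun_eqI) (simp add: blinfun.bilinear_simps)
qed (simp add: blinfun_eqI)

lemma poly_op_hermitian [simp, intro]:
  assumes T: "hermitian T"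
  shows "hermitian (poly_op p T)"
proof (induction p)
  case (pCons d p)
  have "poly_op p T (T y) = T (poly_op p T y)" for y
    using poly_op_commute[of T T p] by (metis blinfun_apply_blinfun_compose)
  then have "hermitian (T o\<^sub>L poly_op p T)"
    using T pCons by (simp add: hermitian_def)
  then show ?case
    by simp
qed auto

lemma poly_nonneg_punctured:
  fixes p :: "real poly"
  assumes "a < b" "c \<in> {a..b}" and nn: "\<And>x. x \<in> {a..b} \<Longrightarrow> x \<noteq> c \<Longrightarrow> 0 \<le> poly p x"
  shows "0 \<le> poly p c"
proof -
  have "c islimpt {a..b}"
    using assms by (simp add: islimpt_Icc)
  then have "c islimpt {x. 0 \<le> poly p x}"
    unfolding islimpt_def using nn by blast
  moreover have "closed {x. 0 \<le> poly p x}"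
    by (intro closed_Collect_le continuous_intros)
  ultimately show ?thesis
    by (auto simp: closed_limpt)
qed

text \<open>Induction on the degree: subtract the minimum on the interval and divide by the root thereby
  created. An interior root is double and is absorbed by a sandwich; a root at an end point leaves
  one linear factor, so the statement is proved jointly for the products with the two
  linear factors.\<close>

lemma poly_op_nonneg:
  assumes ab: "a < b" and T: "hermitian T"
    and lo: "\<And>x. a * (norm x)\<^sup>2 \<le> inner x (T x)" and up: "\<And>x. inner x (T x) \<le> b * (norm x)\<^sup>2"
    and p: "\<And>x. x \<in> {a..b} \<Longrightarrow> 0 \<le> poly p x"
  shows "0 \<le> inner x (poly_op p T x)"
proof -
  define P where "P r \<longleftrightarrow> (\<forall>x. 0 \<le> inner x (poly_op r T x))" for r
  have P_add: "P (r + s)" if "P r" "P s" for r s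
    using that by (auto simp: P_def poly_op_add blinfun.bilinear_simps inner_add_right)
  have P_smult: "P (smult c r)" if "P r" "0 \<le> c" for c r
    using that by (auto simp: P_def poly_op_smult blinfun.bilinear_simps)
  have P_sq: "P (q * r * q)" if "P r" for q r
    unfolding P_def
  proof
    fix x
    have "inner x (poly_op (q * r * q) T x)
        = inner (poly_op q T x) (poly_op r T (poly_op q T x))"
      by (simp add: poly_op_mult hermitian_inner[OF poly_op_hermitian[OF T]])
    then show "0 \<le> inner x (poly_op (q * r * q) T x)"
      using that by (simp add: P_def)
  qed
  define \<alpha> \<beta> where "\<alpha> = [:- a, 1:]" and "\<beta> = [:b, -1:]"
  have P_1: "P 1"
    by (simp add: P_def)
  have P_\<alpha>: "P \<alpha>" and P_\<beta>: "P \<beta>"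
    using lo up by (simp_all add: P_def \<alpha>_def \<beta>_def blinfun.bilinear_simps inner_add_right
        inner_diff_right power2_norm_eq_inner)
  have P_\<alpha>\<beta>: "P (\<alpha> * \<beta>)"
  proof -
    have "smult (1 / (b - a)) (\<alpha> * \<beta> * \<alpha> + \<beta> * \<alpha> * \<beta>) = smult (1 / (b - a)) (\<alpha> * \<beta> * (\<alpha> + \<beta>))"
      by (simp add: algebra_simps)
    also have "\<alpha> + \<beta> = [:b - a:]"
      by (simp add: \<alpha>_def \<beta>_def)
    also have "smult (1 / (b - a)) (\<alpha> * \<beta> * [:b - a:]) = \<alpha> * \<beta>"
      using ab by simp
    finally show ?thesis
      using ab P_smult[OF P_add[OF P_sq[OF P_\<beta>, of \<alpha>] P_sq[OF P_\<alpha>, of \<beta>]], of "1 / (b - a)"] by simp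
  qed
  define Q where "Q r \<longleftrightarrow> P r \<and> P (\<alpha> * r) \<and> P (\<beta> * r) \<and> P (\<alpha> * \<beta> * r)" for r
  have Q_1: "Q 1"
    by (simp add: Q_def P_1 P_\<alpha> P_\<beta> P_\<alpha>\<beta>)
  have Q_add: "Q (r + s)" if "Q r" "Q s" for r s
    using that by (auto simp: Q_def distrib_left intro: P_add)
  have Q_smult: "Q (smult c r)" if "Q r" "0 \<le> c" for c r
    using that by (auto simp: Q_def intro: P_smult)
  have Q_sq: "Q (q * r * q)" if "Q r" for q r
  proof -
    have eq: "s * (q * r * q) = q * (s * r) * q" for s
      by (simp add: algebra_simps)
    show ?thesis
      using that unfolding Q_def eq by (auto intro: P_sq)
  qed
  have Q_\<alpha>: "Q (\<alpha> * r)" if "Q r" for r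
    using that P_sq[of r \<alpha>] P_sq[of "\<beta> * r" \<alpha>] by (simp add: Q_def algebra_simps)
  have Q_\<beta>: "Q (\<beta> * r)" if "Q r" for r
    using that P_sq[of r \<beta>] P_sq[of "\<alpha> * r" \<beta>] by (simp add: Q_def algebra_simps)
  have "Q p"
    using p
  proof (induction "degree p" arbitrary: p rule: less_induct)
    case less
    show ?case
    proof (cases "degree p = 0")
      case True
      then obtain c where c: "p = [:c:]"
        by (rule degree_eq_zeroE)
      then have "0 \<le> c"
        using less.prems[of a] ab by simp
      then show ?thesis
        using Q_smult[OF Q_1, of c] c by (simp add: one_pCons)
    next
      case False
      have "\<exists>c\<in>{a..b}. \<forall>x\<in>{a..b}. poly p c \<le> poly p x"
        using ab by (intro continuous_attains_inf continuous_intros) auto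
      then obtain c where c: "c \<in> {a..b}" and cmin: "\<And>x. x \<in> {a..b} \<Longrightarrow> poly p c \<le> poly p x"
        by blast
      define m where "m = poly p c"
      have m: "0 \<le> m"
        unfolding m_def by (rule less.prems[OF c])
      have "poly (p - [:m:]) c = 0"
        by (simp add: m_def)
      then obtain q where q: "p - [:m:] = [:- c, 1:] * q"
        unfolding poly_eq_0_iff_dvd dvd_def by blast
      then have p_eq: "p = smult m 1 + [:- c, 1:] * q"
        by (simp add: algebra_simps one_pCons)
      have q0: "q \<noteq> 0"
        using False p_eq by (auto simp: one_pCons)
      have deg: "degree p = Suc (degree q)"
      proof -
        have "degree p = degree (p - [:m:] + [:m:])"
          by simp
        also have "\<dots> = degree (p - [:m:])"
          using q q0 by (intro degree_add_eq_left) (simp add: degree_mult_eq del: mult_pCons_left)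
        also have "\<dots> = Suc (degree q)"
          using q q0 by (simp add: degree_mult_eq del: mult_pCons_left)
        finally show ?thesis .
      qed
      have sgn: "0 \<le> (x - c) * poly q x" if "x \<in> {a..b}" for x
      proof -
        have "poly (p - [:m:]) x = (x - c) * poly q x"
          by (simp only: q) (simp add: algebra_simps)
        then show ?thesis
          using cmin[OF that] by (simp add: m_def)
      qed
      consider "c = a" | "c = b" | "a < c" "c < b"
        using c by fastforce
      then show ?thesis
      proof cases
        case 1
        have nn: "0 \<le> poly q x" if "x \<in> {a..b}" "x \<noteq> a" for x
          using sgn[of x] that 1 by (auto simp: zero_le_mult_iff)
        have nn': "0 \<le> poly q x" if "x \<in> {a..b}" for x
          using nn[OF that] poly_nonneg_punctured[OF ab _ nn, of a] ab by (cases "x = a") auto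
        have "Q q"
          using nn' by (intro less.hyps) (auto simp: deg)
        moreover have "\<alpha> * q = [:- c, 1:] * q"
          by (simp add: \<alpha>_def 1)
        ultimately show ?thesis
          using Q_add[OF Q_smult[OF Q_1 m] Q_\<alpha>[of q]] by (simp only: p_eq[symmetric])
      next
        case 2
        have nn: "0 \<le> poly (- q) x" if "x \<in> {a..b}" "x \<noteq> b" for x
          using sgn[of x] that 2 by (auto simp: zero_le_mult_iff)
        have nn': "0 \<le> poly (- q) x" if "x \<in> {a..b}" for x
          using nn[OF that] poly_nonneg_punctured[OF ab _ nn, of b] ab by (cases "x = b") auto
        have "Q (- q)"
          using nn' by (intro less.hyps) (auto simp: deg)
        moreover have "\<beta> * (- q) = [:- c, 1:] * q"
          by (simp add: \<beta>_def 2)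
        ultimately show ?thesis
          using Q_add[OF Q_smult[OF Q_1 m] Q_\<beta>[of "- q"]] by (simp only: p_eq[symmetric])
      next
        case 3
        have "0 \<le> poly q c"
        proof (rule poly_nonneg_punctured[of c b])
          show "0 \<le> poly q x" if "x \<in> {c..b}" "x \<noteq> c" for x
            using sgn[of x] that 3 by (auto simp: zero_le_mult_iff)
        qed (use 3 in auto)
        moreover have "0 \<le> poly (- q) c"
        proof (rule poly_nonneg_punctured[of a c])
          show "0 \<le> poly (- q) x" if "x \<in> {a..c}" "x \<noteq> c" for x
            using sgn[of x] that 3 by (auto simp: zero_le_mult_iff)
        qed (use 3 in auto)
        ultimately have "poly q c = 0"
          by simp
        then obtain r where r: "q = [:- c, 1:] * r"
          unfolding poly_eq_0_iff_dvd dvd_def by blast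
        have nn: "0 \<le> poly r x" if "x \<in> {a..b}" "x \<noteq> c" for x
        proof -
          have "0 \<le> (x - c)\<^sup>2 * poly r x"
            using sgn[OF that(1)] r by (simp add: power2_eq_square algebra_simps)
          then show ?thesis
            using that by (auto simp: zero_le_mult_iff)
        qed
        have nn': "0 \<le> poly r x" if "x \<in> {a..b}" for x
          using nn[OF that] poly_nonneg_punctured[OF ab c nn] by (cases "x = c") auto
        have "degree r < degree p"
          using q0 deg unfolding r by (auto simp: degree_mult_eq simp del: mult_pCons_left)
        then have "Q r"
          using nn' by (intro less.hyps) auto
        then have "Q ([:- c, 1:] * r * [:- c, 1:])"
          by (rule Q_sq)
        then show ?thesis
          using Q_add[OF Q_smult[OF Q_1 m]] p_eq r by (metis mult.assoc mult.commute)
      qed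
    qed
  qed
  then show ?thesis
    by (simp add: Q_def P_def)
qed

section \<open>Bounded Borel functions on an interval\<close>

definition bounded_borel_on :: "real \<Rightarrow> real \<Rightarrow> (real \<Rightarrow> real) \<Rightarrow> bool" where
  "bounded_borel_on a b f \<longleftrightarrow> f \<in> borel_measurable borel \<and> (\<exists>C. \<forall>x\<in>{a..b}. \<bar>f x\<bar> \<le> C)"

lemma bounded_borel_onI:
  "f \<in> borel_measurable borel \<Longrightarrow> (\<And>x. x \<in> {a..b} \<Longrightarrow> \<bar>f x\<bar> \<le> C) \<Longrightarrow> bounded_borel_on a b f"
  unfolding bounded_borel_on_def by blast

lemma bounded_borel_on_bound:
  assumes "bounded_borel_on a b f"
  obtains C where "0 \<le> C" "\<And>x. x \<in> {a..b} \<Longrightarrow> \<bar>f x\<bar> \<le> C"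
proof -
  obtain C where "\<forall>x\<in>{a..b}. \<bar>f x\<bar> \<le> C"
    using assms by (auto simp: bounded_borel_on_def)
  then show thesis
    by (intro that[of "max 0 C"]) (auto simp: le_max_iff_disj)
qed

lemma bounded_borel_on_measurable [measurable_dest]:
  "bounded_borel_on a b f \<Longrightarrow> f \<in> borel_measurable borel"
  by (simp add: bounded_borel_on_def)

lemma bounded_borel_on_poly: "bounded_borel_on a b (poly p)"
  using poly_bounded_on_interval[of a b p] bounded_borel_onI[OF poly_borel_measurable] by metis

lemma bounded_borel_on_indicator:
  "B \<in> sets borel \<Longrightarrow> bounded_borel_on a b (indicator B)"
  by (rule bounded_borel_onI[of _ _ _ 1]) (auto simp: indicator_def)

lemma bounded_borel_on_linear:
  assumes "bounded_borel_on a b f" "bounded_borel_on a b g"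
  shows "bounded_borel_on a b (\<lambda>x. c * f x + d * g x)"
proof -
  obtain C D where C: "0 \<le> C" "\<And>x. x \<in> {a..b} \<Longrightarrow> \<bar>f x\<bar> \<le> C"
    and D: "0 \<le> D" "\<And>x. x \<in> {a..b} \<Longrightarrow> \<bar>g x\<bar> \<le> D"
    using assms bounded_borel_on_bound by metis
  show ?thesis
  proof (rule bounded_borel_onI[of _ _ _ "\<bar>c\<bar> * C + \<bar>d\<bar> * D"])
    show "\<bar>c * f x + d * g x\<bar> \<le> \<bar>c\<bar> * C + \<bar>d\<bar> * D" if "x \<in> {a..b}" for x
      by (rule order_trans[OF abs_triangle_ineq])
        (use C(2)[OF that] D(2)[OF that] in \<open>auto simp: abs_mult intro!: add_mono mult_left_mono\<close>)
  qed (use assms in \<open>auto simp: bounded_borel_on_def\<close>)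
qed

lemma bounded_borel_on_mult:
  assumes "bounded_borel_on a b f" "bounded_borel_on a b g"
  shows "bounded_borel_on a b (\<lambda>x. f x * g x)"
proof -
  obtain C D where C: "0 \<le> C" "\<And>x. x \<in> {a..b} \<Longrightarrow> \<bar>f x\<bar> \<le> C"
    and D: "0 \<le> D" "\<And>x. x \<in> {a..b} \<Longrightarrow> \<bar>g x\<bar> \<le> D"
    using assms bounded_borel_on_bound by metis
  show ?thesis
    by (rule bounded_borel_onI[of _ _ _ "C * D"])
      (use assms C D in \<open>auto simp: bounded_borel_on_def abs_mult intro!: mult_mono\<close>)
qed

lemma bounded_borel_on_const: "bounded_borel_on a b (\<lambda>_. c)"
  by (rule bounded_borel_onI[of _ _ _ "\<bar>c\<bar>"]) auto

lemma measure_on_interval_integrable':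
  "measure_on_interval a b \<mu> \<Longrightarrow> bounded_borel_on a b f \<Longrightarrow> integrable \<mu> f"
  by (metis bounded_borel_on_bound bounded_borel_on_measurable measure_on_interval_integrable)

text \<open>Rounding \<open>f\<close> down to multiples of \<open>1 / (n + 1)\<close> gives finite combinations of indicators that
  converge uniformly.\<close>

lemma bounded_borel_uniform_induct
  [consumes 1, case_names indicator linear uniform]:
  assumes f: "bounded_borel_on a b f"
    and ind: "\<And>B. B \<in> sets borel \<Longrightarrow> P (indicator B)"
    and lin: "\<And>f g c d. bounded_borel_on a b f \<Longrightarrow> bounded_borel_on a b g \<Longrightarrow> P f \<Longrightarrow> P g \<Longrightarrow>
      P (\<lambda>x. c * f x + d * g x)"
    and lim: "\<And>f g. bounded_borel_on a b f \<Longrightarrow> (\<And>n. bounded_borel_on a b (g n)) \<Longrightarrow>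
      (\<And>n. P (g n)) \<Longrightarrow>
      (\<And>n x. x \<in> {a..b} \<Longrightarrow> \<bar>g n x - f x\<bar> \<le> inverse (real (Suc n))) \<Longrightarrow> P f"
  shows "P f"
proof -
  obtain C where C: "0 \<le> C" "\<And>x. x \<in> {a..b} \<Longrightarrow> \<bar>f x\<bar> \<le> C"
    using bounded_borel_on_bound[OF f] by metis
  define B where "B n k = {x. \<lfloor>real (Suc n) * f x\<rfloor> = k}" for n and k :: int
  have B: "B n k \<in> sets borel" for n k
  proof -
    have [measurable]: "f \<in> borel_measurable borel"
      using f by (rule bounded_borel_on_measurable)
    show ?thesis
      unfolding B_def by measurable
  qed
  define K where "K n = {- \<lceil>real (Suc n) * C\<rceil> - 1..\<lceil>real (Suc n) * C\<rceil> + 1}" for n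
  define g where "g n x = (\<Sum>k\<in>K n. real_of_int k / real (Suc n) * indicator (B n k) x)" for n x
  have P0: "P (\<lambda>_. 0)"
    using lin[of "indicator {}" "indicator {}" 0 0] ind[of "{}"] bounded_borel_on_indicator[of "{}"]
    by simp
  have Pg: "bounded_borel_on a b (\<lambda>x. \<Sum>k\<in>A. real_of_int k / real (Suc n) * indicator (B n k) x)
      \<and> P (\<lambda>x. \<Sum>k\<in>A. real_of_int k / real (Suc n) * indicator (B n k) x)" if "finite A" for A n
    using that
  proof induction
    case empty
    then show ?case
      by (simp add: P0 bounded_borel_on_const)
  next
    case (insert k A)
    then show ?case
      using lin[OF bounded_borel_on_indicator[OF B, of a b n k] _ ind[OF B, of n k], of _ "k / Suc n" 1]
        bounded_borel_on_linear[OF bounded_borel_on_indicator[OF B, of a b n k], of _ "k / Suc n" 1]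
      by simp
  qed
  have eq: "g n x = real_of_int \<lfloor>real (Suc n) * f x\<rfloor> / real (Suc n)" if x: "x \<in> {a..b}" for n x
  proof -
    have "\<bar>real (Suc n) * f x\<bar> \<le> real (Suc n) * C"
      using C(2)[OF x] by (simp add: abs_mult del: of_nat_Suc)
    then have "\<lfloor>real (Suc n) * f x\<rfloor> \<in> K n"
      unfolding K_def abs_le_iff by (auto simp del: of_nat_Suc; linarith)
    then show ?thesis
      unfolding g_def B_def indicator_def
      by (subst sum.remove[of _ "\<lfloor>real (Suc n) * f x\<rfloor>"])
        (auto simp: K_def intro!: sum.neutral)
  qed
  have close: "\<bar>g n x - f x\<bar> \<le> inverse (real (Suc n))" if x: "x \<in> {a..b}" for n x
  proof -
    have "\<bar>real_of_int \<lfloor>real (Suc n) * f x\<rfloor> - real (Suc n) * f x\<bar> \<le> 1"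
      by linarith
    then have "\<bar>real_of_int \<lfloor>real (Suc n) * f x\<rfloor> - real (Suc n) * f x\<bar> / real (Suc n) \<le> 1 / real (Suc n)"
      by (intro divide_right_mono) auto
    also have "\<bar>real_of_int \<lfloor>real (Suc n) * f x\<rfloor> - real (Suc n) * f x\<bar> / real (Suc n)
        = \<bar>(real_of_int \<lfloor>real (Suc n) * f x\<rfloor> - real (Suc n) * f x) / real (Suc n)\<bar>"
      by (simp add: abs_divide)
    also have "\<dots> = \<bar>g n x - f x\<bar>"
      by (simp add: eq[OF x] diff_divide_distrib del: of_nat_Suc)
    finally show ?thesis
      by (simp add: inverse_eq_divide)
  qed
  have fin: "finite (K n)" for n
    by (simp add: K_def)
  show ?thesis
    by (rule lim[of f g]) (use Pg[OF fin] f close in \<open>auto simp: g_def[abs_def]\<close>)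
qed

text \<open>Every property of bounded Borel functions that holds for polynomials and is stable under
  linear combinations and bounded pointwise limits holds in general: half-line indicators are limits
  of polynomials, and the sets with indicator in the class form a Dynkin system.\<close>

lemma bounded_borel_limit_induct
  [consumes 1, case_names poly linear limit]:
  assumes f: "bounded_borel_on a b f"
    and poly: "\<And>p. P (poly p)"
    and lin: "\<And>f g c d. bounded_borel_on a b f \<Longrightarrow> bounded_borel_on a b g \<Longrightarrow> P f \<Longrightarrow> P g \<Longrightarrow>
      P (\<lambda>x. c * f x + d * g x)"
    and lim: "\<And>f g C. bounded_borel_on a b f \<Longrightarrow> (\<And>n. bounded_borel_on a b (g n)) \<Longrightarrow>
      (\<And>n. P (g n)) \<Longrightarrow> (\<And>n x. x \<in> {a..b} \<Longrightarrow> \<bar>g n x\<bar> \<le> C) \<Longrightarrow>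
      (\<And>x. x \<in> {a..b} \<Longrightarrow> (\<lambda>n. g n x) \<longlonglongrightarrow> f x) \<Longrightarrow> P f"
  shows "P f"
  using f
proof (induction rule: bounded_borel_uniform_induct)
  case (indicator B)
  have P_zero: "P (\<lambda>_. 0)"
  proof -
    have "(\<lambda>_. 0) = poly (0 :: real poly)"
      by (auto simp: fun_eq_iff)
    then show ?thesis
      using poly[of 0] by simp
  qed
  have "Int_stable (range atMost :: real set set)" "range atMost \<subseteq> Pow (UNIV :: real set)"
    "B \<in> sigma_sets UNIV (range atMost)"
    using indicator by (auto simp: borel_eq_atMost Int_stable_def)
  then show ?case
  proof (induction rule: sigma_sets_induct_disjoint)
    case (basic B)
    then obtain l where l: "B = {..l}"
      by auto
    obtain q where q: "\<And>n x. x \<in> {a..b} \<Longrightarrow> \<bar>poly (q n) x\<bar> \<le> 2"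
      "\<And>x. x \<in> {a..b} \<Longrightarrow> (\<lambda>n. poly (q n) x) \<longlonglongrightarrow> indicator {..l} x"
      using poly_tendsto_indicator_atMost[of a b l] by blast
    show ?case
      unfolding l
      by (rule lim[OF bounded_borel_on_indicator bounded_borel_on_poly poly q]) auto
  next
    case empty
    show ?case
      using P_zero by (simp add: indicator_def[abs_def])
  next
    case (compl B)
    then have B: "B \<in> sets borel"
      by (simp add: borel_eq_atMost)
    have "P (\<lambda>x. 1 * poly 1 x + (- 1) * indicator B x)"
      using compl B by (intro lin poly bounded_borel_on_poly bounded_borel_on_indicator) auto
    also have "(\<lambda>x. 1 * poly 1 x + (- 1) * indicator B x) = (indicator (UNIV - B) :: real \<Rightarrow> real)"
      by (auto simp: indicator_def)
    finally show ?case .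
  next
    case (union F)
    then have F: "F i \<in> sets borel" for i
      by (auto simp: borel_eq_atMost)
    have "P (indicator (\<Union>i<n. F i))" for n
    proof (induction n)
      case 0
      then show ?case
        using P_zero by (simp add: indicator_def[abs_def])
    next
      case (Suc n)
      have "P (\<lambda>x. 1 * indicator (\<Union>i<n. F i) x + 1 * indicator (F n) x)"
        using Suc union F by (intro lin bounded_borel_on_indicator) auto
      also have "(\<lambda>x. 1 * indicator (\<Union>i<n. F i) x + 1 * indicator (F n) x)
          = (indicator (\<Union>i<Suc n. F i) :: real \<Rightarrow> real)"
      proof -
        have "F n \<inter> (\<Union>i<n. F i) = {}"
          using union by (auto simp: disjoint_family_on_def) (metis IntI UNIV_I empty_iff less_irrefl)
        then show ?thesis
          by (auto simp: indicator_def less_Suc_eq fun_eq_iff)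
      qed
      finally show ?case .
    qed
    then show ?case
    proof (rule lim[rotated 2])
      show "\<bar>indicator (\<Union>i<n. F i) x\<bar> \<le> (1::real)" for n x
        by (simp add: indicator_def)
      show "(\<lambda>n. indicator (\<Union>i<n. F i) x :: real) \<longlonglongrightarrow> indicator (\<Union>i. F i) x" for x
        by (rule LIMSEQ_indicator_UN)
    qed (use F in \<open>auto intro!: bounded_borel_on_indicator\<close>)
  qed
next
  case (uniform f g)
  obtain C where C: "0 \<le> C" "\<And>x. x \<in> {a..b} \<Longrightarrow> \<bar>f x\<bar> \<le> C"
    using bounded_borel_on_bound[OF uniform.hyps(1)] by metis
  have le1: "inverse (real (Suc n)) \<le> 1" for n
    by (simp add: field_simps)
  show ?case
  proof (rule lim[OF uniform.hyps(1,2) uniform.IH])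
    show "\<bar>g n x\<bar> \<le> C + 1" if "x \<in> {a..b}" for n x
      using C(2)[OF that] uniform.hyps(3)[OF that, of n] le1[of n] by linarith
    show "(\<lambda>n. g n x) \<longlonglongrightarrow> f x" if "x \<in> {a..b}" for x
      by (rule LIM_zero_cancel, rule Lim_null_comparison[OF _ LIMSEQ_inverse_real_of_nat])
        (use uniform.hyps(3)[OF that] in auto)
  qed
qed (use lin in auto)

section \<open>Operators defined by families of measures\<close>

text \<open>Operators are recovered from the quadratic forms \<open>x \<mapsto> \<integral> f d\<nu>\<^sub>x\<close>. The locale below assumes this to be
  possible for indicators only. It has two instances: the measures built from the moments
  \<open>\<langle>x, p(T) x\<rangle>\<close>, and the scalar measures of an arbitrary resolution of the identity. Comparing the
  two yields uniqueness of the resolution.\<close>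

definition form_op :: "('h \<Rightarrow> real measure) \<Rightarrow> (real \<Rightarrow> real) \<Rightarrow> ('h::complex_hilbert \<Rightarrow>\<^sub>L 'h)" where
  "form_op \<nu> f = (THE R. hermitian R \<and> (\<forall>x. inner x (R x) = (LINT t|\<nu> x. f t)))"

locale measure_form =
  fixes a b :: real and \<nu> :: "'h::complex_hilbert \<Rightarrow> real measure"
  assumes on_interval: "measure_on_interval a b (\<nu> x)"
    and total: "measure (\<nu> x) UNIV = (norm x)\<^sup>2"
    and ex_indicator: "B \<in> sets borel \<Longrightarrow> \<exists>R. hermitian R \<and> (\<forall>x. inner x (R x) = measure (\<nu> x) B)"
begin

lemma integral_bound:
  assumes f: "bounded_borel_on a b f" and C: "\<And>t. t \<in> {a..b} \<Longrightarrow> \<bar>f t\<bar> \<le> C"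
  shows "\<bar>LINT t|\<nu> x. f t\<bar> \<le> C * (norm x)\<^sup>2"
proof -
  interpret finite_measure "\<nu> x"
    using on_interval[of x] by (simp add: measure_on_interval_def)
  have sp: "space (\<nu> x) = UNIV"
    by (rule measure_on_interval_space[OF on_interval])
  have i: "integrable (\<nu> x) f"
    by (rule measure_on_interval_integrable'[OF on_interval f])
  have "\<bar>LINT t|\<nu> x. f t\<bar> \<le> (LINT t|\<nu> x. \<bar>f t\<bar>)"
    by (rule integral_abs_bound)
  also have "\<dots> \<le> (LINT t|\<nu> x. C)"
  proof (rule integral_mono_AE)
    show "AE t in \<nu> x. \<bar>f t\<bar> \<le> C"
      using measure_on_interval_AE[OF on_interval[of x]] by eventually_elim (rule C)
  qed (use i in auto)
  also have "\<dots> = C * (norm x)\<^sup>2"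
    using total[of x] by (simp add: sp)
  finally show ?thesis .
qed

lemma form_op_ex:
  assumes f: "bounded_borel_on a b f"
  shows "\<exists>R. hermitian R \<and> (\<forall>x. inner x (R x) = (LINT t|\<nu> x. f t))"
  using f
proof (induction rule: bounded_borel_uniform_induct)
  case (indicator B)
  then show ?case
    using ex_indicator[OF indicator] measure_on_interval_space[OF on_interval] by simp
next
  case (linear f g c d)
  then obtain R S where R: "hermitian R" "\<And>x. inner x (R x) = (LINT t|\<nu> x. f t)"
    and S: "hermitian S" "\<And>x. inner x (S x) = (LINT t|\<nu> x. g t)"
    by blast
  have "integrable (\<nu> x) f" "integrable (\<nu> x) g" for x
    using linear measure_on_interval_integrable'[OF on_interval] by auto
  with R S show ?case
    by (intro exI[of _ "c *\<^sub>R R + d *\<^sub>R S"]) (simp add: blinfun.bilinear_simps inner_add_right)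
next
  case (uniform f g)
  obtain C where C: "0 \<le> C" "\<And>x. x \<in> {a..b} \<Longrightarrow> \<bar>f x\<bar> \<le> C"
    using bounded_borel_on_bound[OF uniform.hyps(1)] by metis
  have le1: "inverse (real (Suc n)) \<le> 1" for n
    by (simp add: field_simps)
  have gC: "\<bar>g n x\<bar> \<le> C + 1" if "x \<in> {a..b}" for n x
    using C(2)[OF that] uniform.hyps(3)[OF that, of n] le1[of n] by linarith
  have lim: "(\<lambda>n. g n x) \<longlonglongrightarrow> f x" if "x \<in> {a..b}" for x
    by (rule LIM_zero_cancel, rule Lim_null_comparison[OF _ LIMSEQ_inverse_real_of_nat])
      (use uniform.hyps(3)[OF that] in auto)
  obtain R where R: "\<And>n. hermitian (R n)" "\<And>n x. inner x (R n x) = (LINT t|\<nu> x. g n t)"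
    using uniform.IH by metis
  show ?case
  proof (rule hermitian_weak_limit[of R "C + 1"])
    show "(\<lambda>n. inner x (R n x)) \<longlonglongrightarrow> (LINT t|\<nu> x. f t)" for x
      unfolding R(2)
      by (rule measure_on_interval_tendsto[OF on_interval _ _ gC lim])
        (use uniform in \<open>auto dest: bounded_borel_on_measurable\<close>)
  qed (use R integral_bound[OF uniform.hyps(2) gC] in auto)
qed

lemma form_op:
  assumes "bounded_borel_on a b f"
  shows form_op_hermitian: "hermitian (form_op \<nu> f)"
    and form_op_inner: "inner x (form_op \<nu> f x) = (LINT t|\<nu> x. f t)"
proof -
  have "\<exists>!R. hermitian R \<and> (\<forall>x. inner x (R x) = (LINT t|\<nu> x. f t))"
    using form_op_ex[OF assms] by (metis hermitian_eqI)
  from theI'[OF this] show "hermitian (form_op \<nu> f)"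
    "inner x (form_op \<nu> f x) = (LINT t|\<nu> x. f t)"
    by (auto simp: form_op_def)
qed

lemma form_op_eqI:
  assumes "bounded_borel_on a b f" "hermitian R" "\<And>x. inner x (R x) = (LINT t|\<nu> x. f t)"
  shows "form_op \<nu> f = R"
  using assms by (intro hermitian_eqI) (auto simp: form_op)

lemma form_op_linear:
  assumes f: "bounded_borel_on a b f" and g: "bounded_borel_on a b g"
  shows "form_op \<nu> (\<lambda>t. c * f t + d * g t) = c *\<^sub>R form_op \<nu> f + d *\<^sub>R form_op \<nu> g"
proof (rule form_op_eqI)
  have "integrable (\<nu> x) f" "integrable (\<nu> x) g" for x
    using f g measure_on_interval_integrable'[OF on_interval] by auto
  then show "inner x ((c *\<^sub>R form_op \<nu> f + d *\<^sub>R form_op \<nu> g) x) = (LINT t|\<nu> x. c * f t + d * g t)" for x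
    using f g by (simp add: blinfun.bilinear_simps inner_add_right form_op_inner)
qed (use f g in \<open>auto simp: form_op_hermitian bounded_borel_on_linear\<close>)

lemma form_op_diff:
  assumes f: "bounded_borel_on a b f" and g: "bounded_borel_on a b g"
  shows "form_op \<nu> (\<lambda>t. f t - g t) = form_op \<nu> f - form_op \<nu> g"
  using form_op_linear[OF f g, of 1 "-1"] by simp

lemma form_op_norm_le:
  assumes "bounded_borel_on a b f" "\<And>t. t \<in> {a..b} \<Longrightarrow> \<bar>f t\<bar> \<le> C" "0 \<le> C"
  shows "norm (form_op \<nu> f) \<le> C"
  by (rule hermitian_norm_bound)
    (use integral_bound[OF assms(1,2)] assms in \<open>simp_all add: form_op\<close>)

lemma form_op_cong:
  assumes f: "bounded_borel_on a b f" and g: "bounded_borel_on a b g"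
    and eq: "\<And>t. t \<in> {a..b} \<Longrightarrow> f t = g t"
  shows "form_op \<nu> f = form_op \<nu> g"
proof -
  have "norm (form_op \<nu> (\<lambda>t. f t - g t)) \<le> 0"
    using bounded_borel_on_linear[OF f g, of 1 "-1"] eq by (intro form_op_norm_le) auto
  then show ?thesis
    by (simp add: form_op_diff[OF f g])
qed

lemma form_op_one: "form_op \<nu> (\<lambda>_. 1) = id_blinfun"
  using total measure_on_interval_space[OF on_interval]
  by (intro form_op_eqI bounded_borel_on_const) (auto simp: power2_norm_eq_inner)

lemma form_op_mono:
  assumes f: "bounded_borel_on a b f" and g: "bounded_borel_on a b g"
    and le: "\<And>t. t \<in> {a..b} \<Longrightarrow> f t \<le> g t"
  shows "inner x (form_op \<nu> f x) \<le> inner x (form_op \<nu> g x)"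
  unfolding form_op_inner[OF f] form_op_inner[OF g]
proof (rule integral_mono_AE)
  show "AE t in \<nu> x. f t \<le> g t"
    using measure_on_interval_AE[OF on_interval[of x]] by eventually_elim (rule le)
qed (use measure_on_interval_integrable'[OF on_interval] f g in auto)

lemma form_op_tendsto_weak:
  assumes f: "bounded_borel_on a b f" and g: "\<And>n. bounded_borel_on a b (g n)"
    and bd: "\<And>n t. t \<in> {a..b} \<Longrightarrow> \<bar>g n t\<bar> \<le> C"
    and lim: "\<And>t. t \<in> {a..b} \<Longrightarrow> (\<lambda>n. g n t) \<longlonglongrightarrow> f t"
  shows "(\<lambda>n. inner x (form_op \<nu> (g n) y)) \<longlonglongrightarrow> inner x (form_op \<nu> f y)"
proof -
  have "(\<lambda>n. inner x (form_op \<nu> (g n) x)) \<longlonglongrightarrow> inner x (form_op \<nu> f x)" for x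
    unfolding form_op_inner[OF f] form_op_inner[OF g]
    by (rule measure_on_interval_tendsto[OF on_interval _ _ bd lim])
      (use f g in \<open>auto dest: bounded_borel_on_measurable\<close>)
  then have "(\<lambda>n. (inner (x + y) (form_op \<nu> (g n) (x + y)) - inner (x - y) (form_op \<nu> (g n) (x - y))) / 4)
      \<longlonglongrightarrow> (inner (x + y) (form_op \<nu> f (x + y)) - inner (x - y) (form_op \<nu> f (x - y))) / 4"
    by (intro tendsto_divide tendsto_diff tendsto_const) simp_all
  then show ?thesis
    by (simp only: hermitian_polarization[OF form_op_hermitian[OF g], where x = x and y = y]
        hermitian_polarization[OF form_op_hermitian[OF f], of x y])
qed

lemma form_op_tendsto_uniform:
  assumes f: "bounded_borel_on a b f" and g: "\<And>n. bounded_borel_on a b (g n)"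
    and lim: "\<And>n t. t \<in> {a..b} \<Longrightarrow> \<bar>g n t - f t\<bar> \<le> inverse (real (Suc n))"
  shows "(\<lambda>n. form_op \<nu> (g n)) \<longlonglongrightarrow> form_op \<nu> f"
proof (rule LIM_zero_cancel, rule Lim_null_comparison[OF _ LIMSEQ_inverse_real_of_nat])
  have "norm (form_op \<nu> (\<lambda>t. g n t - f t)) \<le> inverse (real (Suc n))" for n
    using bounded_borel_on_linear[OF g f, of 1 _ "-1"] lim by (intro form_op_norm_le) auto
  then show "\<forall>\<^sub>F n in sequentially. norm (form_op \<nu> (g n) - form_op \<nu> f) \<le> inverse (real (Suc n))"
    by (simp add: form_op_diff[OF g f])
qed

text \<open>Both sides are linear in each factor and continuous for uniform convergence of one factor, so the
  uniform induction applies first to the left and then to the right factor.\<close>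

lemma form_op_mult_of_indicators:
  assumes ind: "\<And>B C. B \<in> sets borel \<Longrightarrow> C \<in> sets borel \<Longrightarrow>
      form_op \<nu> (indicator B) o\<^sub>L form_op \<nu> (indicator C) = form_op \<nu> (indicator (B \<inter> C))"
    and f: "bounded_borel_on a b f" and g: "bounded_borel_on a b g"
  shows "form_op \<nu> f o\<^sub>L form_op \<nu> g = form_op \<nu> (\<lambda>t. f t * g t)"
proof -
  have step: "(\<lambda>n. form_op \<nu> (\<lambda>t. h n t * k t)) \<longlonglongrightarrow> form_op \<nu> (\<lambda>t. f t * k t)"
    if f: "bounded_borel_on a b f" and k: "bounded_borel_on a b k" and h: "\<And>n. bounded_borel_on a b (h n)"
      and lim: "\<And>n t. t \<in> {a..b} \<Longrightarrow> \<bar>h n t - f t\<bar> \<le> inverse (real (Suc n))" for f h k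
  proof -
    obtain C where C: "0 \<le> C" "\<And>t. t \<in> {a..b} \<Longrightarrow> \<bar>k t\<bar> \<le> C"
      using bounded_borel_on_bound[OF k] by metis
    have bd: "norm (form_op \<nu> (\<lambda>t. h n t * k t) - form_op \<nu> (\<lambda>t. f t * k t)) \<le> inverse (real (Suc n)) * C" for n
    proof -
      have "norm (form_op \<nu> (\<lambda>t. h n t * k t - f t * k t)) \<le> inverse (real (Suc n)) * C"
      proof (rule form_op_norm_le)
        show "bounded_borel_on a b (\<lambda>t. h n t * k t - f t * k t)"
          using bounded_borel_on_linear[OF bounded_borel_on_mult[OF h k] bounded_borel_on_mult[OF f k], of 1 n "-1"]
          by simp
        show "\<bar>h n t * k t - f t * k t\<bar> \<le> inverse (real (Suc n)) * C" if "t \<in> {a..b}" for t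
          using mult_mono[OF lim[OF that, of n] C(2)[OF that]] C(1)
          by (simp add: left_diff_distrib[symmetric] abs_mult)
      qed (use C in simp)
      then show ?thesis
        by (simp add: form_op_diff bounded_borel_on_mult f k h)
    qed
    have "(\<lambda>n. inverse (real (Suc n)) * C) \<longlonglongrightarrow> 0"
      by (rule tendsto_mult_left_zero[OF LIMSEQ_inverse_real_of_nat])
    then show ?thesis
      by (rule LIM_zero_cancel[OF Lim_null_comparison[OF always_eventually[OF allI[OF bd]]]])
  qed
  have lin_left: "form_op \<nu> (\<lambda>t. c * f t + d * g t) o\<^sub>L form_op \<nu> k = form_op \<nu> (\<lambda>t. (c * f t + d * g t) * k t)"
    if "bounded_borel_on a b f" "bounded_borel_on a b g" "bounded_borel_on a b k"
      "form_op \<nu> f o\<^sub>L form_op \<nu> k = form_op \<nu> (\<lambda>t. f t * k t)"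
      "form_op \<nu> g o\<^sub>L form_op \<nu> k = form_op \<nu> (\<lambda>t. g t * k t)" for f g k c d
  proof -
    have "form_op \<nu> (\<lambda>t. (c * f t + d * g t) * k t)
        = form_op \<nu> (\<lambda>t. c * (f t * k t) + d * (g t * k t))"
      by (simp add: algebra_simps)
    also have "\<dots> = c *\<^sub>R (form_op \<nu> f o\<^sub>L form_op \<nu> k) + d *\<^sub>R (form_op \<nu> g o\<^sub>L form_op \<nu> k)"
      using that by (simp add: form_op_linear bounded_borel_on_mult)
    also have "\<dots> = (c *\<^sub>R form_op \<nu> f + d *\<^sub>R form_op \<nu> g) o\<^sub>L form_op \<nu> k"
      by (intro blinfun_eqI) (simp add: blinfun.bilinear_simps)
    also have "\<dots> = form_op \<nu> (\<lambda>t. c * f t + d * g t) o\<^sub>L form_op \<nu> k"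
      using that by (simp add: form_op_linear)
    finally show ?thesis ..
  qed
  have left: "form_op \<nu> f o\<^sub>L form_op \<nu> (indicator B) = form_op \<nu> (\<lambda>t. f t * indicator B t)"
    if B: "B \<in> sets borel" and f: "bounded_borel_on a b f" for f B
    using f
  proof (induction rule: bounded_borel_uniform_induct)
    case (indicator C)
    then show ?case
      using ind[OF indicator B] by (simp add: indicator_inter_arith[abs_def])
  next
    case (linear f g c d)
    then show ?case
      by (intro lin_left bounded_borel_on_indicator B)
  next
    case (uniform f h)
    have "(\<lambda>n. form_op \<nu> (h n) o\<^sub>L form_op \<nu> (indicator B)) \<longlonglongrightarrow> (form_op \<nu> f o\<^sub>L form_op \<nu> (indicator B))"
      by (intro bounded_bilinear.tendsto[OF bounded_bilinear_blinfun_compose] tendsto_const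
          form_op_tendsto_uniform uniform)
    moreover have "(\<lambda>n. form_op \<nu> (h n) o\<^sub>L form_op \<nu> (indicator B)) \<longlonglongrightarrow> form_op \<nu> (\<lambda>t. f t * indicator B t)"
      unfolding uniform.IH by (intro step uniform bounded_borel_on_indicator B)
    ultimately show ?case
      by (rule LIMSEQ_unique)
  qed
  show ?thesis
    using g
  proof (induction rule: bounded_borel_uniform_induct)
    case (indicator C)
    then show ?case
      by (intro left f)
  next
    case (linear g h c d)
    have "form_op \<nu> (\<lambda>t. f t * (c * g t + d * h t)) = form_op \<nu> (\<lambda>t. c * (f t * g t) + d * (f t * h t))"
      by (simp add: algebra_simps)
    also have "\<dots> = c *\<^sub>R (form_op \<nu> f o\<^sub>L form_op \<nu> g) + d *\<^sub>R (form_op \<nu> f o\<^sub>L form_op \<nu> h)"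
      using linear f by (simp add: form_op_linear bounded_borel_on_mult)
    also have "\<dots> = form_op \<nu> f o\<^sub>L (c *\<^sub>R form_op \<nu> g + d *\<^sub>R form_op \<nu> h)"
      by (intro blinfun_eqI) (simp add: blinfun.bilinear_simps)
    also have "\<dots> = form_op \<nu> f o\<^sub>L form_op \<nu> (\<lambda>t. c * g t + d * h t)"
      using linear by (simp add: form_op_linear)
    finally show ?case ..
  next
    case (uniform g h)
    have "(\<lambda>n. form_op \<nu> f o\<^sub>L form_op \<nu> (h n)) \<longlonglongrightarrow> (form_op \<nu> f o\<^sub>L form_op \<nu> g)"
      by (intro bounded_bilinear.tendsto[OF bounded_bilinear_blinfun_compose] tendsto_const
          form_op_tendsto_uniform uniform)
    moreover have "(\<lambda>n. form_op \<nu> f o\<^sub>L form_op \<nu> (h n)) \<longlonglongrightarrow> form_op \<nu> (\<lambda>t. f t * g t)"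
      unfolding uniform.IH using step[OF uniform.hyps(1) f uniform.hyps(2,3)] by (simp add: mult.commute)
    ultimately show ?case
      by (rule LIMSEQ_unique)
  qed
qed

end

lemma bounded_borel_on_ident: "bounded_borel_on a b (\<lambda>x. x)"
  by (rule bounded_borel_onI[of _ _ _ "max \<bar>a\<bar> \<bar>b\<bar>"]) auto

section \<open>The spectral theorem\<close>

text \<open>The interval is existentially quantified so that the measure depends on the operator and
  the vector alone.\<close>

definition spec_measure :: "('h::complex_hilbert \<Rightarrow>\<^sub>L 'h) \<Rightarrow> 'h \<Rightarrow> real measure" where
  "spec_measure T x = (THE \<mu>. \<exists>a b. measure_on_interval a b \<mu> \<and>
     (\<forall>p. (LINT t|\<mu>. poly p t) = inner x (poly_op p T x)))"

lemma measure_on_interval_mono: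
  assumes \<mu>: "measure_on_interval a b \<mu>" and "a' \<le> a" "b \<le> b'"
  shows "measure_on_interval a' b' \<mu>"
proof -
  have "emeasure \<mu> (- {a'..b'}) \<le> emeasure \<mu> (- {a..b})"
    using assms by (intro emeasure_mono) (auto simp: measure_on_interval_def)
  with \<mu> show ?thesis
    by (simp add: measure_on_interval_def)
qed

lemma spec_measure_eqI:
  assumes \<mu>: "measure_on_interval a b \<mu>" "\<And>p. (LINT t|\<mu>. poly p t) = inner x (poly_op p T x)"
  shows "spec_measure T x = \<mu>"
  unfolding spec_measure_def
proof (rule the_equality)
  fix \<nu>
  assume "\<exists>a b. measure_on_interval a b \<nu> \<and> (\<forall>p. (LINT t|\<nu>. poly p t) = inner x (poly_op p T x))"
  then obtain c d where \<nu>: "measure_on_interval c d \<nu>" "\<And>p. (LINT t|\<nu>. poly p t) = inner x (poly_op p T x)"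
    by blast
  show "\<nu> = \<mu>"
  proof (rule measure_on_interval_eqI)
    show "measure_on_interval (min a c) (max b d) \<nu>"
      by (rule measure_on_interval_mono[OF \<nu>(1)]) auto
    show "measure_on_interval (min a c) (max b d) \<mu>"
      by (rule measure_on_interval_mono[OF \<mu>(1)]) auto
  qed (simp add: \<mu> \<nu>)
qed (use \<mu> in blast)

locale spectral_bounds =
  fixes T :: "'h::complex_hilbert \<Rightarrow>\<^sub>L 'h" and a b :: real
  assumes ab: "a < b" and hermitian: "hermitian T"
    and lower: "a * (norm x)\<^sup>2 \<le> inner x (T x)" and upper: "inner x (T x) \<le> b * (norm x)\<^sup>2"
begin

lemma spec_measure:
  shows spec_measure_on_interval: "measure_on_interval a b (spec_measure T x)"
    and spec_measure_poly: "(LINT t|spec_measure T x. poly p t) = inner x (poly_op p T x)"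
proof -
  have "\<exists>\<mu>. measure_on_interval a b \<mu> \<and> (\<forall>p. (LINT t|\<mu>. poly p t) = inner x (poly_op p T x))"
  proof (rule positive_functional_measure[OF ab])
    show "0 \<le> inner x (poly_op p T x)" if "\<And>t. t \<in> {a..b} \<Longrightarrow> 0 \<le> poly p t" for p
      by (rule poly_op_nonneg[OF ab hermitian lower upper that])
  qed (auto simp: poly_op_add poly_op_smult blinfun.bilinear_simps inner_add_right)
  then show "measure_on_interval a b (spec_measure T x)"
    "(LINT t|spec_measure T x. poly p t) = inner x (poly_op p T x)"
    using spec_measure_eqI by metis+
qed

lemma spec_measure_total: "measure (spec_measure T x) UNIV = (norm x)\<^sup>2"
  using spec_measure_poly[of x 1] measure_on_interval_space[OF spec_measure_on_interval]
  by (simp add: power2_norm_eq_inner)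

text \<open>Polynomials act through \<open>poly_op\<close>, and bounded pointwise limits of functions become
  weak limits of operators.\<close>

lemma ex_op_spec_measure:
  assumes "bounded_borel_on a b f"
  shows "\<exists>R. hermitian R \<and> (\<forall>x. inner x (R x) = (LINT t|spec_measure T x. f t))"
  using assms
proof (induction rule: bounded_borel_limit_induct)
  case (poly p)
  then show ?case
    using hermitian by (intro exI[of _ "poly_op p T"]) (simp add: spec_measure_poly)
next
  case (linear f g c d)
  then obtain R S where R: "hermitian R" "\<And>x. inner x (R x) = (LINT t|spec_measure T x. f t)"
    and S: "hermitian S" "\<And>x. inner x (S x) = (LINT t|spec_measure T x. g t)"
    by blast
  have "integrable (spec_measure T x) f" "integrable (spec_measure T x) g" for x
    using linear measure_on_interval_integrable'[OF spec_measure_on_interval] by auto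
  with R S show ?case
    by (intro exI[of _ "c *\<^sub>R R + d *\<^sub>R S"]) (simp add: blinfun.bilinear_simps inner_add_right)
next
  case (limit f g C)
  obtain R where R: "\<And>n. hermitian (R n)" "\<And>n x. inner x (R n x) = (LINT t|spec_measure T x. g n t)"
    using limit.IH by metis
  show ?case
  proof (rule hermitian_weak_limit[of R C])
    show "(\<lambda>n. inner x (R n x)) \<longlonglongrightarrow> (LINT t|spec_measure T x. f t)" for x
      unfolding R(2)
      by (rule measure_on_interval_tendsto[OF spec_measure_on_interval _ _ limit.hyps(3,4)])
        (use limit.hyps in \<open>auto dest: bounded_borel_on_measurable\<close>)
    show "\<bar>inner x (R n x)\<bar> \<le> C * (norm x)\<^sup>2" for n x
    proof -
      interpret finite_measure "spec_measure T x"
        using spec_measure_on_interval[of x] by (simp add: measure_on_interval_def)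
      have i: "integrable (spec_measure T x) (g n)"
        by (rule measure_on_interval_integrable'[OF spec_measure_on_interval limit.hyps(2)])
      have "\<bar>LINT t|spec_measure T x. g n t\<bar> \<le> (LINT t|spec_measure T x. \<bar>g n t\<bar>)"
        by (rule integral_abs_bound)
      also have "\<dots> \<le> (LINT t|spec_measure T x. C)"
      proof (rule integral_mono_AE)
        show "AE t in spec_measure T x. \<bar>g n t\<bar> \<le> C"
          using measure_on_interval_AE[OF spec_measure_on_interval[of x]]
          by eventually_elim (rule limit.hyps(3))
      qed (use i in auto)
      also have "\<dots> = C * (norm x)\<^sup>2"
        using spec_measure_total[of x] measure_on_interval_space[OF spec_measure_on_interval] by simp
      finally show ?thesis
        by (simp add: R)
    qed
  qed (rule R)
qed

sublocale measure_form a b "spec_measure T"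
proof
  show "\<exists>R. hermitian R \<and> (\<forall>x. inner x (R x) = measure (spec_measure T x) B)"
    if "B \<in> sets borel" for B
    using ex_op_spec_measure[OF bounded_borel_on_indicator[OF that]]
      measure_on_interval_space[OF spec_measure_on_interval] by simp
qed (rule spec_measure_on_interval spec_measure_total)+

abbreviation calc :: "(real \<Rightarrow> real) \<Rightarrow> ('h \<Rightarrow>\<^sub>L 'h)" where
  "calc \<equiv> form_op (spec_measure T)"

lemma calc_poly: "calc (poly p) = poly_op p T"
  using hermitian by (intro form_op_eqI bounded_borel_on_poly) (auto simp: spec_measure_poly)

text \<open>Multiplicativity is first extended in the left factor, the right one being a polynomial, and
  then in the right factor. Each step uses that weak limits may be taken in one factor at a time.\<close>

lemma calc_mult_poly:
  assumes "bounded_borel_on a b f"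
  shows "calc f o\<^sub>L poly_op p T = calc (\<lambda>t. f t * poly p t)"
  using assms
proof (induction rule: bounded_borel_limit_induct)
  case (poly q)
  have "(\<lambda>t. poly q t * poly p t) = poly (q * p)"
    by (simp add: fun_eq_iff)
  then show ?case
    by (simp only: calc_poly poly_op_mult)
next
  case (linear f g c d)
  have "calc (\<lambda>t. (c * f t + d * g t) * poly p t) = calc (\<lambda>t. c * (f t * poly p t) + d * (g t * poly p t))"
    by (simp add: algebra_simps)
  also have "\<dots> = c *\<^sub>R (calc f o\<^sub>L poly_op p T) + d *\<^sub>R (calc g o\<^sub>L poly_op p T)"
    using linear by (simp add: form_op_linear bounded_borel_on_mult bounded_borel_on_poly)
  also have "\<dots> = (c *\<^sub>R calc f + d *\<^sub>R calc g) o\<^sub>L poly_op p T"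
    by (intro blinfun_eqI) (simp add: blinfun.bilinear_simps)
  also have "\<dots> = calc (\<lambda>t. c * f t + d * g t) o\<^sub>L poly_op p T"
    using linear by (simp add: form_op_linear)
  finally show ?case ..
next
  case (limit f g C)
  obtain D where D: "0 \<le> D" "\<And>t. t \<in> {a..b} \<Longrightarrow> \<bar>poly p t\<bar> \<le> D"
    using poly_bounded_on_interval by metis
  have "inner x ((calc f o\<^sub>L poly_op p T) y) = inner x (calc (\<lambda>t. f t * poly p t) y)" for x y
  proof (rule LIMSEQ_unique)
    show "(\<lambda>n. inner x ((calc (g n) o\<^sub>L poly_op p T) y)) \<longlonglongrightarrow> inner x ((calc f o\<^sub>L poly_op p T) y)"
      using form_op_tendsto_weak[OF limit.hyps(1,2,3,4)] by simp
    show "(\<lambda>n. inner x ((calc (g n) o\<^sub>L poly_op p T) y)) \<longlonglongrightarrow> inner x (calc (\<lambda>t. f t * poly p t) y)"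
      unfolding limit.IH
    proof (rule form_op_tendsto_weak)
      show "\<bar>g n t * poly p t\<bar> \<le> C * D" if "t \<in> {a..b}" for n t
        using limit.hyps(3)[OF that, of n] D(2)[OF that] by (simp add: abs_mult mult_mono')
    qed (use limit.hyps in \<open>auto intro!: bounded_borel_on_mult bounded_borel_on_poly tendsto_intros\<close>)
  qed
  then show ?case
    by (intro blinfun_eqI) (metis vector_eq_ldot)
qed

lemma calc_mult:
  assumes f: "bounded_borel_on a b f" and g: "bounded_borel_on a b g"
  shows "calc f o\<^sub>L calc g = calc (\<lambda>t. f t * g t)"
  using g
proof (induction rule: bounded_borel_limit_induct)
  case (poly q)
  show ?case
    using calc_mult_poly[OF f] by (simp add: calc_poly)
next
  case (linear g h c d)
  have "calc (\<lambda>t. f t * (c * g t + d * h t)) = calc (\<lambda>t. c * (f t * g t) + d * (f t * h t))"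
    by (simp add: algebra_simps)
  also have "\<dots> = c *\<^sub>R (calc f o\<^sub>L calc g) + d *\<^sub>R (calc f o\<^sub>L calc h)"
    using linear f by (simp add: form_op_linear bounded_borel_on_mult)
  also have "\<dots> = calc f o\<^sub>L (c *\<^sub>R calc g + d *\<^sub>R calc h)"
    by (intro blinfun_eqI) (simp add: blinfun.bilinear_simps)
  also have "\<dots> = calc f o\<^sub>L calc (\<lambda>t. c * g t + d * h t)"
    using linear by (simp add: form_op_linear)
  finally show ?case ..
next
  case (limit g h C)
  obtain D where D: "0 \<le> D" "\<And>t. t \<in> {a..b} \<Longrightarrow> \<bar>f t\<bar> \<le> D"
    using bounded_borel_on_bound[OF f] by metis
  have sw: "inner x ((calc f o\<^sub>L R) y) = inner (calc f x) (R y)" for x y R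
    using hermitian_inner[OF form_op_hermitian[OF f]] by simp
  have "inner x ((calc f o\<^sub>L calc g) y) = inner x (calc (\<lambda>t. f t * g t) y)" for x y
  proof (rule LIMSEQ_unique)
    show "(\<lambda>n. inner x ((calc f o\<^sub>L calc (h n)) y)) \<longlonglongrightarrow> inner x ((calc f o\<^sub>L calc g) y)"
      unfolding sw by (rule form_op_tendsto_weak[OF limit.hyps(1,2,3,4)])
    show "(\<lambda>n. inner x ((calc f o\<^sub>L calc (h n)) y)) \<longlonglongrightarrow> inner x (calc (\<lambda>t. f t * g t) y)"
      unfolding limit.IH
    proof (rule form_op_tendsto_weak)
      show "\<bar>f t * h n t\<bar> \<le> D * C" if "t \<in> {a..b}" for n t
        using limit.hyps(3)[OF that, of n] D(2)[OF that] by (simp add: abs_mult mult_mono')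
    qed (use limit.hyps f in \<open>auto intro!: bounded_borel_on_mult tendsto_intros\<close>)
  qed
  then show ?case
    by (intro blinfun_eqI) (metis vector_eq_ldot)
qed

lemma calc_commute:
  assumes S: "clinear_op S" "S o\<^sub>L T = T o\<^sub>L S" and f: "bounded_borel_on a b f"
  shows "S o\<^sub>L calc f = calc f o\<^sub>L S"
  using f
proof (induction rule: bounded_borel_limit_induct)
  case (poly p)
  show ?case
    using poly_op_commute[OF S(2)] by (simp add: calc_poly)
next
  case (linear f g c d)
  have "S (calc f y) = calc f (S y)" "S (calc g y) = calc g (S y)" for y
    using linear by (metis blinfun_apply_blinfun_compose)+
  then show ?case
    using linear by (intro blinfun_eqI) (simp add: form_op_linear blinfun.bilinear_simps)
next
  case (limit f g C)
  have sw: "inner x ((S o\<^sub>L R) y) = inner (adj S x) (R y)" for x y R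
    using adj_inner[OF S(1)] by simp
  have "inner x ((S o\<^sub>L calc f) y) = inner x ((calc f o\<^sub>L S) y)" for x y
  proof (rule LIMSEQ_unique)
    show "(\<lambda>n. inner x ((S o\<^sub>L calc (g n)) y)) \<longlonglongrightarrow> inner x ((S o\<^sub>L calc f) y)"
      unfolding sw by (rule form_op_tendsto_weak[OF limit.hyps(1,2,3,4)])
    show "(\<lambda>n. inner x ((S o\<^sub>L calc (g n)) y)) \<longlonglongrightarrow> inner x ((calc f o\<^sub>L S) y)"
      unfolding limit.IH using form_op_tendsto_weak[OF limit.hyps(1,2,3,4)] by simp
  qed
  then show ?case
    by (intro blinfun_eqI) (metis vector_eq_ldot)
qed

end

lemma spectral_bounds_norm:
  assumes "hermitian T"
  shows "spectral_bounds T (- norm T - 1) (norm T + 1)"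
proof
  fix x
  have "\<bar>inner x (T x)\<bar> \<le> norm T * (norm x)\<^sup>2"
    using abs_inner_op_le[of x T x] by (simp add: power2_eq_square mult.assoc)
  moreover have "0 \<le> (norm x)\<^sup>2"
    by simp
  ultimately show "(- norm T - 1) * (norm x)\<^sup>2 \<le> inner x (T x)" "inner x (T x) \<le> (norm T + 1) * (norm x)\<^sup>2"
    unfolding distrib_right left_diff_distrib by linarith+
  have "0 \<le> norm T"
    by simp
  then show "- norm T - 1 < norm T + 1"
    by linarith
qed (rule assms)

lemma spectral_bounds_positive:
  assumes "positive_op T"
  shows "spectral_bounds T 0 (norm T + 1)"
proof -
  interpret spectral_bounds T "- norm T - 1" "norm T + 1"
    using assms by (intro spectral_bounds_norm) (simp add: positive_op_iff)
  show ?thesis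
    using assms upper by unfold_locales (auto simp: positive_op_iff add_nonneg_pos)
qed

subsection \<open>Resolutions of the identity\<close>

lemma measure_of_real_additive:
  fixes m :: "real set \<Rightarrow> real"
  assumes nn: "\<And>B. B \<in> sets borel \<Longrightarrow> 0 \<le> m B"
    and add: "\<And>F :: nat \<Rightarrow> real set. range F \<subseteq> sets borel \<Longrightarrow> disjoint_family F \<Longrightarrow>
      (\<lambda>n. m (F n)) sums m (\<Union>n. F n)"
  shows "finite_measure (measure_of UNIV (sets borel) (\<lambda>B. ennreal (m B)))" (is "finite_measure ?M")
    and "B \<in> sets borel \<Longrightarrow> measure (measure_of UNIV (sets borel) (\<lambda>B. ennreal (m B))) B = m B"
    and "sets (measure_of UNIV (sets borel) (\<lambda>B. ennreal (m B))) = sets borel"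
proof -
  have sets: "sets ?M = sets borel"
    using sets.sigma_sets_eq[of "borel :: real measure"] by simp
  have "(\<lambda>n. m {}) sums m {}"
    using add[of "\<lambda>_. {}"] by (simp add: disjoint_family_on_def)
  then have "m {} = 0"
    using summable_LIMSEQ_zero[of "\<lambda>_. m {}"] sums_summable LIMSEQ_unique[OF _ tendsto_const] by metis
  have em: "emeasure ?M B = ennreal (m B)" if B: "B \<in> sets borel" for B
  proof (rule emeasure_measure_of[of ?M UNIV "sets borel"])
    show "positive (sets ?M) (\<lambda>B. ennreal (m B))"
      by (simp add: positive_def \<open>m {} = 0\<close>)
    show "countably_additive (sets ?M) (\<lambda>B. ennreal (m B))"
      unfolding countably_additive_def sets
    proof (intro allI impI)
      fix F :: "nat \<Rightarrow> real set"
      assume F: "range F \<subseteq> sets borel" "disjoint_family F" "\<Union> (range F) \<in> sets borel"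
      have "(\<lambda>n. ennreal (m (F n))) sums ennreal (m (\<Union>n. F n))"
        using add[OF F(1,2)] nn F by (subst sums_ennreal) auto
      then show "(\<Sum>n. ennreal (m (F n))) = ennreal (m (\<Union> (range F)))"
        by (rule sums_unique[symmetric])
    qed
  qed (use B sets in auto)
  have sp: "space ?M = UNIV"
    by simp
  show "finite_measure ?M"
    by (rule finite_measureI) (simp add: em sp)
  show "B \<in> sets borel \<Longrightarrow> measure ?M B = m B"
    by (simp add: measure_def em nn)
  show "sets ?M = sets borel"
    by (rule sets)
qed

lemma projection_iff: "projection P \<longleftrightarrow> hermitian P \<and> P o\<^sub>L P = P"
  by (simp add: projection_def self_adjoint_iff)

lemma projection_inner:
  assumes "projection P"
  shows "inner x (P x) = (norm (P x))\<^sup>2"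
proof -
  have "P (P x) = P x"
    using assms by (metis projection_iff blinfun_apply_blinfun_compose)
  then show ?thesis
    using assms hermitian_inner[of P x "P x"] by (simp add: projection_iff power2_norm_eq_inner)
qed

lemma projection_inner_le:
  assumes "projection P"
  shows "inner x (P x) \<le> (norm x)\<^sup>2"
proof -
  have "(norm (P x))\<^sup>2 \<le> norm x * norm (P x)"
    using norm_cauchy_schwarz[of x "P x"] projection_inner[OF assms, of x] by simp
  then have "norm (P x) \<le> norm x"
    by (cases "P x = 0") (auto simp: power2_eq_square)
  then show ?thesis
    by (simp add: projection_inner[OF assms] power_mono)
qed

text \<open>The sum, being a projection, cannot lengthen a vector in the range of one summand; this
  leaves no room for the other summand there.\<close>

lemma projection_sum_orthogonal:
  assumes P: "projection P" and Q: "projection Q" and PQ: "projection (P + Q)"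
  shows "Q o\<^sub>L P = 0"
proof (rule blinfun_eqI)
  fix x
  have PP: "P (P x) = P x"
    using P by (metis projection_iff blinfun_apply_blinfun_compose)
  have "(norm (P x))\<^sup>2 + (norm (Q (P x)))\<^sup>2 \<le> (norm (P x))\<^sup>2"
    using projection_inner_le[OF PQ, of "P x"] projection_inner[OF Q, of "P x"]
    by (simp add: blinfun.bilinear_simps inner_add_right PP power2_norm_eq_inner)
  then show "(Q o\<^sub>L P) x = blinfun_apply 0 x"
    by simp
qed

context spectral_bounds
begin

definition spec_proj :: "real set \<Rightarrow> ('h \<Rightarrow>\<^sub>L 'h)" where
  "spec_proj B = (if B \<in> sets borel then calc (indicator B) else 0)"

lemma spec_proj_inner: "B \<in> sets borel \<Longrightarrow> inner x (spec_proj B x) = measure (spec_measure T x) B"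
  using measure_on_interval_space[OF spec_measure_on_interval]
  by (simp add: spec_proj_def form_op_inner bounded_borel_on_indicator)

lemma spec_proj_mult:
  assumes "B \<in> sets borel" "C \<in> sets borel"
  shows "spec_proj B o\<^sub>L spec_proj C = spec_proj (B \<inter> C)"
  using assms by (simp add: spec_proj_def calc_mult bounded_borel_on_indicator
      indicator_inter_arith[abs_def])

lemma spec_proj_projection: "B \<in> sets borel \<Longrightarrow> projection (spec_proj B)"
  using spec_proj_mult[of B B]
  by (simp add: projection_iff) (simp add: spec_proj_def form_op_hermitian bounded_borel_on_indicator)

lemma spec_proj_disjoint_Un:
  assumes "B \<in> sets borel" "C \<in> sets borel" "B \<inter> C = {}"
  shows "spec_proj (B \<union> C) = spec_proj B + spec_proj C"
proof -
  have "indicator (B \<union> C) = (\<lambda>t. 1 * indicator B t + 1 * indicator C t :: real)"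
    using assms(3) by (auto simp: indicator_def fun_eq_iff)
  then show ?thesis
    using assms form_op_linear[of "indicator B" "indicator C" 1 1]
    by (simp add: spec_proj_def bounded_borel_on_indicator)
qed

lemma spec_proj_UN_lessThan:
  assumes F: "range F \<subseteq> sets borel" "disjoint_family (F :: nat \<Rightarrow> real set)"
  shows "(\<Sum>i<n. spec_proj (F i)) = spec_proj (\<Union>i<n. F i)"
proof (induction n)
  case 0
  have "hermitian (spec_proj {})" "inner x (spec_proj {} x) = 0" for x
    using spec_proj_projection[of "{}"] spec_proj_inner[of "{}" x] by (auto simp: projection_iff)
  then have "spec_proj {} = 0"
    by (intro hermitian_eqI) auto
  then show ?case
    by simp
next
  case (Suc n)
  have "(\<Union>i<n. F i) \<inter> F n = {}"
    using F(2) unfolding disjoint_family_on_def by (auto simp: less_le) (metis IntI empty_iff)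
  moreover have "F i \<in> sets borel" for i
    using F by auto
  ultimately have "spec_proj ((\<Union>i<n. F i) \<union> F n) = spec_proj (\<Union>i<n. F i) + spec_proj (F n)"
    by (intro spec_proj_disjoint_Un) auto
  with Suc show ?case
    by (simp add: lessThan_Suc Un_commute add.commute)
qed

lemma spec_proj_sums:
  assumes F: "range F \<subseteq> sets borel" "disjoint_family (F :: nat \<Rightarrow> real set)"
  shows "(\<lambda>n. spec_proj (F n) x) sums spec_proj (\<Union>n. F n) x"
proof -
  let ?U = "\<Union>n. F n"
  define D where "D n = ?U - (\<Union>i<n. F i)" for n
  have Fi: "F i \<in> sets borel" for i
    using F by auto
  have D: "D n \<in> sets borel" for n
    unfolding D_def using Fi by auto
  have diff: "spec_proj ?U x - (\<Sum>i<n. spec_proj (F i) x) = spec_proj (D n) x" for n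
  proof -
    have "spec_proj (D n \<union> (\<Union>i<n. F i)) = spec_proj (D n) + spec_proj (\<Union>i<n. F i)"
      using D Fi by (intro spec_proj_disjoint_Un) (auto simp: D_def)
    moreover have "D n \<union> (\<Union>i<n. F i) = ?U"
      by (auto simp: D_def)
    ultimately have "spec_proj ?U = spec_proj (D n) + (\<Sum>i<n. spec_proj (F i))"
      by (simp add: spec_proj_UN_lessThan[OF F])
    then show ?thesis
      by (simp add: blinfun.bilinear_simps blinfun.sum_left)
  qed
  interpret finite_measure "spec_measure T x"
    using spec_measure_on_interval[of x] by (simp add: measure_on_interval_def)
  have "(\<lambda>n. measure (spec_measure T x) (D n)) \<longlonglongrightarrow> measure (spec_measure T x) (\<Inter>n. D n)"
    using D measure_on_interval_sets[OF spec_measure_on_interval]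
    by (intro finite_Lim_measure_decseq) (auto simp: decseq_def D_def)
  also have "(\<Inter>n. D n) = {}"
    by (auto simp: D_def)
  finally have "(\<lambda>n. (norm (spec_proj (D n) x))\<^sup>2) \<longlonglongrightarrow> 0"
    using projection_inner[OF spec_proj_projection[OF D]] spec_proj_inner[OF D] by simp
  from tendsto_real_sqrt[OF this] have "(\<lambda>n. norm (spec_proj (D n) x)) \<longlonglongrightarrow> 0"
    by simp
  then have "(\<lambda>n. norm ((\<Sum>i<n. spec_proj (F i) x) - spec_proj ?U x)) \<longlonglongrightarrow> 0"
    by (simp add: diff[symmetric] norm_minus_commute)
  then show ?thesis
    unfolding sums_def by (rule LIM_zero_cancel[OF tendsto_norm_zero_cancel])
qed

lemma pvm_scalar_spec_proj: "pvm_scalar spec_proj x = spec_measure T x"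
proof -
  interpret finite_measure "spec_measure T x"
    using spec_measure_on_interval[of x] by (simp add: measure_on_interval_def)
  have sets: "sets (spec_measure T x) = sets borel" and sp: "space (spec_measure T x) = UNIV"
    using spec_measure_on_interval[of x] by (auto simp: measure_on_interval_def measure_on_interval_space)
  have "pvm_scalar spec_proj x = measure_of UNIV (sets borel) (emeasure (spec_measure T x))"
    unfolding pvm_scalar_def
  proof (rule measure_of_eq)
    fix B :: "real set"
    assume "B \<in> sigma_sets UNIV (sets borel)"
    then have "B \<in> sets borel"
      using sets.sigma_sets_eq[of "borel :: real measure"] by simp
    then show "ennreal (Re (cinner x (spec_proj B x))) = emeasure (spec_measure T x) B"
      by (simp add: inner_eq_Re_cinner[symmetric] spec_proj_inner emeasure_eq_measure)
  qed auto
  also have "\<dots> = spec_measure T x"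
    using measure_of_of_measure[of "spec_measure T x"] by (simp add: sets sp)
  finally show ?thesis .
qed

lemma resolution_of_identity_spec_proj: "resolution_of_identity T spec_proj"
  unfolding resolution_of_identity_def
proof (intro conjI allI ballI impI)
  show "projection (spec_proj B)" if "B \<in> sets borel" for B
    by (rule spec_proj_projection[OF that])
  show "spec_proj B = 0" if "B \<notin> sets borel" for B
    using that by (simp add: spec_proj_def)
  show "(\<lambda>n. spec_proj (F n) x) sums spec_proj (\<Union>n. F n) x"
    if "range F \<subseteq> sets borel" "disjoint_family F" for F :: "nat \<Rightarrow> real set" and x
    by (rule spec_proj_sums[OF that])
  show "\<exists>K. spec_proj {- K..K} = id_blinfun"
  proof
    let ?K = "max \<bar>a\<bar> \<bar>b\<bar>"
    have "calc (indicator {- ?K..?K}) = calc (\<lambda>_. 1)"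
      by (intro form_op_cong bounded_borel_on_indicator bounded_borel_on_const)
        (auto simp: indicator_def)
    then show "spec_proj {- ?K..?K} = id_blinfun"
      by (simp add: spec_proj_def form_op_one)
  qed
  show "cinner x (T x) = of_real (LINT t|pvm_scalar spec_proj x. t)" for x
    using spec_measure_poly[of x "[:0, 1:]"] hermitian_cinner_quadratic[OF hermitian, of x]
    by (simp add: pvm_scalar_spec_proj)
qed

text \<open>The form calculus of any other resolution of the identity is multiplicative and represents
  \<open>T\<close>, so its scalar measures have the polynomial moments of \<open>T\<close>.\<close>

lemma resolution_of_identity_unique:
  assumes Q: "resolution_of_identity T Q"
  shows "Q = spec_proj"
proof -
  have proj: "\<And>B. B \<in> sets borel \<Longrightarrow> projection (Q B)"
    and out: "\<And>B. B \<notin> sets borel \<Longrightarrow> Q B = 0"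
    and sums: "\<And>F x. range F \<subseteq> sets borel \<Longrightarrow> disjoint_family (F :: nat \<Rightarrow> real set) \<Longrightarrow>
        (\<lambda>n. Q (F n) x) sums Q (\<Union>n. F n) x"
    and repr: "\<And>x. cinner x (T x) = of_real (LINT t|pvm_scalar Q x. t)"
    using Q unfolding resolution_of_identity_def by blast+
  obtain K where K: "Q {- K..K} = id_blinfun"
    using Q unfolding resolution_of_identity_def by blast
  have herm: "hermitian (Q B)" if "B \<in> sets borel" for B
    using proj[OF that] by (simp add: projection_iff)
  have Q_empty: "Q {} = 0"
  proof (rule blinfun_eqI)
    fix x
    have "(\<lambda>n. Q {} x) sums Q {} x"
      using sums[of "\<lambda>_. {}" x] by (simp add: disjoint_family_on_def)
    then have "(\<lambda>n::nat. Q {} x) \<longlonglongrightarrow> 0"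
      by (rule summable_LIMSEQ_zero[OF sums_summable])
    then show "Q {} x = blinfun_apply 0 x"
      using LIMSEQ_unique[OF _ tendsto_const] by (metis blinfun.zero_left)
  qed
  have Q_Un: "Q (B \<union> C) = Q B + Q C" if "B \<in> sets borel" "C \<in> sets borel" "B \<inter> C = {}" for B C
  proof (rule blinfun_eqI)
    fix x
    define F where "F n = (if n = 0 then B else if n = 1 then C else {})" for n :: nat
    have "(\<lambda>n. Q (F n) x) sums Q (\<Union>n. F n) x"
      using that by (intro sums) (auto simp: F_def disjoint_family_on_def)
    moreover have "(\<Union>n. F n) = B \<union> C"
      by (auto simp: F_def split: if_splits)
    moreover have "(\<lambda>n. Q (F n) x) sums (\<Sum>n\<in>{0, 1}. Q (F n) x)"
      by (rule sums_finite) (auto simp: F_def Q_empty)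
    ultimately have "Q (B \<union> C) x = (\<Sum>n\<in>{0, 1}. Q (F n) x)"
      using sums_unique2 by fastforce
    then show "Q (B \<union> C) x = (Q B + Q C) x"
      by (simp add: F_def blinfun.bilinear_simps)
  qed
  have orth: "Q B o\<^sub>L Q C = 0" if "B \<in> sets borel" "C \<in> sets borel" "B \<inter> C = {}" for B C
  proof (rule projection_sum_orthogonal)
    show "projection (Q C + Q B)"
      using Q_Un[of C B] proj[of "C \<union> B"] that by (simp add: Int_commute)
  qed (use that proj in auto)
  have mult: "Q B o\<^sub>L Q C = Q (B \<inter> C)" if BC: "B \<in> sets borel" "C \<in> sets borel" for B C
  proof -
    have "Q ((B \<inter> C) \<union> (B - C)) = Q (B \<inter> C) + Q (B - C)"
      "Q ((B \<inter> C) \<union> (C - B)) = Q (B \<inter> C) + Q (C - B)"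
      using BC by (auto intro!: Q_Un)
    moreover have "(B \<inter> C) \<union> (B - C) = B" "(B \<inter> C) \<union> (C - B) = C"
      by auto
    ultimately have "Q B = Q (B \<inter> C) + Q (B - C)" "Q C = Q (B \<inter> C) + Q (C - B)"
      by simp_all
    moreover have "Q (B \<inter> C) o\<^sub>L Q (C - B) = 0" "Q (B - C) o\<^sub>L Q (B \<inter> C) = 0" "Q (B - C) o\<^sub>L Q (C - B) = 0"
      using BC by (auto intro!: orth)
    moreover have "Q (B \<inter> C) o\<^sub>L Q (B \<inter> C) = Q (B \<inter> C)"
      using proj[of "B \<inter> C"] BC by (simp add: projection_iff)
    moreover have "(S + R) o\<^sub>L (S + R') = (S o\<^sub>L S) + (S o\<^sub>L R') + ((R o\<^sub>L S) + (R o\<^sub>L R'))" for S R R' :: "'h \<Rightarrow>\<^sub>L 'h"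
      by (intro blinfun_eqI) (simp add: blinfun.bilinear_simps)
    ultimately show ?thesis
      by (metis add.right_neutral)
  qed
  have inner_sums: "(\<lambda>n. inner x (Q (F n) x)) sums inner x (Q (\<Union>n. F n) x)"
    if "range F \<subseteq> sets borel" "disjoint_family (F :: nat \<Rightarrow> real set)" for F x
    by (rule bounded_linear.sums[OF bounded_linear_inner_right sums[OF that]])
  define \<nu> where "\<nu> = pvm_scalar Q"
  have \<nu>_fin: "finite_measure (\<nu> x)" and \<nu>_sets: "sets (\<nu> x) = sets borel"
    and \<nu>: "\<And>B. B \<in> sets borel \<Longrightarrow> measure (\<nu> x) B = inner x (Q B x)" for x
    using measure_of_real_additive[of "\<lambda>B. inner x (Q B x)"] inner_sums projection_inner[OF proj]
    by (auto simp: \<nu>_def pvm_scalar_def inner_eq_Re_cinner[symmetric])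
  define K' where "K' = \<bar>K\<bar> + 1"
  have Q_compl: "Q (- {- K..K}) = 0 \<and> Q UNIV = id_blinfun"
  proof -
    have U: "Q UNIV = id_blinfun + Q (- {- K..K})"
      using Q_Un[of "{- K..K}" "- {- K..K}"] by (simp add: K)
    have "inner x (Q (- {- K..K}) x) = 0" for x
    proof (rule antisym)
      show "inner x (Q (- {- K..K}) x) \<le> 0"
        using projection_inner_le[OF proj[of UNIV], of x]
        by (simp add: U blinfun.bilinear_simps inner_add_right power2_norm_eq_inner)
    qed (simp add: projection_inner[OF proj])
    then have "Q (- {- K..K}) = 0"
      by (intro hermitian_eqI herm) auto
    with U show ?thesis
      by simp
  qed
  interpret \<nu>: measure_form "- K'" K' \<nu>
  proof
    show "measure_on_interval (- K') K' (\<nu> x)" for x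
    proof (rule measure_on_interval_mono)
      interpret finite_measure "\<nu> x" by (rule \<nu>_fin)
      show "measure_on_interval (- K) K (\<nu> x)"
        using \<nu>_fin[of x] \<nu>_sets[of x] \<nu>[of "- {- K..K}" x] Q_compl
        by (simp add: measure_on_interval_def emeasure_eq_measure)
    qed (auto simp: K'_def)
    show "measure (\<nu> x) UNIV = (norm x)\<^sup>2" for x
      using Q_compl by (simp add: \<nu> power2_norm_eq_inner)
    show "\<exists>R. hermitian R \<and> (\<forall>x. inner x (R x) = measure (\<nu> x) B)" if "B \<in> sets borel" for B
      using that herm \<nu> by (intro exI[of _ "Q B"]) auto
  qed
  let ?bb = "bounded_borel_on (- K') K'"
  have sp: "space (\<nu> x) = UNIV" for x
    using \<nu>.on_interval measure_on_interval_space by blast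
  have ind: "form_op \<nu> (indicator B) = Q B" if "B \<in> sets borel" for B
    using that herm \<nu> by (intro \<nu>.form_op_eqI bounded_borel_on_indicator) (auto simp: sp)
  have fmult: "form_op \<nu> f o\<^sub>L form_op \<nu> g = form_op \<nu> (\<lambda>t. f t * g t)" if "?bb f" "?bb g" for f g
    using that mult by (intro \<nu>.form_op_mult_of_indicators) (auto simp: ind)
  have fid: "form_op \<nu> (\<lambda>t. t) = T"
  proof (rule \<nu>.form_op_eqI)
    show "?bb (\<lambda>t. t)"
      by (rule bounded_borel_on_ident)
    show "inner x (T x) = (LINT t|\<nu> x. t)" for x
      using repr[of x] by (simp add: inner_eq_Re_cinner \<nu>_def)
  qed (rule hermitian)
  have fpoly: "form_op \<nu> (poly p) = poly_op p T" for p
  proof (induction p)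
    case 0
    have "form_op \<nu> (\<lambda>_. 0) = 0"
      by (intro \<nu>.form_op_eqI bounded_borel_on_const) auto
    moreover have "poly (0 :: real poly) = (\<lambda>_. 0)"
      by auto
    ultimately show ?case
      by simp
  next
    case (pCons c p)
    have i: "?bb (\<lambda>t. t)"
      by (rule bounded_borel_on_ident)
    have "poly (pCons c p) = (\<lambda>t. c * 1 + 1 * (t * poly p t))"
      by (auto simp: fun_eq_iff)
    then have "form_op \<nu> (poly (pCons c p)) = c *\<^sub>R id_blinfun + (form_op \<nu> (\<lambda>t. t * poly p t))"
      using \<nu>.form_op_linear[OF bounded_borel_on_const bounded_borel_on_mult[OF i bounded_borel_on_poly], of c 1 1 p]
      by (simp add: \<nu>.form_op_one)
    also have "form_op \<nu> (\<lambda>t. t * poly p t) = (T o\<^sub>L form_op \<nu> (poly p))"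
      using fmult[OF i bounded_borel_on_poly, of p] by (simp add: fid)
    finally show ?case
      by (simp add: pCons)
  qed
  have "\<nu> x = spec_measure T x" for x
    by (rule spec_measure_eqI[symmetric, OF \<nu>.on_interval])
      (simp add: \<nu>.form_op_inner[OF bounded_borel_on_poly, symmetric] fpoly)
  then have "Q B = spec_proj B" if "B \<in> sets borel" for B
    using that spec_proj_projection[OF that]
    by (intro hermitian_eqI herm) (auto simp: spec_proj_inner \<nu>[symmetric] projection_iff)
  moreover have "Q B = spec_proj B" if "B \<notin> sets borel" for B
    using that out by (simp add: spec_proj_def)
  ultimately show ?thesis
    by (intro ext) blast
qed

lemma spectral_pvm_eq: "spectral_pvm T = spec_proj"
  unfolding spectral_pvm_def
  using resolution_of_identity_spec_proj resolution_of_identity_unique by blast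

lemma borel_calculus_eq:
  assumes f: "bounded_borel_on a b f"
  shows "borel_calculus f T = calc f"
  unfolding borel_calculus_def spectral_pvm_eq pvm_scalar_spec_proj
proof (rule the_equality)
  show "clinear_op (calc f) \<and> (\<forall>x. cinner x (calc f x) = of_real (LINT t|spec_measure T x. f t))"
    using form_op_hermitian[OF f] by (simp add: hermitian_cinner_quadratic form_op_inner[OF f])
next
  fix R
  assume R: "clinear_op R \<and> (\<forall>x. cinner x (blinfun_apply R x) = of_real (LINT t|spec_measure T x. f t))"
  then have "hermitian R"
    by (intro hermitianI_real_quadratic) auto
  then show "R = calc f"
    using R by (intro form_op_eqI[OF f, symmetric]) (auto simp: inner_eq_Re_cinner)
qed

end

section \<open>The trace and the functional calculus\<close>

lemma scaleC_op_compose_left: "scaleC_op c S o\<^sub>L T = scaleC_op c (S o\<^sub>L T)"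
  by (rule blinfun_eqI) (simp add: blinfun_apply_scaleC_op)

lemma scaleC_op_compose_right: "clinear_op S \<Longrightarrow> S o\<^sub>L scaleC_op c T = scaleC_op c (S o\<^sub>L T)"
  by (rule blinfun_eqI) (simp add: blinfun_apply_scaleC_op clinear_op_def)

lemma compose_assoc: "(R o\<^sub>L S) o\<^sub>L T = R o\<^sub>L (S o\<^sub>L T)"
  by (rule blinfun_eqI) simp

lemma compose_id [simp]: "T o\<^sub>L id_blinfun = T" "id_blinfun o\<^sub>L T = T"
  by (rule blinfun_eqI, simp)+

lemma compose_add: "R o\<^sub>L (S + T) = (R o\<^sub>L S) + (R o\<^sub>L T)" "(S + T) o\<^sub>L R = (S o\<^sub>L R) + (T o\<^sub>L R)"
  by (rule blinfun_eqI, simp add: blinfun.bilinear_simps)+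

lemma compose_diff: "R o\<^sub>L (S - T) = (R o\<^sub>L S) - (R o\<^sub>L T)" "(S - T) o\<^sub>L R = (S o\<^sub>L R) - (T o\<^sub>L R)"
  by (rule blinfun_eqI, simp add: blinfun.bilinear_simps)+

lemma compose_scaleR: "R o\<^sub>L (c *\<^sub>R T) = c *\<^sub>R (R o\<^sub>L T)" "(c *\<^sub>R T) o\<^sub>L R = c *\<^sub>R (T o\<^sub>L R)"
  by (rule blinfun_eqI, simp add: blinfun.bilinear_simps)+

lemmas tendsto_compose_op = bounded_bilinear.tendsto[OF bounded_bilinear_blinfun_compose]

text \<open>The algebra \<open>M\<close>, being a commutant, is closed in norm, as is needed to find in it the norm limits
  of polynomials.\<close>

lemma commutant_closed: "closed (commutant N)"
  unfolding closed_sequential_limits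
proof (intro allI impI)
  fix T :: "nat \<Rightarrow> 'a \<Rightarrow>\<^sub>L 'a" and S
  assume *: "(\<forall>n. T n \<in> commutant N) \<and> T \<longlonglongrightarrow> S"
  then have T: "\<And>n. T n \<in> commutant N" and lim: "T \<longlonglongrightarrow> S"
    by auto
  have "S (scaleC c x) = scaleC c (S x)" for c x
  proof (rule LIMSEQ_unique)
    show "(\<lambda>n. T n (scaleC c x)) \<longlonglongrightarrow> S (scaleC c x)"
      by (intro tendsto_intros lim)
    have "(\<lambda>n. scaleC c (T n x)) \<longlonglongrightarrow> scaleC c (S x)"
      by (intro bounded_linear.tendsto[OF bounded_linear_scaleC] tendsto_intros lim)
    then show "(\<lambda>n. T n (scaleC c x)) \<longlonglongrightarrow> scaleC c (S x)"
      using T by (simp add: commutant_def clinear_op_def)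
  qed
  moreover have "S o\<^sub>L R = R o\<^sub>L S" if "R \<in> N" for R
  proof (rule LIMSEQ_unique)
    show "(\<lambda>n. T n o\<^sub>L R) \<longlonglongrightarrow> (S o\<^sub>L R)"
      by (intro tendsto_compose_op tendsto_const lim)
    have "(\<lambda>n. R o\<^sub>L T n) \<longlonglongrightarrow> (R o\<^sub>L S)"
      by (intro tendsto_compose_op tendsto_const lim)
    then show "(\<lambda>n. T n o\<^sub>L R) \<longlonglongrightarrow> (R o\<^sub>L S)"
      using T that by (simp add: commutant_def)
  qed
  ultimately show "S \<in> commutant N"
    by (simp add: commutant_def clinear_op_def)
qed

context tracial_wstar_space
begin

lemma bicommutant: "commutant (commutant M) = M"
  using finite_vna by (simp add: finite_von_neumann_algebra_def von_neumann_algebra_def)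

lemma M_clinear: "T \<in> M \<Longrightarrow> clinear_op T"
  using finite_vna by (simp add: finite_von_neumann_algebra_def von_neumann_algebra_def)

lemma M_adj: "T \<in> M \<Longrightarrow> adj T \<in> M"
  using finite_vna by (simp add: finite_von_neumann_algebra_def von_neumann_algebra_def)

lemma M_I:
  assumes "clinear_op T" "\<And>S. S \<in> commutant M \<Longrightarrow> T o\<^sub>L S = S o\<^sub>L T"
  shows "T \<in> M"
  using assms by (subst bicommutant[symmetric]) (simp add: commutant_def)

lemma M_commute: "T \<in> M \<Longrightarrow> S \<in> commutant M \<Longrightarrow> T o\<^sub>L S = S o\<^sub>L T"
  by (simp add: commutant_def)

lemma M_closed: "closed M"
  using commutant_closed[of "commutant M"] by (simp add: bicommutant)

lemma M_id: "id_blinfun \<in> M"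
  by (rule M_I) auto

lemma M_add:
  assumes "S \<in> M" "T \<in> M"
  shows "S + T \<in> M"
proof (rule M_I)
  show "(S + T) o\<^sub>L R = R o\<^sub>L (S + T)" if "R \<in> commutant M" for R
    by (simp only: compose_add M_commute[OF assms(1) that] M_commute[OF assms(2) that])
qed (use assms M_clinear in auto)

lemma M_scaleC:
  assumes "T \<in> M"
  shows "scaleC_op c T \<in> M"
proof (rule M_I)
  show "scaleC_op c T o\<^sub>L R = R o\<^sub>L scaleC_op c T" if R: "R \<in> commutant M" for R
  proof -
    have "clinear_op R"
      using R by (simp add: commutant_def)
    then show ?thesis
      by (simp only: scaleC_op_compose_left scaleC_op_compose_right M_commute[OF assms R])
  qed
qed (use assms M_clinear in auto)

lemma M_scaleR: "T \<in> M \<Longrightarrow> r *\<^sub>R T \<in> M"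
  using M_scaleC[of T "of_real r"] by (simp add: scaleC_op_of_real)

lemma M_diff: "S \<in> M \<Longrightarrow> T \<in> M \<Longrightarrow> S - T \<in> M"
  using M_add[of S "(-1) *\<^sub>R T"] M_scaleR[of T "-1"] by simp

lemma M_zero: "0 \<in> M"
  using M_scaleR[OF M_id, of 0] by simp

lemma M_compose:
  assumes "S \<in> M" "T \<in> M"
  shows "S o\<^sub>L T \<in> M"
proof (rule M_I)
  fix R
  assume R: "R \<in> commutant M"
  have "(S o\<^sub>L T) o\<^sub>L R = (S o\<^sub>L R) o\<^sub>L T"
    using M_commute[OF assms(2) R] by (simp add: compose_assoc)
  then show "(S o\<^sub>L T) o\<^sub>L R = R o\<^sub>L (S o\<^sub>L T)"
    using M_commute[OF assms(1) R] by (simp add: compose_assoc)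
qed (use assms in \<open>auto simp: M_clinear\<close>)

lemma M_uminus: "T \<in> M \<Longrightarrow> - T \<in> M"
  using M_scaleR[of T "-1"] by simp

lemmas M_intros = M_uminus M_id M_add M_diff M_scaleC M_scaleR M_compose M_zero

lemma E_scaleR: "T \<in> M \<Longrightarrow> E (r *\<^sub>R T) = of_real r * E T"
  using E_scaleC[of T "of_real r"] by (simp add: scaleC_op_of_real)

lemma E_zero: "E 0 = 0"
  using E_scaleR[OF M_id, of 0] by simp

lemma E_diff: "S \<in> M \<Longrightarrow> T \<in> M \<Longrightarrow> E (S - T) = E S - E T"
  using E_add[of S "(-1) *\<^sub>R T"] M_scaleR[of T "-1"] E_scaleR[of T "-1"] by simp

lemma E_sum: "(\<And>i. i \<in> A \<Longrightarrow> F i \<in> M) \<Longrightarrow> finite A \<Longrightarrow> E (\<Sum>i\<in>A. F i) = (\<Sum>i\<in>A. E (F i))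
    \<and> (\<Sum>i\<in>A. F i) \<in> M"
  by (induction A rule: infinite_finite_induct) (auto simp: E_zero E_add M_zero M_add)

lemma E_hermitian:
  assumes T: "T \<in> M" "hermitian T"
  shows E_hermitian_real: "E T = of_real (Re (E T))" and E_hermitian_abs_le: "\<bar>Re (E T)\<bar> \<le> norm T"
proof -
  let ?c = "norm T"
  have b: "\<bar>inner x (T x)\<bar> \<le> ?c * (norm x)\<^sup>2" for x
    using abs_inner_op_le[of x T x] by (simp add: power2_eq_square mult.assoc)
  have "positive_op (?c *\<^sub>R id_blinfun - T)" "positive_op (?c *\<^sub>R id_blinfun + T)"
  proof -
    have "0 \<le> inner x ((?c *\<^sub>R id_blinfun - T) x)" "0 \<le> inner x ((?c *\<^sub>R id_blinfun + T) x)" for x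
      using b[of x]
      by (simp_all add: blinfun.bilinear_simps inner_diff_right inner_add_right power2_norm_eq_inner abs_le_iff)
    then show "positive_op (?c *\<^sub>R id_blinfun - T)" "positive_op (?c *\<^sub>R id_blinfun + T)"
      using T by (auto simp: positive_op_iff)
  qed
  then have "E (?c *\<^sub>R id_blinfun - T) \<in> \<real>\<^sub>\<ge>\<^sub>0" "E (?c *\<^sub>R id_blinfun + T) \<in> \<real>\<^sub>\<ge>\<^sub>0"
    using T by (auto intro!: E_positive M_intros)
  moreover have "E (?c *\<^sub>R id_blinfun - T) = of_real ?c - E T" "E (?c *\<^sub>R id_blinfun + T) = of_real ?c + E T"
    using T by (simp_all add: E_diff E_add E_scaleR M_intros E_id)
  ultimately show "E T = of_real (Re (E T))" "\<bar>Re (E T)\<bar> \<le> norm T"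
    by (auto simp: complex_nonneg_Reals_iff complex_eq_iff abs_le_iff)
qed

text \<open>The factor 2 stems from splitting the operator into its real and imaginary parts. The bound
  serves only to make \<open>E\<close> continuous in norm.\<close>

lemma norm_E_le:
  assumes T: "T \<in> M"
  shows "cmod (E T) \<le> 2 * norm T"
proof -
  have c: "clinear_op T" and ca: "clinear_op (adj T)"
    using T by (auto simp: M_clinear clinear_adj)
  define H1 where "H1 = (1/2) *\<^sub>R (T + adj T)"
  define H2 where "H2 = (- 1/2) *\<^sub>R scaleC_op \<i> (T - adj T)"
  have adj': "inner (T x) y = inner x (adj T y)" for x y
    using adj_inner(1)[OF c, of y x] by (simp add: inner_commute)
  have H1: "hermitian H1"
    using c ca by (simp add: hermitian_def H1_def blinfun.bilinear_simps inner_add_left inner_add_right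
        adj_inner adj' add.commute)
  have "inner (H2 x) y = inner x (H2 y)" for x y
  proof -
    have i: "adj T (scaleC \<i> y) = scaleC \<i> (adj T y)" "T (scaleC \<i> y) = scaleC \<i> (T y)"
      using c ca by (auto simp: clinear_op_iff_i)
    show ?thesis
      by (simp add: H2_def blinfun.bilinear_simps blinfun_apply_scaleC_op inner_scaleC_i_left
          inner_diff_left adj_inner[OF c] adj' i scaleC_diff_right inner_diff_right)
  qed
  then have H2: "hermitian H2"
    using c ca by (simp add: hermitian_def H2_def)
  have M12: "H1 \<in> M" "H2 \<in> M"
    using T M_adj[OF T] by (auto simp: H1_def H2_def intro!: M_intros)
  have n: "norm (adj T) \<le> norm T"
    by (rule norm_adj_le[OF c])
  have n1: "norm H1 \<le> norm T"
    using norm_triangle_ineq[of T "adj T"] n by (simp add: H1_def)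
  have n2: "norm H2 \<le> norm T"
  proof -
    have "norm (scaleC_op \<i> (T - adj T)) \<le> norm (T - adj T)"
      by (rule norm_blinfun_bound) (auto simp: blinfun_apply_scaleC_op norm_scaleC norm_blinfun)
    also have "\<dots> \<le> norm T + norm (adj T)"
      by (rule norm_triangle_ineq4)
    finally show ?thesis
      using n by (simp add: H2_def)
  qed
  have "T = H1 + scaleC_op \<i> H2"
    by (rule blinfun_eqI) (simp add: H1_def H2_def blinfun.bilinear_simps blinfun_apply_scaleC_op
        scaleC_scaleR_commute scaleC_scaleC scaleC_minus_right algebra_simps flip: scaleR_add_left)
  then have "E T = E H1 + \<i> * E H2"
    using M12 by (metis E_add E_scaleC M_scaleC)
  then have "cmod (E T) \<le> cmod (E H1) + cmod (E H2)"
    by (metis norm_triangle_ineq norm_mult norm_ii mult_1)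
  moreover have "cmod (E H1) \<le> norm H1" "cmod (E H2) \<le> norm H2"
    using E_hermitian[OF M12(1) H1] E_hermitian[OF M12(2) H2] by (metis norm_of_real)+
  ultimately show ?thesis
    using n1 n2 by linarith
qed

lemma E_tendsto:
  assumes T: "\<And>n. T n \<in> M" and lim: "T \<longlonglongrightarrow> S"
  shows "(\<lambda>n. E (T n)) \<longlonglongrightarrow> E S"
proof -
  have S: "S \<in> M"
    using M_closed T lim by (metis closed_sequentially)
  have "(\<lambda>n. norm (T n - S)) \<longlonglongrightarrow> 0"
    using lim by (simp add: LIM_zero tendsto_norm_zero)
  then have "(\<lambda>n. 2 * norm (T n - S)) \<longlonglongrightarrow> 0"
    by (rule tendsto_mult_right_zero)
  moreover have "norm (E (T n) - E S) \<le> 2 * norm (T n - S)" for n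
    using norm_E_le[OF M_diff[OF T S], of n] by (simp add: E_diff T S)
  ultimately have "(\<lambda>n. E (T n) - E S) \<longlonglongrightarrow> 0"
    by (rule Lim_null_comparison[OF always_eventually[OF allI], rotated])
  then show ?thesis
    by (rule LIM_zero_cancel)
qed

end

locale bounded_element = tracial_wstar_space M E + spectral_bounds T a b
  for M :: "('h::complex_hilbert \<Rightarrow>\<^sub>L 'h) set" and E and T :: "'h \<Rightarrow>\<^sub>L 'h" and a b +
  assumes T_in_M: "T \<in> M"
begin

lemma calc_in_M:
  assumes f: "bounded_borel_on a b f"
  shows "calc f \<in> M"
proof (rule M_I)
  show "clinear_op (calc f)"
    using form_op_hermitian[OF f] by simp
  fix S
  assume S: "S \<in> commutant M"
  then have "clinear_op S" "S o\<^sub>L T = T o\<^sub>L S"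
    using T_in_M by (auto simp: commutant_def)
  then show "calc f o\<^sub>L S = S o\<^sub>L calc f"
    using calc_commute[OF _ _ f] by simp
qed

lemma spec_proj_in_M: "spec_proj B \<in> M"
  by (simp add: spec_proj_def calc_in_M bounded_borel_on_indicator M_zero)

definition \<mu> :: "real measure" where "\<mu> = spectral_distribution E T"

text \<open>Here normality of \<open>E\<close> enters: the spectral projections of increasing unions are suprema,
  which makes the spectral distribution countably additive.\<close>

lemma E_spec_proj_sums:
  assumes F: "range F \<subseteq> sets borel" "disjoint_family (F :: nat \<Rightarrow> real set)"
  shows "(\<lambda>n. Re (E (spec_proj (F n)))) sums Re (E (spec_proj (\<Union>n. F n)))"
proof -
  have Fi: "F i \<in> sets borel" for i
    using F by auto
  define S where "S n = spec_proj (\<Union>i<n. F i)" for n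
  let ?U = "spec_proj (\<Union>n. F n)"
  have S_herm: "hermitian (S n)" and U_herm: "hermitian ?U" for n
    using spec_proj_projection[of "\<Union>i<n. F i"] spec_proj_projection[of "\<Union>n. F n"] Fi
    by (auto simp: S_def projection_iff)
  have fm: "finite_measure (spec_measure T x)" for x
    using spec_measure_on_interval[of x] by (simp add: measure_on_interval_def)
  have sets: "sets (spec_measure T x) = sets borel" for x
    using spec_measure_on_interval[of x] by (simp add: measure_on_interval_def)
  have mono: "inner x (S m x) \<le> inner x (S n x)" if "m \<le> n" for m n x
  proof -
    have "(\<Union>i<m. F i) \<subseteq> (\<Union>i<n. F i)"
      using that by (intro UN_mono) auto
    then show ?thesis
      unfolding S_def using Fi fm[of x] sets[of x]
      by (subst (1 2) spec_proj_inner) (auto intro!: finite_measure.finite_measure_mono)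
  qed
  have le_U: "inner x (S n x) \<le> inner x (?U x)" for n x
    unfolding S_def using Fi fm[of x] sets[of x]
    by (subst (1 2) spec_proj_inner) (auto intro!: finite_measure.finite_measure_mono)
  have pos: "0 \<le> inner x (S n x)" for n x
    unfolding S_def using Fi by (subst spec_proj_inner) auto
  have partial: "Re (E (S n)) = (\<Sum>i<n. Re (E (spec_proj (F i))))" for n
    using E_sum[of "{..<n}" "\<lambda>i. spec_proj (F i)"] spec_proj_in_M
    by (simp add: S_def spec_proj_UN_lessThan[OF F, symmetric])
  have lub: "is_lub_in M (range S) ?U"
    unfolding is_lub_in_def
  proof (intro conjI ballI impI)
    show "self_adjoint ?U"
      using U_herm by (simp add: self_adjoint_iff)
    show "op_le R ?U" if "R \<in> range S" for R
      using that S_herm U_herm le_U by (auto simp: op_le_iff)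
    show "op_le ?U R" if "R \<in> M" "self_adjoint R" "\<forall>R'\<in>range S. op_le R' R" for R
    proof -
      have R: "hermitian R"
        using that by (simp add: self_adjoint_iff)
      have "inner x (?U x) \<le> inner x (R x)" for x
      proof (rule LIMSEQ_le_const2)
        have "(\<lambda>n. \<Sum>i<n. spec_proj (F i) x) \<longlonglongrightarrow> ?U x"
          using spec_proj_sums[OF F] by (simp add: sums_def)
        then have "(\<lambda>n. S n x) \<longlonglongrightarrow> ?U x"
          by (simp add: S_def spec_proj_UN_lessThan[OF F, symmetric] blinfun.sum_left)
        then show "(\<lambda>n. inner x (S n x)) \<longlonglongrightarrow> inner x (?U x)"
          by (rule tendsto_inner[OF tendsto_const])
        show "\<exists>N. \<forall>n\<ge>N. inner x (S n x) \<le> inner x (R x)"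
          using that(3) R S_herm by (auto simp: op_le_iff)
      qed
      then show ?thesis
        using R U_herm by (simp add: op_le_iff)
    qed
  qed (rule spec_proj_in_M)
  have E_mono: "Re (E R) \<le> Re (E R')" if "R \<in> M" "R' \<in> M" "op_le R R'" for R R'
    using that E_positive[of "R' - R"] by (auto simp: op_le_def M_diff E_diff complex_nonneg_Reals_iff)
  have S_M: "S n \<in> M" for n
    by (simp add: S_def spec_proj_in_M)
  have "Re (E ?U) = (SUP R\<in>range S. Re (E R))"
  proof (rule E_normal[OF _ _ _ _ lub])
    show "\<exists>R\<in>range S. op_le R1 R \<and> op_le R2 R" if R12: "R1 \<in> range S" "R2 \<in> range S" for R1 R2
    proof -
      obtain m n where "R1 = S m" "R2 = S n"
        using R12 by auto
      then show ?thesis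
        using mono S_herm by (intro bexI[of _ "S (max m n)"]) (auto simp: op_le_iff)
    qed
  qed (use S_M S_herm pos in \<open>auto simp: positive_op_iff\<close>)
  then have U: "Re (E ?U) = (SUP n. Re (E (S n)))"
    by (simp add: image_image)
  have "(\<lambda>n. Re (E (S n))) \<longlonglongrightarrow> (SUP n. Re (E (S n)))"
  proof (rule LIMSEQ_incseq_SUP)
    show "bdd_above (range (\<lambda>n. Re (E (S n))))"
      using E_mono[OF S_M spec_proj_in_M] S_herm U_herm le_U
      by (intro bdd_aboveI[of _ "Re (E ?U)"]) (auto simp: op_le_iff)
    show "incseq (\<lambda>n. Re (E (S n)))"
      using E_mono[OF S_M S_M] S_herm mono by (auto simp: incseq_def op_le_iff)
  qed
  then show ?thesis
    by (simp add: sums_def U partial)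
qed

lemma borel_calculus_indicator: "B \<in> sets borel \<Longrightarrow> borel_calculus (indicator B) T = spec_proj B"
  by (simp add: borel_calculus_eq bounded_borel_on_indicator spec_proj_def)

lemma \<mu>: shows finite_\<mu>: "finite_measure \<mu>"
  and measure_\<mu>: "B \<in> sets borel \<Longrightarrow> measure \<mu> B = Re (E (spec_proj B))"
  and sets_\<mu>: "sets \<mu> = sets borel"
proof -
  let ?m = "\<lambda>B. Re (E (borel_calculus (indicator B) T))"
  have nn: "0 \<le> ?m B" if "B \<in> sets borel" for B
  proof -
    have "positive_op (spec_proj B)"
      using spec_proj_projection[OF that] projection_inner[OF spec_proj_projection[OF that]]
      by (simp add: positive_op_iff projection_iff)
    then show ?thesis
      using E_positive[OF spec_proj_in_M] that
      by (simp add: borel_calculus_indicator complex_nonneg_Reals_iff)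
  qed
  have sums: "(\<lambda>n. ?m (F n)) sums ?m (\<Union>n. F n)"
    if "range F \<subseteq> sets borel" "disjoint_family (F :: nat \<Rightarrow> real set)" for F
  proof -
    have "F n \<in> sets borel" for n
      using that by auto
    moreover from this have "(\<Union>n. F n) \<in> sets borel"
      by auto
    ultimately show ?thesis
      using E_spec_proj_sums[OF that] by (simp add: borel_calculus_indicator)
  qed
  show "finite_measure \<mu>"
    unfolding \<mu>_def spectral_distribution_def by (rule measure_of_real_additive(1)[OF nn sums])
  show "sets \<mu> = sets borel"
    unfolding \<mu>_def spectral_distribution_def by (rule measure_of_real_additive(3)[OF nn sums])
  assume B: "B \<in> sets borel"
  have "measure \<mu> B = ?m B"
    unfolding \<mu>_def spectral_distribution_def by (rule measure_of_real_additive(2)[OF nn sums B])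
  then show "measure \<mu> B = Re (E (spec_proj B))"
    by (simp only: borel_calculus_indicator[OF B])
qed

lemma space_\<mu>: "space \<mu> = UNIV"
  using sets_eq_imp_space_eq[OF sets_\<mu>] by simp

lemma \<mu>_on_interval: "measure_on_interval a b \<mu>"
proof -
  have "spec_proj (- {a..b}) = 0"
  proof (rule hermitian_eqI)
    show "inner x (spec_proj (- {a..b}) x) = inner x (blinfun_apply 0 x)" for x
      using spec_measure_on_interval[of x]
      by (simp add: spec_proj_inner measure_on_interval_def measure_def)
  qed (use spec_proj_projection[of "- {a..b}"] in \<open>auto simp: projection_iff\<close>)
  then have "measure \<mu> (- {a..b}) = 0"
    by (simp add: measure_\<mu> E_zero)
  then show ?thesis
    using finite_\<mu> sets_\<mu> by (simp add: measure_on_interval_def finite_measure.emeasure_eq_measure)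
qed

lemma \<mu>_total: "measure \<mu> UNIV = 1"
proof -
  have "spec_proj UNIV = calc (\<lambda>_. 1)"
    by (simp add: spec_proj_def indicator_def[abs_def])
  then show ?thesis
    by (simp add: measure_\<mu> form_op_one E_id)
qed

lemma E_calc:
  assumes "bounded_borel_on a b f"
  shows "E (calc f) = of_real (LINT t|\<mu>. f t)"
proof -
  have "Re (E (calc f)) = (LINT t|\<mu>. f t)"
    using assms
  proof (induction rule: bounded_borel_uniform_induct)
    case (indicator B)
    then show ?case
      using measure_\<mu>[OF indicator] by (simp add: spec_proj_def space_\<mu>)
  next
    case (linear f g c d)
    have "integrable \<mu> f" "integrable \<mu> g"
      using linear measure_on_interval_integrable'[OF \<mu>_on_interval] by auto
    then show ?case
      using linear by (simp add: form_op_linear E_add E_scaleR M_scaleR calc_in_M)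
  next
    case (uniform f g)
    have "(\<lambda>n. Re (E (calc (g n)))) \<longlonglongrightarrow> Re (E (calc f))"
      by (intro tendsto_Re E_tendsto form_op_tendsto_uniform uniform.hyps calc_in_M)
    moreover have "(\<lambda>n. LINT t|\<mu>. g n t) \<longlonglongrightarrow> (LINT t|\<mu>. f t)"
    proof -
      obtain C where C: "0 \<le> C" "\<And>x. x \<in> {a..b} \<Longrightarrow> \<bar>f x\<bar> \<le> C"
        using bounded_borel_on_bound[OF uniform.hyps(1)] by metis
      have le1: "inverse (real (Suc n)) \<le> 1" for n
        by (simp add: field_simps)
      show ?thesis
      proof (rule measure_on_interval_tendsto[OF \<mu>_on_interval])
        show "\<bar>g n x\<bar> \<le> C + 1" if "x \<in> {a..b}" for n x
          using C(2)[OF that] uniform.hyps(3)[OF that, of n] le1[of n] by linarith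
        show "(\<lambda>n. g n x) \<longlonglongrightarrow> f x" if "x \<in> {a..b}" for x
          by (rule LIM_zero_cancel, rule Lim_null_comparison[OF _ LIMSEQ_inverse_real_of_nat])
            (use uniform.hyps(3)[OF that] in auto)
      qed (use uniform.hyps in \<open>auto dest: bounded_borel_on_measurable\<close>)
    qed
    ultimately show ?case
      unfolding uniform.IH by (rule LIMSEQ_unique)
  qed
  then show ?thesis
    using E_hermitian_real[OF calc_in_M[OF assms] form_op_hermitian[OF assms]] by simp
qed

lemma E_borel_calculus:
  "bounded_borel_on a b f \<Longrightarrow> E (borel_calculus f T) = of_real (LINT t|\<mu>. f t)"
  by (simp add: borel_calculus_eq E_calc)

end

section \<open>Square roots\<close>

text \<open>Uniqueness: if \<open>R\<^sup>2 = T\<close>, then polynomials that approximate the square root turn, in the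
  functional calculus of \<open>R\<close>, into approximations of the identity function.\<close>

lemma positive_square_root_unique:
  assumes T: "positive_op T" and R: "positive_op R" "R o\<^sub>L R = T"
  shows "R = form_op (spec_measure T) sqrt"
proof -
  define b where "b = max (norm T + 1) ((norm R + 1)\<^sup>2)"
  interpret T: spectral_bounds T 0 "norm T + 1"
    by (rule spectral_bounds_positive[OF T])
  interpret R: spectral_bounds R 0 "norm R + 1"
    by (rule spectral_bounds_positive[OF R(1)])
  obtain p where p: "\<And>n x. x \<in> {0..b} \<Longrightarrow> \<bar>sqrt x - poly (p n) x\<bar> < inverse (real (Suc n))"
    using poly_approximation_sequence[of 0 b sqrt] continuous_on_real_sqrt[OF continuous_on_id] by blast
  have sqrt_bb: "bounded_borel_on 0 c sqrt" for c
    by (rule bounded_borel_onI[of _ _ _ "sqrt \<bar>c\<bar>"]) auto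
  have "(\<lambda>n. poly_op (p n) T) \<longlonglongrightarrow> form_op (spec_measure T) sqrt"
    unfolding T.calc_poly[symmetric]
    by (rule T.form_op_tendsto_uniform[OF sqrt_bb bounded_borel_on_poly])
      (use p in \<open>auto simp: b_def abs_minus_commute less_imp_le\<close>)
  moreover have "(\<lambda>n. poly_op (p n) T) \<longlonglongrightarrow> R"
  proof -
    have comp: "poly_op q T = poly_op (q \<circ>\<^sub>p [:0, 0, 1:]) R" for q
    proof (induction q)
      case (pCons c q)
      define s :: "real poly" where "s = [:0, 0, 1:]"
      have "poly_op s R = T"
        using R(2) by (simp add: s_def)
      with pCons show ?case
        by (simp add: pcompose_pCons poly_op_add poly_op_mult flip: s_def)
    qed simp
    have "R = R.calc (\<lambda>t. t)"
    proof -
      have "poly [:0, 1:] = (\<lambda>t::real. t)"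
        by (auto simp: fun_eq_iff)
      then show ?thesis
        using R.calc_poly[of "[:0, 1:]"] by simp
    qed
    moreover have "(\<lambda>n. R.calc (poly (p n \<circ>\<^sub>p [:0, 0, 1:]))) \<longlonglongrightarrow> R.calc (\<lambda>t. t)"
    proof (rule R.form_op_tendsto_uniform[OF bounded_borel_on_ident bounded_borel_on_poly])
      fix n t
      assume t: "t \<in> {0..norm R + 1}"
      then have "t\<^sup>2 \<in> {0..b}"
        by (auto simp: b_def le_max_iff_disj power_mono)
      then show "\<bar>poly (p n \<circ>\<^sub>p [:0, 0, 1:]) t - t\<bar> \<le> inverse (real (Suc n))"
        using p[of "t\<^sup>2" n] t by (simp add: poly_pcompose power2_eq_square abs_minus_commute)
    qed
    ultimately show ?thesis
      by (simp add: comp R.calc_poly)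
  qed
  ultimately show ?thesis
    using LIMSEQ_unique by blast
qed

lemma sqrt_op:
  assumes T: "positive_op T"
  shows positive_sqrt_op: "positive_op (sqrt_op T)" and sqrt_op_square: "sqrt_op T o\<^sub>L sqrt_op T = T"
proof -
  interpret T: spectral_bounds T 0 "norm T + 1"
    by (rule spectral_bounds_positive[OF T])
  let ?R = "T.calc sqrt"
  have bb: "bounded_borel_on 0 (norm T + 1) sqrt"
    by (rule bounded_borel_onI[of _ _ _ "sqrt (norm T + 1)"]) auto
  have "?R o\<^sub>L ?R = T.calc (poly [:0, 1:])"
    unfolding T.calc_mult[OF bb bb]
    by (rule T.form_op_cong[OF bounded_borel_on_mult[OF bb bb] bounded_borel_on_poly]) auto
  then have sq: "?R o\<^sub>L ?R = T"
    by (simp add: T.calc_poly)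
  have pos: "positive_op ?R"
    unfolding positive_op_iff
  proof (intro conjI allI)
    show "0 \<le> inner x (?R x)" for x
      using T.form_op_mono[OF bounded_borel_on_const bb, of 0 x] T.form_op_inner[OF bounded_borel_on_const, of x 0]
      by simp
  qed (rule T.form_op_hermitian[OF bb])
  have "sqrt_op T = ?R"
    unfolding sqrt_op_def
  proof (rule the_equality)
    show "positive_op ?R \<and> ?R o\<^sub>L ?R = T"
      using pos sq by blast
  qed (metis positive_square_root_unique[OF T])
  with sq pos show "positive_op (sqrt_op T)" "sqrt_op T o\<^sub>L sqrt_op T = T"
    by simp_all
qed

section \<open>Inverses in closed algebras of operators\<close>

text \<open>A small perturbation of an element that is invertible in the algebra is again invertible there:
  the Neumann series of \<open>1 - N\<close> is obtained as the fixed point of \<open>W \<mapsto> 1 + N W\<close>. An inverse that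
  exists among all operators must then coincide with it.\<close>

lemma inverse_in_closed_algebra:
  fixes S :: "('h::complex_hilbert \<Rightarrow>\<^sub>L 'h) set"
  assumes S: "closed S" "id_blinfun \<in> S"
      "\<And>A B. A \<in> S \<Longrightarrow> B \<in> S \<Longrightarrow> A + B \<in> S" "\<And>A B. A \<in> S \<Longrightarrow> B \<in> S \<Longrightarrow> A - B \<in> S"
      "\<And>A B. A \<in> S \<Longrightarrow> B \<in> S \<Longrightarrow> A o\<^sub>L B \<in> S"
    and Z: "Z \<in> S" "R \<in> S" "Z o\<^sub>L R = id_blinfun"
    and Z': "Z' \<in> S" "R' o\<^sub>L Z' = id_blinfun"
    and close: "norm R * norm (Z - Z') < 1"
  shows "R' \<in> S"
proof -
  define N where "N = R o\<^sub>L (Z - Z')"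
  have N: "N \<in> S"
    unfolding N_def using S Z Z' by blast
  have nN: "norm N < 1"
    using norm_blinfun_compose[of R "Z - Z'"] close by (simp add: N_def)
  have "\<exists>!W. W \<in> S \<and> id_blinfun + (N o\<^sub>L W) = W"
  proof (rule Banach_fix[of S "norm N"])
    show "dist (id_blinfun + (N o\<^sub>L V)) (id_blinfun + (N o\<^sub>L W)) \<le> norm N * dist V W" for V W
      using norm_blinfun_compose[of N "V - W"] by (simp add: dist_norm compose_diff)
  qed (use S N nN in \<open>auto simp: complete_eq_closed\<close>)
  then obtain W where W: "W \<in> S" "id_blinfun + (N o\<^sub>L W) = W"
    by blast
  have W': "(id_blinfun - N) o\<^sub>L W = id_blinfun"
    using W(2) by (simp add: compose_diff algebra_simps)
  have "Z o\<^sub>L N = Z - Z'"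
    by (simp add: N_def compose_assoc[symmetric] Z(3))
  then have Z'_eq: "Z' = Z o\<^sub>L (id_blinfun - N)"
    by (simp add: compose_diff)
  have "Z' o\<^sub>L (W o\<^sub>L R) = id_blinfun"
  proof -
    have "Z' o\<^sub>L (W o\<^sub>L R) = Z o\<^sub>L (((id_blinfun - N) o\<^sub>L W) o\<^sub>L R)"
      by (simp add: Z'_eq compose_assoc)
    then show ?thesis
      by (simp add: W' Z(3))
  qed
  then have "R' = W o\<^sub>L R"
    using Z'(2) by (metis compose_assoc compose_id)
  then show ?thesis
    using W Z S by simp
qed

section \<open>Alternating words in free algebras\<close>

lemma foldr_compose_append:
  "foldr (o\<^sub>L) (as @ bs) id_blinfun = foldr (o\<^sub>L) as id_blinfun o\<^sub>L foldr (o\<^sub>L) bs id_blinfun"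
  by (induction as) (auto simp: compose_assoc)

locale free_elements = tracial_wstar_space M E
  for M :: "('h::complex_hilbert \<Rightarrow>\<^sub>L 'h) set" and E +
  fixes X Y :: "'h \<Rightarrow>\<^sub>L 'h"
  assumes X: "X \<in> M" and Y: "Y \<in> M" and free: "free_pair E X Y"
begin

abbreviation "AX \<equiv> generated_algebra {X}"
abbreviation "AY \<equiv> generated_algebra {Y}"

lemma generated_in_M:
  assumes "T \<in> M" "S \<in> generated_algebra {T}"
  shows "S \<in> M"
  using assms(2) by induction (auto simp: assms(1) M_intros)

lemma AX_M: "S \<in> AX \<Longrightarrow> S \<in> M" and AY_M: "S \<in> AY \<Longrightarrow> S \<in> M"
  using generated_in_M X Y by auto

text \<open>The number is the position of the first letter, of which only the parity matters. Keeping it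
  as a parameter makes prefixes and suffixes of words accessible to the same predicate.\<close>

primrec centred_word :: "nat \<Rightarrow> ('h \<Rightarrow>\<^sub>L 'h) list \<Rightarrow> bool" where
  "centred_word c [] \<longleftrightarrow> True"
| "centred_word c (x # as) \<longleftrightarrow>
     x \<in> (if even c then AX else AY) \<and> E x = 0 \<and> centred_word (Suc c) as"

lemma centred_word_nth:
  "centred_word c as \<Longrightarrow> j < length as \<Longrightarrow> as ! j \<in> (if even (j + c) then AX else AY) \<and> E (as ! j) = 0"
proof (induction as arbitrary: c j)
  case (Cons x as)
  then show ?case
    using Cons.IH[of "Suc c" "j - 1"] by (cases j) auto
qed simp

lemma centred_word_append:
  "centred_word c (as @ bs) \<longleftrightarrow> centred_word c as \<and> centred_word (c + length as) bs"
  by (induction as arbitrary: c) auto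

lemma centred_word_parity: "even c = even d \<Longrightarrow> centred_word c as = centred_word d as"
proof (induction as arbitrary: c d)
  case (Cons x as)
  then show ?case
  proof -
    have "centred_word (Suc c) as = centred_word (Suc d) as"
      using Cons.prems by (intro Cons.IH) simp
    then show ?thesis
      using Cons.prems by simp
  qed
qed simp

lemma E_centred_word:
  assumes "centred_word c as" "as \<noteq> []"
  shows "E (foldr (o\<^sub>L) as id_blinfun) = 0"
proof -
  define ks where "ks = map (\<lambda>j. if even (j + c) then 0 else 1 :: nat) [0..<length as]"
  have "\<forall>j<length as. ks ! j \<in> {0, 1} \<and> as ! j \<in> generated_algebra {if ks ! j = 0 then X else Y} \<and> E (as ! j) = 0"
  proof (intro allI impI)
    fix j
    assume j: "j < length as"
    show "ks ! j \<in> {0, 1} \<and> as ! j \<in> generated_algebra {if ks ! j = 0 then X else Y} \<and> E (as ! j) = 0"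
      using centred_word_nth[OF assms(1) j] j by (cases "even j"; cases "even c") (auto simp: ks_def)
  qed
  moreover have "\<forall>j. Suc j < length as \<longrightarrow> ks ! j \<noteq> ks ! Suc j"
    by (auto simp: ks_def)
  moreover have "length ks = length as"
    by (simp add: ks_def)
  ultimately show ?thesis
    using free assms(2) unfolding free_pair_def free_operators_def free_subalgebras_def by blast
qed

lemma centred_word_in_M:
  assumes "centred_word c as"
  shows "foldr (o\<^sub>L) as id_blinfun \<in> M"
  using assms by (induction as arbitrary: c) (auto simp: M_intros AX_M AY_M split: if_splits)

text \<open>Words that begin with a letter from the algebra of \<open>X\<close> and end with one from the algebra of \<open>Y\<close>
  can be concatenated without destroying alternation. Hence their span, with the scalars added, is
  an algebra, and \<open>E\<close> is the character that forgets the words.\<close>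

definition XY_words :: "('h \<Rightarrow>\<^sub>L 'h) set" where
  "XY_words = {foldr (o\<^sub>L) as id_blinfun | as. as \<noteq> [] \<and> even (length as) \<and> centred_word 0 as}"

inductive_set XY_span :: "('h \<Rightarrow>\<^sub>L 'h) set" where
  zero: "0 \<in> XY_span"
| word: "w \<in> XY_words \<Longrightarrow> v \<in> XY_span \<Longrightarrow> w + v \<in> XY_span"

lemma XY_words_M: "w \<in> XY_words \<Longrightarrow> w \<in> M"
  by (auto simp: XY_words_def centred_word_in_M)

lemma XY_span_M: "v \<in> XY_span \<Longrightarrow> v \<in> M"
  by (induction rule: XY_span.induct) (auto simp: M_intros XY_words_M)

lemma XY_words_span: "w \<in> XY_words \<Longrightarrow> w \<in> XY_span"
  using XY_span.word[OF _ XY_span.zero] by simp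

lemma XY_span_add: "u \<in> XY_span \<Longrightarrow> v \<in> XY_span \<Longrightarrow> u + v \<in> XY_span"
  by (induction rule: XY_span.induct) (auto simp: add.assoc intro: XY_span.word)

lemma XY_words_compose: "w \<in> XY_words \<Longrightarrow> w' \<in> XY_words \<Longrightarrow> w o\<^sub>L w' \<in> XY_words"
proof -
  assume "w \<in> XY_words" "w' \<in> XY_words"
  then obtain as bs where as: "w = foldr (o\<^sub>L) as id_blinfun" "as \<noteq> []" "even (length as)" "centred_word 0 as"
    and bs: "w' = foldr (o\<^sub>L) bs id_blinfun" "bs \<noteq> []" "even (length bs)" "centred_word 0 bs"
    by (auto simp: XY_words_def)
  have "centred_word 0 (as @ bs)"
    using as bs centred_word_parity[of "length as" 0 bs] by (simp add: centred_word_append)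
  then show ?thesis
    unfolding XY_words_def using as bs
    by (intro CollectI exI[of _ "as @ bs"]) (simp add: foldr_compose_append del: foldr_append)
qed

lemma XY_words_span_compose: "v \<in> XY_span \<Longrightarrow> w \<in> XY_words \<Longrightarrow> w o\<^sub>L v \<in> XY_span"
  by (induction rule: XY_span.induct)
    (auto simp: compose_add intro: XY_span.zero XY_span.word XY_words_compose)

lemma XY_span_compose: "u \<in> XY_span \<Longrightarrow> v \<in> XY_span \<Longrightarrow> u o\<^sub>L v \<in> XY_span"
  by (induction rule: XY_span.induct)
    (auto simp: compose_add intro: XY_span.zero XY_span_add XY_words_span_compose)

lemma XY_words_scale:
  assumes "w \<in> XY_words"
  shows "scaleC_op c w \<in> XY_words"
proof -
  obtain x as where as: "w = foldr (o\<^sub>L) (x # as) id_blinfun" "even (length (x # as))" "centred_word 0 (x # as)"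
    using assms by (auto simp: XY_words_def neq_Nil_conv)
  have "x \<in> AX" "E x = 0"
    using as(3) by auto
  then have "scaleC_op c x \<in> AX" "E (scaleC_op c x) = 0"
    using AX_M by (auto simp: E_scaleC intro: generated_algebra.scale)
  then show ?thesis
    unfolding XY_words_def using as
    by (intro CollectI exI[of _ "scaleC_op c x # as"]) (auto simp: scaleC_op_compose_left)
qed

lemma scaleC_op_add: "scaleC_op c (S + T) = scaleC_op c S + scaleC_op c T"
  by (rule blinfun_eqI) (simp add: blinfun_apply_scaleC_op blinfun.bilinear_simps scaleC_add_right)

lemma scaleC_op_zero: "scaleC_op c 0 = 0"
  by (rule blinfun_eqI) (simp add: blinfun_apply_scaleC_op)

lemma XY_span_scale: "v \<in> XY_span \<Longrightarrow> scaleC_op c v \<in> XY_span"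
  by (induction rule: XY_span.induct)
    (auto simp: scaleC_op_add scaleC_op_zero intro: XY_span.zero XY_span.word XY_words_scale)

definition scalar :: "complex \<Rightarrow> ('h \<Rightarrow>\<^sub>L 'h)" where
  "scalar c = scaleC_op c id_blinfun"

lemma scalar_compose: "scalar c o\<^sub>L T = scaleC_op c T" "clinear_op T \<Longrightarrow> T o\<^sub>L scalar c = scaleC_op c T"
  by (simp_all add: scalar_def scaleC_op_compose_left scaleC_op_compose_right)

lemma scalar_M: "scalar c \<in> M"
  by (simp add: scalar_def M_intros)

lemma E_scalar: "E (scalar c) = c"
  by (simp add: scalar_def E_scaleC M_id E_id)

lemma scalar_AX: "scalar c \<in> AX" and scalar_AY: "scalar c \<in> AY"
  by (auto simp: scalar_def intro: generated_algebra.intros)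

lemma generated_diff_scalar:
  assumes "T \<in> generated_algebra G"
  shows "T - scalar c \<in> generated_algebra G"
proof -
  have "T - scalar c = T + scaleC_op (- c) id_blinfun"
    by (rule blinfun_eqI) (simp add: scalar_def blinfun_apply_scaleC_op blinfun.bilinear_simps
        scaleC_eq[of "- c"] scaleC_eq[of c])
  then show ?thesis
    by (metis assms generated_algebra.add generated_algebra.scale generated_algebra.unit)
qed

lemma E_centre: "T \<in> M \<Longrightarrow> E (T - scalar (E T)) = 0"
  by (simp add: E_diff scalar_M E_scalar)

text \<open>Expand the outer factors into their means and centred parts: every resulting product is an
  alternating word of centred letters.\<close>

lemma E_sandwich_word:
  assumes y: "y \<in> AY" and x: "x \<in> AX" and w: "w \<in> XY_words"
  shows "E (y o\<^sub>L (w o\<^sub>L x)) = 0"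
proof -
  obtain as where as: "w = foldr (o\<^sub>L) as id_blinfun" "as \<noteq> []" "even (length as)" "centred_word 0 as"
    using w by (auto simp: XY_words_def)
  define y0 where "y0 = y - scalar (E y)"
  define x0 where "x0 = x - scalar (E x)"
  have y0: "y0 \<in> AY" "E y0 = 0" and x0: "x0 \<in> AX" "E x0 = 0"
    using y x by (auto simp: y0_def x0_def generated_diff_scalar E_centre AX_M AY_M)
  have wM: "w \<in> M" and y0M: "y0 \<in> M" and x0M: "x0 \<in> M"
    using w y0 x0 AX_M AY_M XY_words_M by auto
  have cw: "centred_word 1 as \<longleftrightarrow> centred_word (Suc 0) as" "centred_word (Suc (Suc 0)) as"
    using as(4) centred_word_parity[of 2 0 as] by (auto simp: numeral_2_eq_2)
  have e1: "E (y0 o\<^sub>L (w o\<^sub>L x0)) = 0"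
  proof -
    have "centred_word 1 (y0 # (as @ [x0]))"
      using as y0 x0 cw centred_word_parity[of "Suc (Suc (length as))" 0 "[x0]"]
      by (simp add: centred_word_append)
    from E_centred_word[OF this] show ?thesis
      by (simp add: foldr_compose_append as(1) del: foldr_append)
  qed
  have e2: "E (y0 o\<^sub>L w) = 0"
  proof -
    have "centred_word 1 (y0 # as)"
      using as y0 cw by simp
    from E_centred_word[OF this] show ?thesis
      by (simp add: as(1))
  qed
  have e3: "E (w o\<^sub>L x0) = 0"
  proof -
    have "centred_word 0 (as @ [x0])"
      using as x0 centred_word_parity[of "length as" 0 "[x0]"]
      by (simp add: centred_word_append)
    from E_centred_word[OF this] show ?thesis
      by (simp add: foldr_compose_append as(1) del: foldr_append)
  qed
  have e4: "E w = 0"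
    using E_centred_word[OF as(4,2)] as(1) by simp
  have yx: "y = y0 + scalar (E y)" "x = x0 + scalar (E x)"
    by (simp_all add: y0_def x0_def)
  have "y o\<^sub>L (w o\<^sub>L x) = (y0 o\<^sub>L (w o\<^sub>L x0)) + scaleC_op (E x) (y0 o\<^sub>L w)
      + (scaleC_op (E y) (w o\<^sub>L x0) + scaleC_op (E y) (scaleC_op (E x) w))"
    using wM y0M M_clinear
    by (subst yx(1), subst yx(2)) (simp add: compose_add scalar_compose scaleC_op_compose_right scaleC_op_add add.assoc add.left_commute)
  then show ?thesis
    using wM y0M x0M by (simp add: E_add E_scaleC M_intros e1 e2 e3 e4)
qed

lemma E_sandwich_span:
  assumes "v \<in> XY_span" "y \<in> AY" "x \<in> AX"
  shows "E (y o\<^sub>L (v o\<^sub>L x)) = 0"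
  using assms(1)
proof induction
  case (word w v)
  then show ?case
    using assms E_sandwich_word AX_M AY_M XY_words_M XY_span_M
    by (simp add: compose_add E_add M_intros)
qed (simp add: E_zero)

lemma E_YX: 
  assumes y: "y \<in> AY" and x: "x \<in> AX"
  shows "E (y o\<^sub>L x) = E y * E x"
proof -
  define y0 where "y0 = y - scalar (E y)"
  define x0 where "x0 = x - scalar (E x)"
  have y0: "y0 \<in> AY" "E y0 = 0" and x0: "x0 \<in> AX" "E x0 = 0"
    using y x by (auto simp: y0_def x0_def generated_diff_scalar E_centre AX_M AY_M)
  have y0M: "y0 \<in> M" and x0M: "x0 \<in> M"
    using y0 x0 AX_M AY_M by auto
  have "centred_word 1 [y0, x0]"
    using y0 x0 by simp
  from E_centred_word[OF this] have e: "E (y0 o\<^sub>L x0) = 0"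
    by simp
  have yx: "y = y0 + scalar (E y)" "x = x0 + scalar (E x)"
    by (simp_all add: y0_def x0_def)
  have "y o\<^sub>L x = (y0 o\<^sub>L x0) + scaleC_op (E x) y0 + (scaleC_op (E y) x0 + scaleC_op (E y) (scalar (E x)))"
    using y0M M_clinear
    by (subst yx(1), subst yx(2)) (simp add: compose_add scalar_compose add.assoc add.left_commute)
  then show ?thesis
    using y0M x0M y0 x0 by (simp add: E_add E_scaleC M_intros scalar_M E_scalar e)
qed

subsection \<open>The closed algebra of words from the first to the second factor\<close>

definition XY0 :: "('h \<Rightarrow>\<^sub>L 'h) set" where
  "XY0 = {scalar c + v | c v. v \<in> XY_span}"

definition XY_algebra :: "('h \<Rightarrow>\<^sub>L 'h) set" where
  "XY_algebra = closure XY0"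

lemma XY0_M: "s \<in> XY0 \<Longrightarrow> s \<in> M"
  by (auto simp: XY0_def scalar_M XY_span_M M_intros)

lemma scalar_add: "scalar c + scalar d = scalar (c + d)"
  by (rule blinfun_eqI) (simp add: scalar_def blinfun.bilinear_simps blinfun_apply_scaleC_op scaleC_add_left)

lemma scalar_scale: "scaleC_op c (scalar d) = scalar (c * d)"
  by (rule blinfun_eqI) (simp add: scalar_def blinfun_apply_scaleC_op scaleC_scaleC)

lemma scalar_real: "scalar (of_real r) = r *\<^sub>R id_blinfun"
  by (simp add: scalar_def scaleC_op_of_real)

lemma XY0_add:
  assumes "s \<in> XY0" "s' \<in> XY0"
  shows "s + s' \<in> XY0"
proof -
  obtain c v d u where "s = scalar c + v" "s' = scalar d + u" "v \<in> XY_span" "u \<in> XY_span"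
    using assms by (auto simp: XY0_def)
  then have "s + s' = scalar (c + d) + (v + u)" "v + u \<in> XY_span"
    by (auto simp: scalar_add[symmetric] XY_span_add)
  then show ?thesis
    by (auto simp: XY0_def)
qed

lemma XY0_scale:
  assumes "s \<in> XY0"
  shows "scaleC_op c s \<in> XY0"
  using assms by (auto simp: XY0_def scaleC_op_add scalar_scale) (use XY_span_scale in blast)

lemma XY0_diff:
  assumes "s \<in> XY0" "s' \<in> XY0"
  shows "s - s' \<in> XY0"
  using XY0_add[OF assms(1) XY0_scale[OF assms(2), of "-1"]] scaleC_op_of_real[of "-1" s'] by simp

lemma XY0_compose:
  assumes "s \<in> XY0" "s' \<in> XY0"
  shows "s o\<^sub>L s' \<in> XY0" and E_XY0_compose: "E (s o\<^sub>L s') = E s * E s'"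
proof -
  obtain c v d u where s: "s = scalar c + v" "s' = scalar d + u" "v \<in> XY_span" "u \<in> XY_span"
    using assms by (auto simp: XY0_def)
  have E0: "E w = 0" if "w \<in> XY_span" for w
    using E_sandwich_span[OF that generated_algebra.unit generated_algebra.unit] by simp
  let ?w = "scaleC_op c u + (scaleC_op d v + (v o\<^sub>L u))"
  have eq: "s o\<^sub>L s' = scalar (c * d) + ?w"
    using s XY_span_M M_clinear
    by (simp add: compose_add scalar_compose scalar_scale add.assoc)
  have w: "?w \<in> XY_span"
    using s by (simp add: XY_span_add XY_span_scale XY_span_compose)
  show "s o\<^sub>L s' \<in> XY0"
    using eq w by (auto simp: XY0_def)
  show "E (s o\<^sub>L s') = E s * E s'"
    unfolding eq using s E0 w by (simp add: E_add scalar_M XY_span_M E_scalar)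
qed

lemma E_sandwich_XY0:
  assumes "s \<in> XY0" "y \<in> AY" "x \<in> AX"
  shows "E (y o\<^sub>L (s o\<^sub>L x)) = E y * E s * E x"
proof -
  obtain c v where s: "s = scalar c + v" "v \<in> XY_span"
    using assms by (auto simp: XY0_def)
  have "E v = 0"
    using E_sandwich_span[OF s(2) generated_algebra.unit generated_algebra.unit] by simp
  then have "E s = c"
    using s by (simp add: E_add scalar_M XY_span_M E_scalar)
  moreover have "y o\<^sub>L (s o\<^sub>L x) = scaleC_op c (y o\<^sub>L x) + (y o\<^sub>L (v o\<^sub>L x))"
    using s assms AY_M M_clinear by (simp add: compose_add scalar_compose scaleC_op_compose_right)
  ultimately show ?thesis
    using s assms AX_M AY_M XY_span_M
    by (simp add: E_add E_scaleC M_intros E_YX E_sandwich_span)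
qed

lemma XY_algebra_seq:
  assumes "s \<in> XY_algebra"
  obtains S where "\<And>n. S n \<in> XY0" "S \<longlonglongrightarrow> s"
  using assms unfolding XY_algebra_def closure_sequential by blast

lemma XY_algebra_seqI: "(\<And>n. S n \<in> XY0) \<Longrightarrow> S \<longlonglongrightarrow> s \<Longrightarrow> s \<in> XY_algebra"
  unfolding XY_algebra_def closure_sequential by blast

lemma XY_algebra_closed: "closed XY_algebra"
  by (simp add: XY_algebra_def)

lemma XY_algebra_id: "id_blinfun \<in> XY_algebra"
proof -
  have "id_blinfun = scalar 1 + 0"
    by (rule blinfun_eqI) (simp add: scalar_def blinfun_apply_scaleC_op)
  then have "id_blinfun \<in> XY0"
    unfolding XY0_def using XY_span.zero by blast
  then show ?thesis
    using closure_subset by (auto simp: XY_algebra_def)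
qed

lemma XY_algebra_add: "s \<in> XY_algebra \<Longrightarrow> s' \<in> XY_algebra \<Longrightarrow> s + s' \<in> XY_algebra"
  by (elim XY_algebra_seq, rule XY_algebra_seqI[rotated], rule tendsto_add, assumption, assumption)
    (rule XY0_add)

lemma XY_algebra_diff: "s \<in> XY_algebra \<Longrightarrow> s' \<in> XY_algebra \<Longrightarrow> s - s' \<in> XY_algebra"
  by (elim XY_algebra_seq, rule XY_algebra_seqI[rotated], rule tendsto_diff, assumption, assumption)
    (rule XY0_diff)

lemma XY_algebra_compose: "s \<in> XY_algebra \<Longrightarrow> s' \<in> XY_algebra \<Longrightarrow> s o\<^sub>L s' \<in> XY_algebra"
  by (elim XY_algebra_seq, rule XY_algebra_seqI[rotated], rule tendsto_compose_op, assumption, assumption)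
    (rule XY0_compose)

lemma XY_algebra_E_compose:
  assumes "s \<in> XY_algebra" "s' \<in> XY_algebra"
  shows "E (s o\<^sub>L s') = E s * E s'"
proof -
  obtain S S' where S: "\<And>n. S n \<in> XY0" "S \<longlonglongrightarrow> s" and S': "\<And>n. S' n \<in> XY0" "S' \<longlonglongrightarrow> s'"
    using assms by (metis XY_algebra_seq)
  have "(\<lambda>n. E (S n o\<^sub>L S' n)) \<longlonglongrightarrow> E (s o\<^sub>L s')"
    by (intro E_tendsto tendsto_compose_op S S' M_compose XY0_M)
  moreover have "(\<lambda>n. E (S n o\<^sub>L S' n)) \<longlonglongrightarrow> E s * E s'"
    unfolding E_XY0_compose[OF S(1) S'(1)] by (intro tendsto_mult E_tendsto S S' XY0_M)
  ultimately show ?thesis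
    by (rule LIMSEQ_unique)
qed

lemma E_sandwich:
  assumes s: "s \<in> XY_algebra" and y: "\<And>n. y n \<in> AY" "y \<longlonglongrightarrow> b" and x: "x \<in> AX"
  shows "E (b o\<^sub>L (s o\<^sub>L x)) = E b * E s * E x"
proof -
  obtain S where S: "\<And>n. S n \<in> XY0" "S \<longlonglongrightarrow> s"
    using s by (metis XY_algebra_seq)
  have "(\<lambda>n. E (y n o\<^sub>L (S n o\<^sub>L x))) \<longlonglongrightarrow> E (b o\<^sub>L (s o\<^sub>L x))"
    by (intro E_tendsto tendsto_compose_op S y M_compose XY0_M AX_M AY_M x tendsto_const)
  moreover have "(\<lambda>n. E (y n o\<^sub>L (S n o\<^sub>L x))) \<longlonglongrightarrow> E b * E s * E x"
    unfolding E_sandwich_XY0[OF S(1) y(1) x]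
    by (intro tendsto_mult E_tendsto tendsto_const S y XY0_M AY_M)
  ultimately show ?thesis
    by (rule LIMSEQ_unique)
qed

text \<open>The norm closure makes room for functions of \<open>Y\<close> that are not polynomials. Words with such a
  last letter are limits of words with polynomial letters.\<close>

lemma centred_product_in_XY_algebra:
  assumes x: "x \<in> AX" "E x = 0" and y: "\<And>n. y n \<in> AY" "y \<longlonglongrightarrow> b"
  shows "x o\<^sub>L (b - scalar (E b)) \<in> XY_algebra"
proof (rule XY_algebra_seqI)
  have E: "(\<lambda>n. E (y n)) \<longlonglongrightarrow> E b"
    by (rule E_tendsto[OF AY_M[OF y(1)] y(2)])
  have bl: "scalar c = Re c *\<^sub>R id_blinfun + Im c *\<^sub>R scalar \<i>" for c
    by (rule blinfun_eqI) (simp add: scalar_def blinfun_apply_scaleC_op blinfun.bilinear_simps scaleC_eq[of c])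
  have "(\<lambda>n. Re (E (y n)) *\<^sub>R id_blinfun + Im (E (y n)) *\<^sub>R scalar \<i>)
      \<longlonglongrightarrow> Re (E b) *\<^sub>R id_blinfun + Im (E b) *\<^sub>R scalar \<i>"
    by (intro tendsto_intros E)
  then have "(\<lambda>n. scalar (E (y n))) \<longlonglongrightarrow> scalar (E b)"
    by (simp only: bl[symmetric])
  then show "(\<lambda>n. x o\<^sub>L (y n - scalar (E (y n)))) \<longlonglongrightarrow> (x o\<^sub>L (b - scalar (E b)))"
    by (intro tendsto_compose_op tendsto_const tendsto_diff y)
  show "x o\<^sub>L (y n - scalar (E (y n))) \<in> XY0" for n
  proof -
    have "centred_word 0 [x, y n - scalar (E (y n))]"
      using x y by (simp add: generated_diff_scalar E_centre AY_M)
    then have "x o\<^sub>L (y n - scalar (E (y n))) \<in> XY_words"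
      unfolding XY_words_def by (intro CollectI exI[of _ "[x, y n - scalar (E (y n))]"]) simp
    moreover have "scalar 0 = 0"
      using scalar_real[of 0] by simp
    ultimately show ?thesis
      unfolding XY0_def by (intro CollectI exI[of _ "0 :: complex"]) (auto intro: XY_words_span)
  qed
qed

end

lemma poly_op_generated: "poly_op p T \<in> generated_algebra {T}"
proof (induction p)
  case 0
  have "scaleC_op 0 id_blinfun \<in> generated_algebra {T}"
    by (intro generated_algebra.intros)
  then show ?case
    by (metis scaleC_op_of_real of_real_0 scaleR_zero_left poly_op_0)
next
  case (pCons c p)
  have "scaleC_op (of_real c) id_blinfun \<in> generated_algebra {T}"
    by (intro generated_algebra.intros)
  then show ?case
    using pCons by (auto simp: scaleC_op_of_real intro: generated_algebra.intros)
qed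

lemma (in spectral_bounds) calc_approximable:
  assumes "continuous_on {a..b} f" "f \<in> borel_measurable borel"
  obtains y where "\<And>n. y n \<in> generated_algebra {T}" "y \<longlonglongrightarrow> calc f"
proof -
  obtain p where p: "\<And>n x. x \<in> {a..b} \<Longrightarrow> \<bar>f x - poly (p n) x\<bar> < inverse (real (Suc n))"
    using poly_approximation_sequence[OF assms(1)] by blast
  have "compact (f ` {a..b})"
    by (intro compact_continuous_image assms) auto
  then obtain B where "\<forall>y\<in>f ` {a..b}. norm y \<le> B"
    using compact_imp_bounded bounded_iff by metis
  then have f: "bounded_borel_on a b f"
    by (intro bounded_borel_onI[of _ _ _ B] assms) auto
  have "(\<lambda>n. poly_op (p n) T) \<longlonglongrightarrow> calc f"
    unfolding calc_poly[symmetric]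
    by (rule form_op_tendsto_uniform[OF f bounded_borel_on_poly])
      (use p in \<open>auto simp: abs_minus_commute less_imp_le\<close>)
  then show thesis
    by (rule that[OF poly_op_generated])
qed

section \<open>Resolvents of positive elements\<close>

text \<open>Everything the determinant formula needs about a positive element is read off from its
  distribution \<open>\<mu>\<close>: the resolvents \<open>(1 + r T)\<^sup>-\<^sup>1\<close>, the function \<open>w r = - \<psi>(- r) = 1 - E ((1 + r T)\<^sup>-\<^sup>1)\<close>
  and the regularized logarithmic determinant \<open>F r = E (ln (1 + r T))\<close>, with \<open>F' = w / r\<close>.\<close>

locale positive_element = bounded_element M E T 0 b
  for M :: "('h::complex_hilbert \<Rightarrow>\<^sub>L 'h) set" and E and T :: "'h \<Rightarrow>\<^sub>L 'h" and b
begin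

lemma b_pos: "0 < b"
  using ab .

definition res :: "real \<Rightarrow> real \<Rightarrow> real" where "res r x = 1 / (1 + r * x)"

definition resolvent :: "real \<Rightarrow> ('h \<Rightarrow>\<^sub>L 'h)" where "resolvent r = calc (res r)"

definition w :: "real \<Rightarrow> real" where "w r = (LINT x|\<mu>. r * x / (1 + r * x))"

lemma res_meas [measurable]: "res r \<in> borel_measurable borel"
  unfolding res_def[abs_def] by measurable

lemma den_ge1: "0 \<le> r \<Longrightarrow> x \<in> {0..b} \<Longrightarrow> 1 \<le> 1 + r * x"
  by simp

lemma res_bounds:
  assumes "0 \<le> r" "x \<in> {0..b}"
  shows "0 \<le> res r x" "res r x \<le> 1"
  using den_ge1[OF assms] by (auto simp: res_def)

lemma res_bb: "0 \<le> r \<Longrightarrow> bounded_borel_on 0 b (res r)"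
  by (rule bounded_borel_onI[of _ _ _ 1]) (use res_bounds in auto)

lemma resolvent_inverse:
  assumes r: "0 \<le> r"
  shows "resolvent r o\<^sub>L (id_blinfun + r *\<^sub>R T) = id_blinfun"
    and "(id_blinfun + r *\<^sub>R T) o\<^sub>L resolvent r = id_blinfun"
proof -
  have p: "id_blinfun + r *\<^sub>R T = calc (poly [:1, r:])"
    by (simp add: calc_poly compose_scaleR)
  have one: "calc g = id_blinfun" if "bounded_borel_on 0 b g" "\<And>t. t \<in> {0..b} \<Longrightarrow> g t = 1" for g
    using form_op_cong[OF that(1) bounded_borel_on_const, of 1] that(2) by (simp add: form_op_one)
  have nz: "1 + t * r \<noteq> 0" if "t \<in> {0..b}" for t
    using den_ge1[OF r that] by (simp add: mult.commute)
  show "resolvent r o\<^sub>L (id_blinfun + r *\<^sub>R T) = id_blinfun"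
    unfolding p resolvent_def calc_mult[OF res_bb[OF r] bounded_borel_on_poly]
    by (rule one[OF bounded_borel_on_mult[OF res_bb[OF r] bounded_borel_on_poly]])
      (use nz in \<open>simp add: res_def mult.commute\<close>)
  show "(id_blinfun + r *\<^sub>R T) o\<^sub>L resolvent r = id_blinfun"
    unfolding p resolvent_def calc_mult[OF bounded_borel_on_poly res_bb[OF r]]
    by (rule one[OF bounded_borel_on_mult[OF bounded_borel_on_poly res_bb[OF r]]])
      (use nz in \<open>simp add: res_def mult.commute\<close>)
qed

lemma norm_resolvent_le: "0 \<le> r \<Longrightarrow> norm (resolvent r) \<le> 1"
  unfolding resolvent_def by (rule form_op_norm_le[OF res_bb]) (use res_bounds in auto)

lemma norm_resolvent_diff_le:
  assumes "0 \<le> r" "0 \<le> s"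
  shows "norm (resolvent r - resolvent s) \<le> b * \<bar>r - s\<bar>"
proof -
  have "norm (calc (\<lambda>x. res r x - res s x)) \<le> b * \<bar>r - s\<bar>"
  proof (rule form_op_norm_le)
    show "bounded_borel_on 0 b (\<lambda>x. res r x - res s x)"
      using bounded_borel_on_linear[OF res_bb[OF assms(1)] res_bb[OF assms(2)], of 1 "-1"] by simp
    show "\<bar>res r x - res s x\<bar> \<le> b * \<bar>r - s\<bar>" if x: "x \<in> {0..b}" for x
    proof -
      have n: "1 + r * x \<noteq> 0" "1 + s * x \<noteq> 0"
        using den_ge1[OF assms(1) x] den_ge1[OF assms(2) x] by auto
      have "res r x - res s x = (x * (s - r)) * (res r x * res s x)"
        using n by (simp add: res_def field_simps)
      then have "\<bar>res r x - res s x\<bar> = (x * \<bar>r - s\<bar>) * (res r x * res s x)"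
        using x res_bounds[OF assms(1) x] res_bounds[OF assms(2) x] by (simp add: abs_mult abs_minus_commute)
      also have "\<dots> \<le> (b * \<bar>r - s\<bar>) * (1 * 1)"
        using x res_bounds[OF assms(1) x] res_bounds[OF assms(2) x] b_pos
        by (intro mult_mono) auto
      finally show ?thesis
        by simp
    qed
  qed (use b_pos in simp)
  then show ?thesis
    by (simp add: resolvent_def form_op_diff res_bb assms)
qed

lemma measure_space_\<mu> [simp]: "measure \<mu> (space \<mu>) = 1"
  using \<mu>_total by (simp add: space_\<mu>)

lemma integrable_\<mu>: "f \<in> borel_measurable borel \<Longrightarrow> (\<And>x. x \<in> {0..b} \<Longrightarrow> \<bar>f x\<bar> \<le> C) \<Longrightarrow> integrable \<mu> (f :: real \<Rightarrow> real)"
  by (rule measure_on_interval_integrable[OF \<mu>_on_interval])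

lemma integral_cong_\<mu>:
  fixes f g :: "real \<Rightarrow> real"
  assumes "f \<in> borel_measurable borel" "g \<in> borel_measurable borel" "\<And>x. x \<in> {0..b} \<Longrightarrow> f x = g x"
  shows "(LINT x|\<mu>. f x) = (LINT x|\<mu>. g x)"
proof (rule integral_cong_AE)
  show "AE x in \<mu>. f x = g x"
    using measure_on_interval_AE[OF \<mu>_on_interval] by eventually_elim (rule assms(3))
qed (use assms measure_on_interval_measurable[OF \<mu>_on_interval] in auto)

lemma integral_mono_\<mu>:
  fixes f g :: "real \<Rightarrow> real"
  assumes "integrable \<mu> f" "integrable \<mu> g" "\<And>x. x \<in> {0..b} \<Longrightarrow> f x \<le> g x"
  shows "(LINT x|\<mu>. f x) \<le> (LINT x|\<mu>. g x)"
proof (rule integral_mono_AE)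
  show "AE x in \<mu>. f x \<le> g x"
    using measure_on_interval_AE[OF \<mu>_on_interval] by eventually_elim (rule assms(3))
qed (use assms in auto)

lemma w_integrand:
  assumes "0 \<le> r" "x \<in> {0..b}"
  shows "r * x / (1 + r * x) = 1 - res r x"
  using den_ge1[OF assms] by (simp add: res_def field_simps)

lemma w_integrable: "0 \<le> r \<Longrightarrow> integrable \<mu> (\<lambda>x. r * x / (1 + r * x))"
  by (rule integrable_\<mu>[of _ 1]) (use res_bounds in \<open>auto simp: w_integrand\<close>)

lemma E_resolvent:
  assumes "0 \<le> r"
  shows "E (resolvent r) = of_real (1 - w r)"
proof -
  have "w r = (LINT x|\<mu>. 1 - res r x)"
    unfolding w_def using assms by (intro integral_cong_\<mu>) (auto simp: w_integrand)
  also have "\<dots> = 1 - (LINT x|\<mu>. res r x)"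
    using measure_on_interval_integrable'[OF \<mu>_on_interval res_bb[OF assms]]
      measure_on_interval_integrable'[OF \<mu>_on_interval bounded_borel_on_const[of 0 b 1]]
    by simp
  finally show ?thesis
    by (simp add: resolvent_def E_calc res_bb assms)
qed

lemma resolvent_in_M: "0 \<le> r \<Longrightarrow> resolvent r \<in> M"
  by (simp add: resolvent_def calc_in_M res_bb)

lemma w_zero: "w 0 = 0"
  by (simp add: w_def)

lemma w_mono:
  assumes "0 \<le> r" "r \<le> s"
  shows "w r \<le> w s"
  unfolding w_def
proof (rule integral_mono_\<mu>)
  show "r * x / (1 + r * x) \<le> s * x / (1 + s * x)" if x: "x \<in> {0..b}" for x
  proof -
    have "1 + r * x \<le> 1 + s * x"
      using assms x by (auto intro: mult_right_mono)
    then have "res s x \<le> res r x"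
      unfolding res_def using den_ge1[OF assms(1) x] by (intro divide_left_mono) auto
    then show ?thesis
      using assms x by (simp only: w_integrand[OF _ x])
  qed
qed (use assms w_integrable in auto)

lemma w_nonneg: "0 \<le> r \<Longrightarrow> 0 \<le> w r"
  using w_mono[of 0 r] by (simp add: w_zero)

lemma psi_transform_eq: "psi_transform E T (- r) = - w r"
proof -
  have "psi_transform E T (- r) = (LINT x|\<mu>. - (r * x / (1 + r * x)))"
    by (simp add: psi_transform_def \<mu>_def)
  then show ?thesis
    by (simp add: w_def)
qed

subsection \<open>Derivatives of integral transforms\<close>

lemma DERIV_quadratic_bound:
  fixes f :: "real \<Rightarrow> real"
  assumes "\<And>y. y \<in> S \<Longrightarrow> \<bar>f y - f x - d * (y - x)\<bar> \<le> C * (y - x)\<^sup>2"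
  shows "(f has_real_derivative d) (at x within S)"
  unfolding has_field_derivative_iff
proof (rule LIM_zero_cancel, rule Lim_null_comparison)
  show "\<forall>\<^sub>F y in at x within S. norm ((f y - f x) / (y - x) - d) \<le> C * \<bar>y - x\<bar>"
    unfolding eventually_at_topological
  proof (intro exI[of _ UNIV] conjI ballI impI)
    fix y
    assume y: "y \<noteq> x" "y \<in> S"
    have "(f y - f x) / (y - x) - d = (f y - f x - d * (y - x)) / (y - x)"
      using y by (simp add: field_simps)
    then have "norm ((f y - f x) / (y - x) - d) \<le> C * (y - x)\<^sup>2 / \<bar>y - x\<bar>"
      using assms[OF y(2)] by (simp add: abs_divide divide_right_mono)
    also have "(y - x)\<^sup>2 = \<bar>y - x\<bar>\<^sup>2"
      by simp
    also have "C * \<bar>y - x\<bar>\<^sup>2 / \<bar>y - x\<bar> = C * \<bar>y - x\<bar>"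
      by (simp only: power2_eq_square mult.assoc[symmetric]) (use y in simp)
    finally show "norm ((f y - f x) / (y - x) - d) \<le> C * \<bar>y - x\<bar>" .
  qed auto
  show "((\<lambda>y. C * \<bar>y - x\<bar>) \<longlongrightarrow> 0) (at x within S)"
    by (rule tendsto_eq_intros refl | simp)+
qed

text \<open>A pointwise error that is quadratic uniformly in the integration variable survives integration;
  this is all that differentiation under the integral sign requires here.\<close>

lemma DERIV_integral_quadratic_bound:
  fixes f :: "real \<Rightarrow> real \<Rightarrow> real"
  assumes f: "\<And>r. 0 \<le> r \<Longrightarrow> integrable \<mu> (f r)" and d: "integrable \<mu> d" and r: "0 \<le> r"
    and bd: "\<And>s x. 0 \<le> s \<Longrightarrow> x \<in> {0..b} \<Longrightarrow> \<bar>f s x - f r x - d x * (s - r)\<bar> \<le> C * (s - r)\<^sup>2"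
  shows "((\<lambda>r. LINT x|\<mu>. f r x) has_real_derivative (LINT x|\<mu>. d x)) (at r within {0..})"
proof (rule DERIV_quadratic_bound)
  fix s :: real
  assume s: "s \<in> {0..}"
  have i: "integrable \<mu> (\<lambda>x. f s x - f r x - d x * (s - r))"
    using f[of s] f[OF r] d s by simp
  have "(LINT x|\<mu>. f s x) - (LINT x|\<mu>. f r x) - (LINT x|\<mu>. d x) * (s - r)
      = (LINT x|\<mu>. f s x - f r x - d x * (s - r))"
    using f[of s] f[OF r] d s by simp
  also have "\<bar>\<dots>\<bar> \<le> (LINT x|\<mu>. \<bar>f s x - f r x - d x * (s - r)\<bar>)"
    by (rule integral_abs_bound)
  also have "\<dots> \<le> (LINT x|\<mu>. C * (s - r)\<^sup>2)"
    using measure_on_interval_integrable'[OF \<mu>_on_interval bounded_borel_on_const] i bd s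
    by (intro integral_mono_\<mu>) auto
  finally show "\<bar>(LINT x|\<mu>. f s x) - (LINT x|\<mu>. f r x) - (LINT x|\<mu>. d x) * (s - r)\<bar> \<le> C * (s - r)\<^sup>2"
    by simp
qed

definition w' :: "real \<Rightarrow> real" where "w' r = (LINT x|\<mu>. x * (res r x)\<^sup>2)"

lemma w'_integrable: "0 \<le> r \<Longrightarrow> integrable \<mu> (\<lambda>x. x * (res r x)\<^sup>2)"
proof (rule integrable_\<mu>[of _ b])
  fix x
  assume "0 \<le> r" "x \<in> {0..b}"
  then show "\<bar>x * (res r x)\<^sup>2\<bar> \<le> b"
    using res_bounds[of r x] mult_mono[of x b "(res r x)\<^sup>2" 1] by (simp add: abs_mult power_le_one)
qed simp

lemma w_deriv:
  assumes r: "0 \<le> r"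
  shows "(w has_real_derivative w' r) (at r within {0..})"
  unfolding w_def[abs_def] w'_def
proof (rule DERIV_integral_quadratic_bound[OF w_integrable w'_integrable[OF r] r])
  fix s x :: real
  assume s: "0 \<le> s" and x: "x \<in> {0..b}"
  have n: "1 + r * x \<noteq> 0" "1 + s * x \<noteq> 0"
    using den_ge1[OF r x] den_ge1[OF s x] by auto
  have "s * x / (1 + s * x) - r * x / (1 + r * x) - x * (res r x)\<^sup>2 * (s - r)
      = - (x\<^sup>2 * ((res r x)\<^sup>2 * res s x)) * (s - r)\<^sup>2"
    using n by (simp add: res_def divide_simps) (simp add: algebra_simps power2_eq_square)
  moreover have "x\<^sup>2 * ((res r x)\<^sup>2 * res s x) \<le> b\<^sup>2 * (1 * 1)"
    using x res_bounds[OF r x] res_bounds[OF s x]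
    by (intro mult_mono power_mono power_le_one) auto
  moreover have "0 \<le> x\<^sup>2 * ((res r x)\<^sup>2 * res s x)"
    using res_bounds[OF s x] by simp
  ultimately show "\<bar>s * x / (1 + s * x) - r * x / (1 + r * x) - x * (res r x)\<^sup>2 * (s - r)\<bar> \<le> b\<^sup>2 * (s - r)\<^sup>2"
    by (simp add: abs_mult mult_right_mono)
qed

definition F :: "real \<Rightarrow> real" where "F r = (LINT x|\<mu>. ln (1 + r * x))"

lemma F_integrable:
  assumes r: "0 \<le> r"
  shows "integrable \<mu> (\<lambda>x. ln (1 + r * x))"
proof (rule integrable_\<mu>[of _ "r * b"])
  fix x
  assume x: "x \<in> {0..b}"
  have "ln (1 + r * x) \<le> r * x"
    using r x by (intro ln_add_one_self_le_self) auto
  also have "\<dots> \<le> r * b"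
    using r x by (intro mult_left_mono) auto
  finally show "\<bar>ln (1 + r * x)\<bar> \<le> r * b"
    using den_ge1[OF r x] by simp
qed measurable

lemma F_zero: "F 0 = 0"
  by (simp add: F_def)

text \<open>With \<open>1 + h\<close> the quotient of the two arguments of the logarithm,
  \<open>h / (1 + h) \<le> ln (1 + h) \<le> h\<close>, and the outer terms differ by \<open>h\<^sup>2 / (1 + h)\<close>.\<close>

lemma F_deriv:
  assumes r: "0 \<le> r"
  shows "(F has_real_derivative (LINT x|\<mu>. x * res r x)) (at r within {0..})"
  unfolding F_def[abs_def]
proof (rule DERIV_integral_quadratic_bound[OF F_integrable _ r])
  show "integrable \<mu> (\<lambda>x. x * res r x)"
  proof (rule integrable_\<mu>[of _ b])
    fix x
    assume "x \<in> {0..b}"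
    then show "\<bar>x * res r x\<bar> \<le> b"
      using res_bounds[OF r, of x] mult_mono[of x b "res r x" 1] by (simp add: abs_mult)
  qed simp
  fix s x :: real
  assume s: "0 \<le> s" and x: "x \<in> {0..b}"
  have p: "0 < 1 + r * x" "0 < 1 + s * x"
    using den_ge1[OF r x] den_ge1[OF s x] by auto
  define h where "h = x * res r x * (s - r)"
  have h1: "1 + h = (1 + s * x) / (1 + r * x)"
    using p by (simp add: h_def res_def field_simps)
  then have h0: "0 < 1 + h"
    using p by simp
  have eq: "ln (1 + s * x) - ln (1 + r * x) = ln (1 + h)"
    using p by (simp add: h1 ln_div)
  have up: "ln (1 + h) \<le> h"
    using ln_le_minus_one[OF h0] by simp
  have "ln (inverse (1 + h)) \<le> inverse (1 + h) - 1"
    using h0 by (intro ln_le_minus_one) simp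
  then have lo: "1 - inverse (1 + h) \<le> ln (1 + h)"
    using h0 by (simp add: ln_inverse)
  have "h - (1 - inverse (1 + h)) = h\<^sup>2 / (1 + h)"
    using h0 by (simp add: field_simps power2_eq_square)
  also have "\<dots> = (x * res r x * (s - r))\<^sup>2 / ((1 + s * x) / (1 + r * x))"
    by (simp only: h1) (simp only: h_def)
  also have "\<dots> = x\<^sup>2 * (res r x * res s x) * (s - r)\<^sup>2"
    using p by (simp add: res_def divide_simps power2_eq_square)
  also have "\<dots> \<le> b\<^sup>2 * (1 * 1) * (s - r)\<^sup>2"
    using x res_bounds[OF r x] res_bounds[OF s x]
    by (intro mult_right_mono mult_mono power_mono) auto
  finally have "h - ln (1 + h) \<le> b\<^sup>2 * (s - r)\<^sup>2"
    using lo by simp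
  then show "\<bar>ln (1 + s * x) - ln (1 + r * x) - x * res r x * (s - r)\<bar> \<le> b\<^sup>2 * (s - r)\<^sup>2"
    using up unfolding eq h_def[symmetric] by simp
qed

lemma F_deriv_eq: "r \<noteq> 0 \<Longrightarrow> (LINT x|\<mu>. x * res r x) = w r / r"
  by (simp add: w_def res_def flip: integral_divide_zero)

lemma at_within_nonneg: "0 < r \<Longrightarrow> at r within {0..} = at (r::real)"
  by (rule at_within_interior) simp

lemma w_DERIV: "0 < r \<Longrightarrow> (w has_real_derivative w' r) (at r)"
  using w_deriv[of r] by (simp add: at_within_nonneg)

lemma F_DERIV: "0 < r \<Longrightarrow> (F has_real_derivative (w r / r)) (at r)"
  using F_deriv[of r] by (simp add: at_within_nonneg F_deriv_eq)

lemma w_continuous: "continuous_on {0..} w"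
  by (rule DERIV_continuous_on[of _ _ w']) (simp add: w_deriv)

lemma F_continuous: "continuous_on {0..} F"
  by (rule DERIV_continuous_on[of _ _ "\<lambda>r. LINT x|\<mu>. x * res r x"]) (simp add: F_deriv)

text \<open>The mass outside the kernel is the limit of \<open>w\<close> at infinity.\<close>

definition u :: real where "u = 1 - measure \<mu> {0}"

lemma u_le_1: "u \<le> 1"
  by (simp add: u_def)

lemma measure_nonzero: "measure \<mu> (- {0}) = u"
proof -
  interpret finite_measure \<mu> by (rule finite_\<mu>)
  have "measure \<mu> (UNIV - {0}) = measure \<mu> UNIV - measure \<mu> {0}"
    using finite_measure_compl[of "{0}"] by (simp add: sets_\<mu> space_\<mu>)
  then show ?thesis
    by (simp add: u_def \<mu>_total Compl_eq_Diff_UNIV)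
qed

lemma integral_nonzero: "(LINT x|\<mu>. indicator (- {0}) x) = u"
  by (simp add: space_\<mu> measure_nonzero)

lemma w_tendsto_u:
  assumes r: "\<And>n. 0 \<le> r n" "filterlim r at_top sequentially"
  shows "(\<lambda>n. w (r n)) \<longlonglongrightarrow> u"
  unfolding w_def integral_nonzero[symmetric]
proof (rule measure_on_interval_tendsto[OF \<mu>_on_interval])
  show "\<bar>r n * x / (1 + r n * x)\<bar> \<le> 1" if "x \<in> {0..b}" for n x
    using res_bounds[OF r(1) that, of n] by (simp add: w_integrand[OF r(1) that])
  show "(\<lambda>n. r n * x / (1 + r n * x)) \<longlonglongrightarrow> indicator (- {0}) x" if x: "x \<in> {0..b}" for x
  proof (cases "x = 0")
    case False
    then have x0: "0 < x"
      using x by simp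
    have "filterlim (\<lambda>n. 1 + r n * x) at_top sequentially"
      using x0 r(2)
      by (intro filterlim_tendsto_add_at_top[OF tendsto_const] filterlim_at_top_mult_tendsto_pos[OF tendsto_const])
    then have "(\<lambda>n. inverse (1 + r n * x)) \<longlonglongrightarrow> 0"
      by (rule tendsto_inverse_0_at_top)
    then have "(\<lambda>n. 1 - inverse (1 + r n * x)) \<longlonglongrightarrow> 1 - 0"
      by (intro tendsto_intros)
    then show ?thesis
      using False w_integrand[OF r(1) x] by (simp add: res_def inverse_eq_divide)
  qed simp
qed measurable

lemma w'_pos:
  assumes u: "0 < u" and r: "0 \<le> r"
  shows "0 < w' r"
proof -
  have nn: "AE x in \<mu>. 0 \<le> x * (res r x)\<^sup>2"
    using measure_on_interval_AE[OF \<mu>_on_interval] by eventually_elim auto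
  have "0 \<le> w' r"
    unfolding w'_def by (rule integral_nonneg_AE[OF nn])
  moreover have "w' r \<noteq> 0"
  proof
    assume "w' r = 0"
    then have "AE x in \<mu>. x * (res r x)\<^sup>2 = 0"
      using integral_nonneg_eq_0_iff_AE[OF w'_integrable[OF r] nn] by (simp add: w'_def)
    with measure_on_interval_AE[OF \<mu>_on_interval] have "AE x in \<mu>. (indicator (- {0}) x :: real) = 0"
    proof eventually_elim
      case (elim x)
      then show ?case
        using den_ge1[OF r elim(1)] by (auto simp: res_def)
    qed
    then have "(LINT x|\<mu>. indicator (- {0}) x :: real) = 0"
      by (rule integral_eq_zero_AE)
    then show False
      using u integral_nonzero by simp
  qed
  ultimately show ?thesis
    by simp
qed

lemma w_strict_mono:
  assumes u: "0 < u" and "0 \<le> r" "r < s"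
  shows "w r < w s"
proof (rule DERIV_pos_imp_increasing_open[OF assms(3)])
  show "\<exists>y. (w has_real_derivative y) (at x) \<and> 0 < y" if "r < x" "x < s" for x
    using w_DERIV[of x] w'_pos[OF u, of x] assms that by auto
  show "continuous_on {r..s} w"
    by (rule continuous_on_subset[OF w_continuous]) (use assms in auto)
qed

text \<open>The inverse of \<open>w\<close>, with the sign conventions of the \<open>S\<close>-transform.\<close>

definition \<rho> :: "real \<Rightarrow> real" where "\<rho> t = - inv_into {..<0} (psi_transform E T) (- t)"

lemma \<rho>:
  assumes t: "0 < t" "t < u"
  shows \<rho>_pos: "0 < \<rho> t" and w_\<rho>: "w (\<rho> t) = t"
proof -
  have "(\<lambda>n. w (real n)) \<longlonglongrightarrow> u"
    by (rule w_tendsto_u) (auto intro: filterlim_real_sequentially)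
  then have "\<forall>\<^sub>F n in sequentially. t < w (real n)"
    using t by (simp add: order_tendstoD)
  then obtain n where n: "t < w (real n)"
    by (auto simp: eventually_sequentially)
  have "\<exists>r. 0 \<le> r \<and> r \<le> real n \<and> w r = t"
    by (rule IVT') (use t n w_zero continuous_on_subset[OF w_continuous] in auto)
  then obtain r where r: "0 \<le> r" "w r = t"
    by blast
  then have "r \<noteq> 0"
    using t w_zero by auto
  with r have "- t \<in> psi_transform E T ` {..<0}"
    using psi_transform_eq[of r] by (intro image_eqI[of _ _ "- r"]) auto
  then have "inv_into {..<0} (psi_transform E T) (- t) \<in> {..<0}"
    "psi_transform E T (inv_into {..<0} (psi_transform E T) (- t)) = - t"
    by (rule inv_into_into, rule f_inv_into_f)
  then show "0 < \<rho> t" "w (\<rho> t) = t"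
    using psi_transform_eq[of "\<rho> t"] by (auto simp: \<rho>_def)
qed

lemma \<rho>_w:
  assumes "0 < r" "0 < w r" "w r < u"
  shows "\<rho> (w r) = r"
  using w_strict_mono[of r "\<rho> (w r)"] w_strict_mono[of "\<rho> (w r)" r] \<rho>[OF assms(2,3)] assms
  by (cases "\<rho> (w r)" r rule: linorder_cases) auto

lemma w_between:
  assumes u: "0 < u" and r: "0 < r"
  shows "0 < w r" "w r < u"
proof -
  show "0 < w r"
    using w_strict_mono[OF u, of 0 r] r by (simp add: w_zero)
  have "w r < w (r + 1)"
    using w_strict_mono[OF u, of r "r + 1"] r by simp
  also have "w (r + 1) \<le> u"
  proof (rule LIMSEQ_le_const)
    show "(\<lambda>n. w (real n)) \<longlonglongrightarrow> u"
      by (rule w_tendsto_u) (auto intro: filterlim_real_sequentially)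
    show "\<exists>N. \<forall>n\<ge>N. w (r + 1) \<le> w (real n)"
    proof -
      obtain N where "r + 1 \<le> real N"
        using real_arch_simple by blast
      then show ?thesis
        using r by (intro exI[of _ N] allI impI w_mono) auto
    qed
  qed
  finally show "w r < u" .
qed

lemma \<rho>_isCont:
  assumes t: "0 < t" "t < u"
  shows "isCont \<rho> t"
proof -
  have u: "0 < u"
    using t by simp
  have "isCont \<rho> (w (\<rho> t))"
  proof (rule isCont_inverse_function2[where f = w and x = "\<rho> t" and a = "\<rho> t / 2" and b = "\<rho> t + 1"])
    show "\<rho> t / 2 < \<rho> t" "\<rho> t < \<rho> t + 1"
      using \<rho>_pos[OF t] by auto
    show "\<rho> (w z) = z" if "\<rho> t / 2 \<le> z" "z \<le> \<rho> t + 1" for z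
      using that \<rho>_pos[OF t] w_between[OF u, of z] by (intro \<rho>_w) auto
    show "isCont w z" if "\<rho> t / 2 \<le> z" "z \<le> \<rho> t + 1" for z
      using that \<rho>_pos[OF t] by (intro DERIV_isCont[OF w_DERIV]) auto
  qed
  then show ?thesis
    by (simp add: w_\<rho>[OF t])
qed

lemma \<rho>_DERIV:
  assumes t: "0 < t" "t < u"
  shows "(\<rho> has_real_derivative inverse (w' (\<rho> t))) (at t)"
proof (rule DERIV_inverse_function[OF _ _ t])
  show "(w has_real_derivative w' (\<rho> t)) (at (\<rho> t))"
    by (rule w_DERIV[OF \<rho>_pos[OF t]])
  show "w' (\<rho> t) \<noteq> 0"
    using w'_pos[of "\<rho> t"] \<rho>_pos[OF t] t by simp
qed (use w_\<rho> \<rho>_isCont t in auto)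

lemma S_transform_eq: "t \<noteq> 0 \<Longrightarrow> S_transform E T (- t) = \<rho> t * (1 - t) / t"
  by (simp add: S_transform_def \<rho>_def field_simps)

text \<open>Off the kernel, \<open>ln (1 + r x) - ln r = ln (1 / r + x)\<close> decreases to \<open>ln x\<close> as \<open>r\<close> grows, so monotone
  convergence makes the logarithm integrable with integral \<open>L\<close>. It then dominates its own truncations.\<close>

lemma E_log_eq:
  assumes r: "\<And>n. 0 < r n" "incseq r" "filterlim r at_top sequentially"
    and lim: "(\<lambda>n. F (r n) - u * ln (r n)) \<longlonglongrightarrow> L"
  shows "E_log E T = ereal L"
proof -
  define g where "g n x = - (ln (1 + r n * x) - indicator (- {0}) x * ln (r n))" for n x
  define h where "h x = indicator {0<..} x * ln x" for x :: real
  have ind_int: "integrable \<mu> (indicator (- {0}) :: real \<Rightarrow> real)"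
    by (rule integrable_\<mu>[of _ 1]) (auto simp: indicator_def)
  have g_int: "integrable \<mu> (g n)" for n
    unfolding g_def using F_integrable[of "r n"] r(1)[of n] ind_int by (auto simp: less_imp_le)
  have g_eq: "g n x = - ln (inverse (r n) + x)" if "0 < x" for n x
  proof -
    have "1 + r n * x = r n * (inverse (r n) + x)"
      using r(1)[of n] by (simp add: field_simps)
    moreover have "0 < inverse (r n) + x"
      using that r(1)[of n] by (simp add: add_pos_pos)
    ultimately show ?thesis
      using that r(1)[of n] by (simp add: g_def ln_mult_pos)
  qed
  have g_lim: "(\<lambda>n. LINT x|\<mu>. g n x) \<longlonglongrightarrow> - L"
  proof -
    have "(LINT x|\<mu>. g n x) = - (F (r n) - u * ln (r n))" for n
      unfolding g_def using F_integrable[of "r n"] r(1)[of n] ind_int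
      by (simp add: F_def less_imp_le space_\<mu> measure_nonzero)
    then show ?thesis
      using tendsto_minus[OF lim] by simp
  qed
  have h_meas [measurable]: "h \<in> borel_measurable borel"
    unfolding h_def[abs_def] by measurable
  have mono: "AE x in \<mu>. mono (\<lambda>n. g n x)"
    using measure_on_interval_AE[OF \<mu>_on_interval]
  proof eventually_elim
    case (elim x)
    show ?case
    proof (cases "x = 0")
      case False
      then have x: "0 < x"
        using elim by simp
      show ?thesis
      proof (rule monoI)
        fix m n :: nat
        assume "m \<le> n"
        then have "inverse (r n) \<le> inverse (r m)"
          using r(1)[of m] r(2) by (intro le_imp_inverse_le) (auto simp: incseq_def)
        moreover have "0 < inverse (r n) + x" "0 < inverse (r m) + x"
          using r(1) x by (simp_all add: add_pos_pos)
        ultimately show "g m x \<le> g n x"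
          using x by (simp add: g_eq del: inverse_le_iff_le)
      qed
    qed (simp add: g_def mono_def)
  qed
  have conv: "AE x in \<mu>. (\<lambda>n. g n x) \<longlonglongrightarrow> - h x"
    using measure_on_interval_AE[OF \<mu>_on_interval]
  proof eventually_elim
    case (elim x)
    show ?case
    proof (cases "x = 0")
      case False
      then have x: "0 < x"
        using elim by simp
      have "(\<lambda>n. inverse (r n)) \<longlonglongrightarrow> 0"
        by (rule tendsto_inverse_0_at_top[OF r(3)])
      then have "(\<lambda>n. - ln (inverse (r n) + x)) \<longlonglongrightarrow> - ln (0 + x)"
        using x by (intro tendsto_intros) auto
      then show ?thesis
        using x by (simp add: g_eq h_def)
    qed (simp add: g_def h_def)
  qed
  have "integrable \<mu> (\<lambda>x. - h x)" "(LINT x|\<mu>. - h x) = - L"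
    by (rule integrable_monotone_convergence[OF g_int mono conv g_lim]
          integral_monotone_convergence[OF g_int mono conv g_lim],
        simp add: measure_on_interval_measurable[OF \<mu>_on_interval])+
  then have h: "integrable \<mu> h" "(LINT x|\<mu>. h x) = L"
    using integrable_minus[of \<mu> "\<lambda>x. - h x"] by simp_all
  have lp_meas [measurable]: "log_plus l \<in> borel_measurable borel" for l
    unfolding log_plus_def[abs_def] by measurable
  have lp: "log_plus l x = (if l < x then h x else 0)" if "0 < l" for l x
    using that by (auto simp: log_plus_def h_def)
  have lim_int: "((\<lambda>l. LINT x|\<mu>. log_plus l x) \<longlongrightarrow> L) (at_right 0)"
  proof (rule tendsto_at_right_sequentially[of 0 1])
    fix S :: "nat \<Rightarrow> real"
    assume S: "\<And>n. 0 < S n" "S \<longlonglongrightarrow> 0"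
    show "(\<lambda>n. LINT x|\<mu>. log_plus (S n) x) \<longlonglongrightarrow> L"
      unfolding h(2)[symmetric]
    proof (rule integral_dominated_convergence[where w = "\<lambda>x. \<bar>h x\<bar>"])
      show "AE x in \<mu>. (\<lambda>n. log_plus (S n) x) \<longlonglongrightarrow> h x"
      proof (rule AE_I2)
        fix x
        show "(\<lambda>n. log_plus (S n) x) \<longlonglongrightarrow> h x"
        proof (cases "0 < x")
          case True
          then have "\<forall>\<^sub>F n in sequentially. S n < x"
            using S(2) by (simp add: order_tendstoD)
          then have "\<forall>\<^sub>F n in sequentially. log_plus (S n) x = h x"
            by eventually_elim (simp add: lp S)
          then show ?thesis
            by (rule tendsto_eventually)
        next
          case False
          then have "log_plus (S n) x = h x" for n
            using S(1)[of n] by (simp add: lp[OF S(1)] h_def)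
          then show ?thesis
            by simp
        qed
      qed
      show "AE x in \<mu>. norm (log_plus (S n) x) \<le> \<bar>h x\<bar>" for n
        by (rule AE_I2) (simp add: lp S)
    qed (use h in \<open>simp_all add: measure_on_interval_measurable[OF \<mu>_on_interval]\<close>)
  qed simp
  have bb: "bounded_borel_on 0 b (log_plus l)" if l: "0 < l" for l
  proof (rule bounded_borel_onI[of _ _ _ "\<bar>ln l\<bar> + \<bar>ln b\<bar>"])
    fix x
    assume x: "x \<in> {0..b}"
    show "\<bar>log_plus l x\<bar> \<le> \<bar>ln l\<bar> + \<bar>ln b\<bar>"
    proof (cases "l < x")
      case True
      then have "ln l \<le> ln x" "ln x \<le> ln b"
        using l x by auto
      then show ?thesis
        using True by (simp add: log_plus_def)
    qed (simp add: log_plus_def)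
  qed measurable
  have "\<forall>\<^sub>F l in at_right 0. ereal (LINT x|\<mu>. log_plus l x) = ereal (Re (E (borel_calculus (log_plus l) T)))"
    unfolding eventually_at_right_field by (intro exI[of _ 1]) (simp add: E_borel_calculus bb)
  then have "((\<lambda>l. ereal (Re (E (borel_calculus (log_plus l) T)))) \<longlongrightarrow> ereal L) (at_right 0)"
    by (rule Lim_transform_eventually[rotated]) (intro tendsto_intros lim_int)
  then show ?thesis
    unfolding E_log_def by (rule tendsto_Lim[OF trivial_limit_at_right_real])
qed

end

section \<open>Free compression\<close>

lemma projection_norm_le:
  assumes "projection P"
  shows "norm P \<le> 1"
proof (rule hermitian_norm_bound)
  show "\<bar>inner x (P x)\<bar> \<le> 1 * (norm x)\<^sup>2" for x
    using projection_inner_le[OF assms, of x] projection_inner[OF assms, of x] by simp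
qed (use assms in \<open>auto simp: projection_iff\<close>)

lemma positive_compression:
  assumes "projection P" "positive_op Y"
  shows "positive_op (P o\<^sub>L Y o\<^sub>L P)"
proof -
  have P: "hermitian P" and Y: "hermitian Y"
    using assms by (auto simp: projection_iff positive_op_iff)
  have "inner x ((P o\<^sub>L Y o\<^sub>L P) y) = inner (P x) (Y (P y))" for x y
    using hermitian_inner[OF P, of x "Y (P y)"] by simp
  moreover have "inner ((P o\<^sub>L Y o\<^sub>L P) x) y = inner (Y (P x)) (P y)" for x y
    using hermitian_inner[OF P, of "Y (P x)" y] by simp
  ultimately show ?thesis
    using assms P Y hermitian_inner[OF Y] by (simp add: positive_op_iff hermitian_def[of "P o\<^sub>L Y o\<^sub>L P"])
qed

lemma (in tracial_wstar_space) positive_elementI: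
  assumes "T \<in> M" "positive_op T"
  shows "positive_element M E T (norm T + 1)"
  using assms spectral_bounds_positive[OF assms(2)] tracial_wstar_space_axioms
  by (simp add: positive_element_def bounded_element_def bounded_element_axioms_def)

text \<open>Let \<open>q \<ge> 0\<close>, \<open>w = w\<^sub>Y(q) < t\<close> and \<open>r = q (1 - w) / (t - w)\<close>. With \<open>A = (1 + q Y)\<^sup>-\<^sup>1\<close> and
  \<open>B = 1 - (w / t) P\<close>, both of trace \<open>1 - w\<close>, the element \<open>G = 1 + r P Y\<close> satisfies \<open>B G A = Z\<close>, where
  \<open>Z = (1 - w) - (1 / t) (P - t) (A - (1 - w))\<close> is a scalar plus an alternating word of centred letters.
  The value of \<open>r\<close> is the one for which the terms linear in the centred letters cancel.
  Primes denote inverses.\<close>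

locale free_compression = free_elements M E P Y
  for M :: "('h::complex_hilbert \<Rightarrow>\<^sub>L 'h) set" and E and P Y :: "'h \<Rightarrow>\<^sub>L 'h" +
  fixes t :: real
  assumes proj: "projection P" and pos: "positive_op Y"
    and EP: "E P = of_real t" and t: "0 < t"
begin

sublocale Y: positive_element M E Y "norm Y + 1"
  by (rule positive_elementI[OF Y pos])

definition T :: "'h \<Rightarrow>\<^sub>L 'h" where "T = P o\<^sub>L Y o\<^sub>L P"

lemma T_M: "T \<in> M"
  unfolding T_def by (intro M_compose X Y)

sublocale T: positive_element M E T "norm T + 1"
  unfolding T_def[symmetric]
  by (rule positive_elementI[OF T_M]) (simp add: T_def positive_compression proj pos)

lemma PP: "P (P x) = P x"
  using proj by (metis projection_iff blinfun_apply_blinfun_compose)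

lemma norm_P: "norm P \<le> 1"
  by (rule projection_norm_le[OF proj])

definition r :: "real \<Rightarrow> real" where "r q = q * (1 - Y.w q) / (t - Y.w q)"

definition A :: "real \<Rightarrow> ('h \<Rightarrow>\<^sub>L 'h)" where "A q = Y.resolvent q"

definition A' :: "real \<Rightarrow> ('h \<Rightarrow>\<^sub>L 'h)" where "A' q = id_blinfun + q *\<^sub>R Y"

definition B :: "real \<Rightarrow> ('h \<Rightarrow>\<^sub>L 'h)" where "B q = id_blinfun - (Y.w q / t) *\<^sub>R P"

definition B' :: "real \<Rightarrow> ('h \<Rightarrow>\<^sub>L 'h)" where
  "B' q = id_blinfun + (Y.w q / (t - Y.w q)) *\<^sub>R P"

definition G :: "real \<Rightarrow> ('h \<Rightarrow>\<^sub>L 'h)" where "G q = id_blinfun + r q *\<^sub>R (P o\<^sub>L Y)"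

definition G' :: "real \<Rightarrow> ('h \<Rightarrow>\<^sub>L 'h)" where
  "G' q = id_blinfun - r q *\<^sub>R (T.resolvent (r q) o\<^sub>L (P o\<^sub>L Y))"

definition Z :: "real \<Rightarrow> ('h \<Rightarrow>\<^sub>L 'h)" where
  "Z q = A q + ((1 - Y.w q) / t) *\<^sub>R P - (1 / t) *\<^sub>R (P o\<^sub>L A q)"

definition Z' :: "real \<Rightarrow> ('h \<Rightarrow>\<^sub>L 'h)" where "Z' q = A' q o\<^sub>L (G' q o\<^sub>L B' q)"

lemma A_inverse: "0 \<le> q \<Longrightarrow> A q o\<^sub>L A' q = id_blinfun" "0 \<le> q \<Longrightarrow> A' q o\<^sub>L A q = id_blinfun"
  by (simp_all add: A_def A'_def Y.resolvent_inverse)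

lemma B_inverse:
  assumes "Y.w q < t"
  shows "B q o\<^sub>L B' q = id_blinfun" "B' q o\<^sub>L B q = id_blinfun"
proof -
  define c d where "c = Y.w q / t" and "d = Y.w q / (t - Y.w q)"
  have "d - c - c * d = 0"
    using assms t by (simp add: c_def d_def field_simps)
  then have d: "d = c + c * d"
    by simp
  have "x + d *\<^sub>R P x - c *\<^sub>R (P x + d *\<^sub>R P x) = x" for x
  proof -
    have "x + d *\<^sub>R P x - c *\<^sub>R (P x + d *\<^sub>R P x) = x + (d - (c + c * d)) *\<^sub>R P x"
      by (simp add: algebra_simps)
    then show ?thesis
      using d by simp
  qed
  moreover have "x - c *\<^sub>R P x + d *\<^sub>R (P x - c *\<^sub>R P x) = x" for x
  proof -
    have "x - c *\<^sub>R P x + d *\<^sub>R (P x - c *\<^sub>R P x) = x + (d - (c + c * d)) *\<^sub>R P x"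
      by (simp add: algebra_simps)
    then show ?thesis
      using d by simp
  qed
  ultimately show "B q o\<^sub>L B' q = id_blinfun" "B' q o\<^sub>L B q = id_blinfun"
    by (auto intro!: blinfun_eqI simp: B_def B'_def c_def[symmetric] d_def[symmetric] blinfun.bilinear_simps PP)
qed

lemma r_nonneg:
  assumes "0 \<le> q" "Y.w q < t" "t \<le> 1"
  shows "0 \<le> r q"
  using assms by (simp add: r_def)

text \<open>The resolvent \<open>V\<close> of \<open>T = P Y P\<close> commutes with \<open>P\<close> and satisfies \<open>r T V = 1 - V\<close>; hence \<open>1 - r V P Y\<close>
  inverts \<open>1 + r P Y\<close>.\<close>

lemma G_inverse:
  assumes "0 \<le> r q"
  shows "G q o\<^sub>L G' q = id_blinfun" "G' q o\<^sub>L G q = id_blinfun"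
proof -
  let ?V = "T.resolvent (r q)"
  have V1: "?V (x + r q *\<^sub>R T x) = x" and V2: "?V x + r q *\<^sub>R T (?V x) = x" for x
    using arg_cong[OF T.resolvent_inverse(1)[OF assms], of "\<lambda>S. blinfun_apply S x"]
      arg_cong[OF T.resolvent_inverse(2)[OF assms], of "\<lambda>S. blinfun_apply S x"]
    by (simp_all add: blinfun.bilinear_simps)
  have PT: "P o\<^sub>L T = T o\<^sub>L P"
    by (rule blinfun_eqI) (simp add: T_def PP)
  have "P o\<^sub>L ?V = ?V o\<^sub>L P"
    unfolding T.resolvent_def using proj
    by (intro T.calc_commute PT T.res_bb assms) (simp add: projection_iff)
  then have PV: "P (?V x) = ?V (P x)" for x
    by (metis blinfun_apply_blinfun_compose)
  have TV: "T (?V (P x)) = P (Y (?V (P x)))" for x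
    using PV[of "P x"] by (simp add: T_def PP)
  have e1: "(G q o\<^sub>L G' q) x = x" for x
  proof -
    define z where "z = P (Y x)"
    have "r q *\<^sub>R P (Y (?V z)) = z - ?V z"
      using V2[of z] TV[of "Y x"] by (simp add: z_def algebra_simps)
    then have "r q *\<^sub>R r q *\<^sub>R P (Y (?V z)) = r q *\<^sub>R (z - ?V z)"
      by simp
    then show ?thesis
      by (simp add: G_def G'_def blinfun.bilinear_simps z_def[symmetric] algebra_simps)
  qed
  have e2: "(G' q o\<^sub>L G q) x = x" for x
  proof -
    define z where "z = P (Y x)"
    have "P (Y z) = T z"
      by (simp add: T_def z_def PP)
    then have "?V z + r q *\<^sub>R ?V (P (Y z)) = z"
      using V1[of z] by (simp add: blinfun.bilinear_simps)
    then have "r q *\<^sub>R (?V z + r q *\<^sub>R ?V (P (Y z))) = r q *\<^sub>R z"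
      by simp
    then show ?thesis
      by (simp add: G_def G'_def blinfun.bilinear_simps z_def[symmetric] algebra_simps)
  qed
  show "G q o\<^sub>L G' q = id_blinfun" "G' q o\<^sub>L G q = id_blinfun"
    using e1 e2 by (auto intro!: blinfun_eqI)
qed

lemma Z_factorization:
  assumes q: "0 \<le> q" and w: "Y.w q < t"
  shows "Z q = B q o\<^sub>L (G q o\<^sub>L A q)"
proof (rule blinfun_eqI)
  fix x
  define y where "y = A q x"
  define w where "w = Y.w q"
  define k where "k = (1 - w) / (t - w)"
  have tw: "t - w \<noteq> 0"
    using assms by (simp add: w_def)
  have qY: "q *\<^sub>R Y y = x - y"
    using arg_cong[OF A_inverse(2)[OF q], of "\<lambda>S. blinfun_apply S x"]
    by (simp add: A'_def blinfun.bilinear_simps y_def algebra_simps)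
  have "r q *\<^sub>R P (Y y) = k *\<^sub>R P (q *\<^sub>R Y y)"
    by (simp add: r_def k_def w_def blinfun.bilinear_simps)
  then have rPY: "r q *\<^sub>R P (Y y) = k *\<^sub>R P (x - y)"
    by (simp add: qY)
  have kt: "k - w / t * k = (1 - w) / t"
    using tw t by (simp add: k_def divide_simps) (simp add: algebra_simps)
  have "(B q o\<^sub>L (G q o\<^sub>L A q)) x = y + k *\<^sub>R P (x - y) - (w / t) *\<^sub>R P (y + k *\<^sub>R P (x - y))"
  proof -
    have "G q y = y + k *\<^sub>R P (x - y)"
      by (simp add: G_def blinfun.add_left blinfun.scaleR_left rPY)
    moreover have "B q z = z - (w / t) *\<^sub>R P z" for z
      by (simp add: B_def w_def blinfun.diff_left blinfun.scaleR_left)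
    ultimately show ?thesis
      by (simp only: blinfun_apply_blinfun_compose y_def[symmetric])
  qed
  also have "\<dots> = y + (k - w / t * k) *\<^sub>R P (x - y) - (w / t) *\<^sub>R P y"
  proof -
    define d where "d = P (x - y)"
    have "P d = d"
      by (simp add: d_def PP)
    then show ?thesis
      by (simp add: blinfun.add_right blinfun.scaleR_right algebra_simps flip: d_def)
  qed
  also have "\<dots> = y + ((1 - w) / t) *\<^sub>R P x - (1 / t) *\<^sub>R P y"
    unfolding kt by (simp add: blinfun.bilinear_simps algebra_simps diff_divide_distrib)
  also have "\<dots> = Z q x"
    by (simp add: Z_def y_def w_def blinfun.bilinear_simps)
  finally show "Z q x = (B q o\<^sub>L (G q o\<^sub>L A q)) x" ..
qed

lemma Z_inverse:
  assumes q: "0 \<le> q" and w: "Y.w q < t" and t1: "t \<le> 1"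
  shows "Z q o\<^sub>L Z' q = id_blinfun" "Z' q o\<^sub>L Z q = id_blinfun"
proof -
  note inv = A_inverse[OF q] B_inverse[OF w] G_inverse[OF r_nonneg[OF q w t1]]
  have e: "A q (A' q x) = x" "A' q (A q x) = x" "B q (B' q x) = x" "B' q (B q x) = x"
    "G q (G' q x) = x" "G' q (G q x) = x" for x
    using inv by (metis blinfun_apply_blinfun_compose blinfun_apply_id_blinfun id_apply)+
  show "Z q o\<^sub>L Z' q = id_blinfun" "Z' q o\<^sub>L Z q = id_blinfun"
    unfolding Z_factorization[OF q w] Z'_def by (auto intro!: blinfun_eqI simp: e)
qed

lemma A_M: "0 \<le> q \<Longrightarrow> A q \<in> M"
  by (simp add: A_def Y.resolvent_in_M)

lemma E_A: "0 \<le> q \<Longrightarrow> E (A q) = of_real (1 - Y.w q)"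
  by (simp add: A_def Y.E_resolvent)

lemma A_approximable:
  assumes q: "0 \<le> q"
  obtains y where "\<And>n. y n \<in> AY" "y \<longlonglongrightarrow> A q"
proof -
  have cont: "continuous_on {0..norm Y + 1} (Y.res q)"
    unfolding Y.res_def[abs_def]
    by (intro continuous_intros) (use Y.den_ge1[OF q] in force)
  show thesis
    by (rule Y.calc_approximable[OF cont Y.res_meas])
      (rule that, simp_all add: A_def Y.resolvent_def)
qed

lemma scalar_in_XY_algebra: "scalar c \<in> XY_algebra"
proof -
  have "scalar c = scalar c + 0"
    by simp
  then have "scalar c \<in> XY0"
    unfolding XY0_def using XY_span.zero by blast
  then show ?thesis
    using closure_subset by (auto simp: XY_algebra_def)
qed

text \<open>Expanding the product of centred elements gives \<open>Z\<close> back, so \<open>Z\<close> lies in the algebra on which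
  \<open>E\<close> is multiplicative.\<close>

lemma Z_in_XY_algebra:
  assumes q: "0 \<le> q"
  shows "Z q \<in> XY_algebra"
proof -
  define x where "x = scaleC_op (of_real (- 1 / t)) (P - scalar (of_real t))"
  have x: "x \<in> AX"
    unfolding x_def by (intro generated_algebra.scale generated_diff_scalar generated_algebra.generator) simp
  have Ex: "E x = 0"
    unfolding x_def by (simp add: E_scaleC E_diff EP E_scalar M_diff X scalar_M)
  obtain y where "\<And>n. y n \<in> AY" "y \<longlonglongrightarrow> A q"
    using A_approximable[OF q] by blast
  then have "x o\<^sub>L (A q - scalar (E (A q))) \<in> XY_algebra"
    by (rule centred_product_in_XY_algebra[OF x Ex])
  then have "scalar (of_real (1 - Y.w q)) + (x o\<^sub>L (A q - scalar (E (A q)))) \<in> XY_algebra"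
    by (intro XY_algebra_add scalar_in_XY_algebra)
  also have "scalar (of_real (1 - Y.w q)) + (x o\<^sub>L (A q - scalar (E (A q)))) = Z q"
  proof (rule blinfun_eqI)
    fix v
    show "(scalar (of_real (1 - Y.w q)) + (x o\<^sub>L (A q - scalar (E (A q))))) v = Z q v"
      unfolding x_def E_A[OF q] scalar_real scaleC_op_of_real Z_def using t
      by (simp add: blinfun.bilinear_simps algebra_simps diff_divide_distrib add_divide_distrib)
  qed
  finally show ?thesis .
qed

lemma E_Z:
  assumes q: "0 \<le> q"
  shows "E (Z q) = of_real (1 - Y.w q)"
proof -
  obtain y where y: "\<And>n. y n \<in> AY" "y \<longlonglongrightarrow> A q"
    using A_approximable[OF q] by blast
  have "E (A q o\<^sub>L (id_blinfun o\<^sub>L P)) = E (A q) * E id_blinfun * E P"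
    by (rule E_sandwich[OF XY_algebra_id y]) (simp add: generated_algebra.generator)
  then have "E (P o\<^sub>L A q) = of_real ((1 - Y.w q) * t)"
    using E_tracial[OF X A_M[OF q]] by (simp add: E_A q E_id EP)
  then show ?thesis
    unfolding Z_def using t
    by (simp add: E_add E_diff E_scaleR M_intros A_M q X E_A EP)
qed

text \<open>The algebra contains \<open>Z\<close> for every parameter; invertibility within it propagates from the
  parameter 0, where \<open>Z = 1\<close>, in steps of a size controlled by a uniform bound for the inverses.\<close>

lemma Z'_in_XY_algebra:
  assumes q1: "0 \<le> q1" and w1: "Y.w q1 < t" and t1: "t \<le> 1"
  shows "Z' q1 \<in> XY_algebra"
proof -
  define R where "R = q1 / (t - Y.w q1)"
  have wq: "0 \<le> Y.w q" "Y.w q \<le> Y.w q1" "Y.w q < t" if "0 \<le> q" "q \<le> q1" for q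
    using that Y.w_nonneg[of q] Y.w_mono[of q q1] w1 by auto
  have r_le: "0 \<le> r q" "r q \<le> R" if q: "0 \<le> q" "q \<le> q1" for q
  proof -
    show "0 \<le> r q"
      using r_nonneg q wq[OF q] t1 by blast
    have "q * (1 - Y.w q) \<le> q1 * 1"
      using q wq[OF q] q1 t1 by (intro mult_mono) auto
    then show "r q \<le> R"
      unfolding r_def R_def using wq[OF q] w1 q1 by (intro frac_le) auto
  qed
  have R0: "0 \<le> R"
    using q1 w1 by (simp add: R_def)
  \<comment> \<open>\<open>C\<close> bounds the inverses of \<open>Z\<close> on the whole range, \<open>D\<close> is a Lipschitz constant of \<open>Z\<close>.\<close>
  define C where "C = (1 + q1 * norm Y) * ((1 + R * norm Y) * (1 + t / (t - Y.w q1)))"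
  have norm_Z': "norm (Z' q) \<le> C" if q: "0 \<le> q" "q \<le> q1" for q
  proof -
    have n_id: "norm (id_blinfun :: 'h \<Rightarrow>\<^sub>L 'h) \<le> 1"
      by (rule norm_blinfun_id_le)
    have "norm (A' q) \<le> 1 + q1 * norm Y"
      unfolding A'_def using q n_id
      by (intro order_trans[OF norm_triangle_ineq] add_mono) (auto intro: mult_right_mono)
    moreover have "norm (G' q) \<le> 1 + R * norm Y"
    proof -
      have "norm (T.resolvent (r q) o\<^sub>L (P o\<^sub>L Y)) \<le> norm (T.resolvent (r q)) * (norm P * norm Y)"
        by (intro order_trans[OF norm_blinfun_compose] mult_left_mono norm_blinfun_compose) auto
      also have "\<dots> \<le> 1 * (1 * norm Y)"
        using T.norm_resolvent_le[OF r_le(1)[OF q]] norm_P by (intro mult_mono) auto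
      finally have "r q * norm (T.resolvent (r q) o\<^sub>L (P o\<^sub>L Y)) \<le> R * norm Y"
        using r_le[OF q] R0 by (intro mult_mono) auto
      then show ?thesis
        unfolding G'_def using n_id r_le[OF q]
        by (intro order_trans[OF norm_triangle_ineq4] add_mono) auto
    qed
    moreover have "norm (B' q) \<le> 1 + t / (t - Y.w q1)"
    proof -
      have "Y.w q / (t - Y.w q) \<le> t / (t - Y.w q1)"
        using wq[OF q] w1 t by (intro frac_le) auto
      then have "Y.w q / (t - Y.w q) * norm P \<le> t / (t - Y.w q1) * 1"
        using norm_P wq[OF q] t w1 by (intro mult_mono) auto
      then show ?thesis
        unfolding B'_def using n_id wq[OF q]
        by (intro order_trans[OF norm_triangle_ineq] add_mono) auto
    qed
    ultimately show ?thesis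
      unfolding Z'_def C_def using q1 R0
      by (intro order_trans[OF norm_blinfun_compose] mult_mono order_refl) auto
  qed
  define D where "D = (norm Y + 1) * (1 + 2 / t)"
  have lip: "norm (Z q - Z p) \<le> D * \<bar>q - p\<bar>" if p: "0 \<le> p" and q: "0 \<le> q" for p q
  proof -
    have nA: "norm (A q - A p) \<le> (norm Y + 1) * \<bar>q - p\<bar>"
      unfolding A_def by (rule Y.norm_resolvent_diff_le[OF q p])
    have nw: "\<bar>Y.w p - Y.w q\<bar> \<le> (norm Y + 1) * \<bar>q - p\<bar>"
    proof -
      have "hermitian (A q - A p)" "A q - A p \<in> M"
        using p q A_M by (auto simp: A_def Y.resolvent_def Y.form_op_hermitian Y.res_bb M_diff)
      from E_hermitian_abs_le[OF this(2,1)] show ?thesis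
        using nA p q by (simp add: E_diff A_M E_A)
    qed
    have "Z q - Z p = (A q - A p) + ((Y.w p - Y.w q) / t) *\<^sub>R P - (1 / t) *\<^sub>R (P o\<^sub>L (A q - A p))"
      unfolding Z_def
      by (intro blinfun_eqI) (simp add: blinfun.bilinear_simps algebra_simps diff_divide_distrib)
    also have "norm \<dots> \<le> norm (A q - A p) + norm (((Y.w p - Y.w q) / t) *\<^sub>R P)
        + norm ((1 / t) *\<^sub>R (P o\<^sub>L (A q - A p)))"
      by (intro order_trans[OF norm_triangle_ineq4] add_mono norm_triangle_ineq order_refl)
    also have "norm (((Y.w p - Y.w q) / t) *\<^sub>R P) \<le> ((norm Y + 1) * \<bar>q - p\<bar>) / t * 1"
      unfolding norm_scaleR abs_divide using t norm_P nw
      by (intro mult_mono) (auto intro: divide_right_mono)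
    also have "norm ((1 / t) *\<^sub>R (P o\<^sub>L (A q - A p))) \<le> (1 / t) * (1 * ((norm Y + 1) * \<bar>q - p\<bar>))"
      unfolding norm_scaleR using t norm_P nA
      by (intro mult_mono order_trans[OF norm_blinfun_compose]) auto
    finally have "norm (Z q - Z p) \<le> norm (A q - A p) + (norm Y + 1) * \<bar>q - p\<bar> / t * 1
        + 1 / t * (1 * ((norm Y + 1) * \<bar>q - p\<bar>))"
      by simp
    also have "\<dots> \<le> (norm Y + 1) * \<bar>q - p\<bar> + (norm Y + 1) * \<bar>q - p\<bar> / t * 1
        + 1 / t * (1 * ((norm Y + 1) * \<bar>q - p\<bar>))"
      using nA by simp
    also have "\<dots> = D * \<bar>q - p\<bar>"
      using t by (simp add: D_def field_simps)
    finally show ?thesis .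
  qed
  have C0: "0 < C"
  proof -
    have "0 < 1 + q1 * norm Y" "0 < 1 + R * norm Y" "0 < 1 + t / (t - Y.w q1)"
      using q1 R0 t w1 by (auto intro!: add_pos_nonneg)
    then show ?thesis
      unfolding C_def by (intro mult_pos_pos)
  qed
  have D0: "0 < D"
    unfolding D_def using t by (intro mult_pos_pos add_pos_nonneg add_nonneg_pos) auto
  define \<delta> where "\<delta> = 1 / (2 * (C * D))"
  have \<delta>: "0 < \<delta>" "C * D * \<delta> < 1"
    using C0 D0 by (simp_all add: \<delta>_def)
  have "Z' q \<in> XY_algebra" if "0 \<le> q" "q \<le> q1" "q \<le> real n * \<delta>" for n q
    using that
  proof (induction n arbitrary: q)
    case 0
    then have "q = 0"
      by simp
    then have "Z' q = id_blinfun"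
      by (simp add: Z'_def A'_def G'_def B'_def r_def Y.w_zero)
    then show ?case
      by (simp add: XY_algebra_id)
  next
    case (Suc n)
    define p where "p = max 0 (q - \<delta>)"
    have p: "0 \<le> p" "p \<le> q1" "p \<le> real n * \<delta>" "\<bar>p - q\<bar> \<le> \<delta>"
      using Suc.prems \<delta> by (auto simp: p_def distrib_right)
    show ?case
    proof (rule inverse_in_closed_algebra[of XY_algebra "Z p" "Z' p" "Z q"])
      have "norm (Z' p) * norm (Z p - Z q) \<le> C * (D * \<delta>)"
        using norm_Z'[OF p(1,2)] lip[OF Suc.prems(1) p(1)] p(4) C0 D0
        by (intro mult_mono order_trans[OF lip[OF Suc.prems(1) p(1)]] mult_left_mono) auto
      then show "norm (Z' p) * norm (Z p - Z q) < 1"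
        using \<delta> by simp
      show "Z p o\<^sub>L Z' p = id_blinfun"
        by (rule Z_inverse[OF p(1) wq(3)[OF p(1,2)] t1])
      show "Z' q o\<^sub>L Z q = id_blinfun"
        by (rule Z_inverse[OF Suc.prems(1) wq(3)[OF Suc.prems(1,2)] t1])
      show "Z' p \<in> XY_algebra"
        by (rule Suc.IH[OF p(1,2,3)])
    qed (use XY_algebra_closed XY_algebra_id XY_algebra_add XY_algebra_diff XY_algebra_compose
        Z_in_XY_algebra p Suc.prems in auto)
  qed
  moreover obtain n where "q1 \<le> real n * \<delta>"
    using reals_Archimedean3[OF \<delta>(1)] by (metis less_imp_le)
  ultimately show ?thesis
    using q1 by blast
qed

lemma t_le_1: "t \<le> 1"
proof -
  have "\<bar>t\<bar> \<le> norm P"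
    using E_hermitian_abs_le[OF X] proj EP by (simp add: projection_iff)
  then show ?thesis
    using norm_P by simp
qed

text \<open>Since \<open>G' = A Z' B\<close> and \<open>E\<close> factorizes on such products, \<open>E G' = (1 - w)\<^sup>2 E Z'\<close>. As \<open>E\<close> is
  multiplicative on the algebra of \<open>Z\<close> and \<open>Z'\<close>, \<open>E Z' = 1 / E Z = 1 / (1 - w)\<close>. By the trace property
  \<open>E G'\<close> is the trace of the resolvent of \<open>P Y P\<close> at \<open>r\<close>.\<close>

theorem w_compression:
  assumes q: "0 \<le> q" and w: "Y.w q < t"
  shows "T.w (r q) = Y.w q"
proof -
  let ?w = "Y.w q"
  let ?V = "T.resolvent (r q)"
  note t1 = t_le_1
  have r: "0 \<le> r q"
    by (rule r_nonneg[OF q w t1])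
  have w1: "?w < 1"
    using w t1 by simp
  have Z'S: "Z' q \<in> XY_algebra"
    by (rule Z'_in_XY_algebra[OF q w t1])
  have "E (Z q) * E (Z' q) = 1"
    using XY_algebra_E_compose[OF Z_in_XY_algebra[OF q] Z'S] Z_inverse[OF q w t1] by (simp add: E_id)
  then have "of_real (1 - ?w) * E (Z' q) = 1"
    by (simp add: E_Z q)
  then have EZ': "E (Z' q) = of_real (1 / (1 - ?w))"
    using w1 by (simp add: field_simps)
  have EB: "E (B q) = of_real (1 - ?w)"
    unfolding B_def using t by (simp add: E_diff E_scaleR M_intros X E_id EP)
  have BAX: "B q \<in> AX"
  proof -
    have "B q = id_blinfun + scaleC_op (of_real (- ?w / t)) P"
      unfolding B_def scaleC_op_of_real by simp
    then show ?thesis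
      by (auto intro: generated_algebra.intros)
  qed
  have "A q o\<^sub>L (Z' q o\<^sub>L B q) = G' q"
  proof -
    have "A q (A' q x) = x" "B' q (B q x) = x" for x
      using A_inverse[OF q] B_inverse[OF w]
      by (metis blinfun_apply_blinfun_compose blinfun_apply_id_blinfun id_apply)+
    then show ?thesis
      unfolding Z'_def by (intro blinfun_eqI) simp
  qed
  moreover obtain y where y: "\<And>n. y n \<in> AY" "y \<longlonglongrightarrow> A q"
    using A_approximable[OF q] by blast
  ultimately have "E (G' q) = E (A q) * E (Z' q) * E (B q)"
    using E_sandwich[OF Z'S y BAX] by simp
  also have "\<dots> = of_real (1 - ?w)"
    using w1 by (simp add: E_A q EB EZ')
  finally have EG1: "E (G' q) = of_real (1 - ?w)" .
  have VM: "?V \<in> M"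
    by (rule T.resolvent_in_M[OF r])
  have PV: "P o\<^sub>L ?V = ?V o\<^sub>L P"
  proof -
    have "P o\<^sub>L T = T o\<^sub>L P"
      by (rule blinfun_eqI) (simp add: T_def PP)
    then show ?thesis
      unfolding T.resolvent_def using proj
      by (intro T.calc_commute T.res_bb r) (simp add: projection_iff)
  qed
  have "?V o\<^sub>L (P o\<^sub>L Y) = P o\<^sub>L (?V o\<^sub>L (P o\<^sub>L Y))"
  proof -
    have "P (?V x) = ?V (P x)" for x
      using PV by (metis blinfun_apply_blinfun_compose)
    then show ?thesis
      by (intro blinfun_eqI) (simp add: PP)
  qed
  then have "E (?V o\<^sub>L (P o\<^sub>L Y)) = E (P o\<^sub>L (?V o\<^sub>L (P o\<^sub>L Y)))"
    by simp
  also have "\<dots> = E ((?V o\<^sub>L (P o\<^sub>L Y)) o\<^sub>L P)"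
    by (rule E_tracial) (intro M_compose X Y VM)+
  also have "(?V o\<^sub>L (P o\<^sub>L Y)) o\<^sub>L P = ?V o\<^sub>L T"
    by (simp add: T_def compose_assoc)
  finally have "E (G' q) = E (id_blinfun - r q *\<^sub>R (?V o\<^sub>L T))"
    unfolding G'_def by (simp add: E_diff E_scaleR M_intros VM X Y T_M)
  also have "id_blinfun - r q *\<^sub>R (?V o\<^sub>L T) = ?V"
    using T.resolvent_inverse(1)[OF r] by (simp add: compose_add compose_scaleR algebra_simps)
  also have "E ?V = of_real (1 - T.w (r q))"
    by (rule T.E_resolvent[OF r])
  finally show ?thesis
    using EG1 by (simp only: of_real_eq_iff)
qed

text \<open>Both sides have the derivative \<open>w r' / r\<close> in \<open>q\<close> and vanish at 0.\<close>

lemma F_compression: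
  assumes q: "0 \<le> q" and w: "Y.w q < t" and t1: "t < 1"
  shows "T.F (r q) = Y.F q + ln (1 - Y.w q) - t * ln (1 - Y.w q / t)"
proof (cases "q = 0")
  case True
  then show ?thesis
    by (simp add: r_def Y.w_zero T.F_zero Y.F_zero)
next
  case False
  define H where "H q = T.F (r q) - (Y.F q + ln (1 - Y.w q) - t * ln (1 - Y.w q / t))" for q
  have wq: "0 \<le> Y.w p" "Y.w p < t" if "0 \<le> p" "p \<le> q" for p
    using that Y.w_nonneg[of p] Y.w_mono[of p q] w by auto
  have ne: "t - Y.w p \<noteq> 0" "1 - Y.w p > 0" "1 - Y.w p / t > 0" if "p \<in> {0..q}" for p
    using wq[of p] that t1 t by (auto simp: divide_less_eq)
  have "H q = H 0"
  proof (rule DERIV_isconst_end[of 0 q H])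
    show "0 < q"
      using False q by simp
    have cw: "continuous_on {0..q} Y.w" and cF: "continuous_on {0..q} Y.F"
      by (rule continuous_on_subset[OF Y.w_continuous] continuous_on_subset[OF Y.F_continuous], simp)+
    have cr: "continuous_on {0..q} r"
      unfolding r_def[abs_def] using ne by (intro continuous_intros cw) auto
    have "r ` {0..q} \<subseteq> {0..}"
      using r_nonneg wq t1 by auto
    then have "continuous_on {0..q} (\<lambda>q. T.F (r q))"
      using continuous_on_compose2[OF T.F_continuous cr] by simp
    then show "continuous_on {0..q} H"
      unfolding H_def using ne t by (intro continuous_intros cw cF) (auto simp: less_imp_neq)
  next
    fix p
    assume p: "0 < p" "p < q"
    have wp: "0 \<le> Y.w p" "Y.w p < t"
      using wq[of p] p by auto
    define v v' where "v = Y.w p" and "v' = Y.w' p"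
    have v: "t - v > 0" "1 - v > 0"
      using wp t1 by (auto simp: v_def)
    have Dw: "(Y.w has_real_derivative v') (at p)"
      unfolding v'_def by (rule Y.w_DERIV[OF p(1)])
    have rp: "0 < r p"
      using p v by (simp add: r_def v_def)
    define r' where "r' = r p * (1 / p - v' / (1 - v) + v' / (t - v))"
    have alg: "((a - y * c') * c + y * a * c') / (c * c) = y * a / c * (1 / y - c' / a + c' / c)"
      if "y \<noteq> 0" "a \<noteq> 0" "c \<noteq> 0" for y a c c' :: real
      using that by (simp add: field_simps)
    have "(r has_real_derivative ((1 - v - p * v') * (t - v) + p * (1 - v) * v') / ((t - v) * (t - v))) (at p)"
      unfolding r_def[abs_def] using v
      by (auto intro!: derivative_eq_intros Dw simp: v_def[symmetric] algebra_simps)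
    then have Dr: "(r has_real_derivative r') (at p)"
      using alg[of p "1 - v" "t - v" v'] v p by (simp add: r'_def r_def v_def[symmetric])
    have DT: "((\<lambda>q. T.F (r q)) has_real_derivative v / r p * r') (at p)"
      using DERIV_chain2[OF T.F_DERIV[OF rp] Dr] w_compression[of p] p wp by (simp add: v_def)
    have DL: "((\<lambda>q. Y.F q + ln (1 - Y.w q) - t * ln (1 - Y.w q / t)) has_real_derivative
        (v / p - v' / (1 - v) + t * (v' / (t - v)))) (at p)"
    proof -
      have "1 - v / t > 0"
        using v t by (simp add: divide_less_eq)
      then show ?thesis
        using v t
        by (auto intro!: derivative_eq_intros Dw Y.F_DERIV[OF p(1)] simp: v_def[symmetric])
          (simp add: field_simps)
    qed
    have "v / r p * r' = v / p - v' / (1 - v) + t * (v' / (t - v))"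
    proof -
      have "v / r p * r' = v * (1 / p - v' / (1 - v) + v' / (t - v))"
        using rp by (simp add: r'_def)
      also have "\<dots> = v / p - v' / (1 - v) * v + v' / (t - v) * v"
        by (simp add: algebra_simps)
      also have "v' / (1 - v) * v = v' / (1 - v) - v'"
        using v by (simp add: field_simps)
      also have "v' / (t - v) * v = t * (v' / (t - v)) - v'"
        using v by (simp add: field_simps)
      finally show ?thesis
        by simp
    qed
    then show "(H has_real_derivative 0) (at p)"
      unfolding H_def using DERIV_diff[OF DT DL] by simp
  qed
  also have "H 0 = 0"
    by (simp add: H_def r_def Y.w_zero T.F_zero Y.F_zero)
  finally show ?thesis
    by (simp add: H_def)
qed

text \<open>Let \<open>w\<close> increase to \<open>t\<close> in the previous formula. The parameters \<open>r\<close> then increase to infinity, as the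
  monotone convergence behind \<open>T.E_log_eq\<close> requires.\<close>

lemma E_log_compression:
  assumes tu: "t < Y.u"
  shows "E_log E T = ereal (Y.F (Y.\<rho> t) - t * ln (Y.\<rho> t) + (1 - t) * ln (1 - t) + t * ln t)"
proof -
  have t1: "t < 1"
    using tu Y.u_le_1 by simp
  \<comment> \<open>The shift by 2 keeps the first value positive.\<close>
  define s where "s n = t - t / real (n + 2)" for n
  have s: "0 < s n" "s n < t" for n
    using t by (auto simp: s_def pos_divide_less_eq distrib_left intro: add_pos_nonneg)
  have su: "s n < Y.u" for n
    using s(2)[of n] tu by simp
  have s_mono: "incseq s"
    unfolding incseq_def s_def using t by (auto intro!: divide_left_mono)
  have inv: "(\<lambda>n. inverse (real (n + 2))) \<longlonglongrightarrow> 0"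
    using LIMSEQ_ignore_initial_segment[OF LIMSEQ_inverse_real_of_nat, of 1] by simp
  have s_lim: "s \<longlonglongrightarrow> t"
  proof -
    have "(\<lambda>n. t - t * inverse (real (n + 2))) \<longlonglongrightarrow> t - t * 0"
      by (intro tendsto_intros inv)
    then show ?thesis
      by (simp add: s_def[abs_def] divide_inverse)
  qed
  define q where "q n = Y.\<rho> (s n)" for n
  have q: "0 < q n" "Y.w (q n) = s n" for n
    using Y.\<rho>[OF s(1) su] by (auto simp: q_def)
  have u0: "0 < Y.u"
    using t tu by simp
  have q_mono: "incseq q"
    unfolding incseq_def
  proof (intro allI impI, rule ccontr)
    fix m n :: nat
    assume "m \<le> n" and "\<not> q m \<le> q n"
    then have "Y.w (q n) < Y.w (q m)"
      using q by (intro Y.w_strict_mono[OF u0]) (auto simp: less_imp_le)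
    then show False
      using s_mono \<open>m \<le> n\<close> by (auto simp: q incseq_def not_less[symmetric])
  qed
  have q_lim: "q \<longlonglongrightarrow> Y.\<rho> t"
    unfolding q_def by (rule isCont_tendsto_compose[OF Y.\<rho>_isCont[OF t tu] s_lim])
  have wlt: "Y.w (q n) < t" for n
    using s q by simp
  have r_eq: "r (q n) = q n * (1 + (1 - t) * (real (n + 2) / t))" for n
  proof -
    have "t - s n = t / real (n + 2)"
      by (simp add: s_def)
    moreover have "(1 - s n) / (t - s n) = 1 + (1 - t) / (t - s n)"
      using s(2)[of n] by (simp add: field_simps)
    moreover have "r (q n) = q n * ((1 - s n) / (t - s n))"
      by (simp add: r_def q(2))
    ultimately show ?thesis
      by (simp only: divide_divide_eq_right times_divide_eq_right)
  qed
  have r_pos: "0 < r (q n)" for n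
    unfolding r_eq using q(1) t t1 by (intro mult_pos_pos add_pos_nonneg) auto
  have r_mono: "incseq (\<lambda>n. r (q n))"
    unfolding incseq_def r_eq
  proof (intro allI impI mult_mono)
    fix m n :: nat
    assume mn: "m \<le> n"
    show "q m \<le> q n"
      using q_mono mn by (simp add: incseq_def)
    show "1 + (1 - t) * (real (m + 2) / t) \<le> 1 + (1 - t) * (real (n + 2) / t)"
      using mn t t1 by (intro add_left_mono mult_left_mono divide_right_mono) auto
  qed (use q t t1 in \<open>auto simp: less_imp_le intro!: add_nonneg_nonneg\<close>)
  have r_inf: "filterlim (\<lambda>n. r (q n)) at_top sequentially"
    unfolding r_eq
  proof (rule filterlim_tendsto_pos_mult_at_top[OF q_lim Y.\<rho>_pos[OF t tu]])
    have "filterlim (\<lambda>n. ((1 - t) / t) * real (n + 2)) at_top sequentially"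
      using t t1
      by (intro filterlim_tendsto_pos_mult_at_top[OF tendsto_const]
          filterlim_compose[OF filterlim_real_sequentially filterlim_add_const_nat_at_top]) auto
    then show "filterlim (\<lambda>n. 1 + (1 - t) * (real (n + 2) / t)) at_top sequentially"
      by (intro filterlim_tendsto_add_at_top[OF tendsto_const]) simp
  qed
  \<comment> \<open>The compression has kernel of trace \<open>1 - t\<close>.\<close>
  have Tu: "T.u = t"
  proof (rule LIMSEQ_unique)
    show "(\<lambda>n. T.w (r (q n))) \<longlonglongrightarrow> T.u"
      by (rule T.w_tendsto_u) (use r_pos r_inf in \<open>auto simp: less_imp_le\<close>)
    have "T.w (r (q n)) = s n" for n
      using w_compression[of "q n"] q s by (simp add: less_imp_le)
    then show "(\<lambda>n. T.w (r (q n))) \<longlonglongrightarrow> t"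
      using s_lim by simp
  qed
  show ?thesis
  proof (rule T.E_log_eq[OF r_pos r_mono r_inf])
    have eq: "T.F (r (q n)) - T.u * ln (r (q n))
        = Y.F (q n) - t * ln (q n) + (1 - t) * ln (1 - s n) + t * ln t" for n
    proof -
      have p: "0 < 1 - s n" "0 < t - s n"
        using s(2)[of n] t1 by auto
      have l1: "ln (r (q n)) = ln (q n) + ln (1 - s n) - ln (t - s n)"
        using q(1)[of n] p by (simp add: r_def q(2) ln_mult_pos ln_div)
      have l2: "ln (1 - s n / t) = ln (t - s n) - ln t"
      proof -
        have "1 - s n / t = (t - s n) / t"
          using t by (simp add: field_simps)
        then show ?thesis
          using p t by (simp add: ln_div)
      qed
      show ?thesis
        unfolding F_compression[OF less_imp_le[OF q(1)] wlt t1] Tu q(2) l1 l2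
        by (simp add: algebra_simps)
    qed
    have "(\<lambda>n. Y.F (q n) - t * ln (q n) + (1 - t) * ln (1 - s n) + t * ln t)
        \<longlonglongrightarrow> Y.F (Y.\<rho> t) - t * ln (Y.\<rho> t) + (1 - t) * ln (1 - t) + t * ln t"
    proof (intro tendsto_intros)
      show "(\<lambda>n. Y.F (q n)) \<longlonglongrightarrow> Y.F (Y.\<rho> t)"
        by (rule isCont_tendsto_compose[OF DERIV_isCont[OF Y.F_DERIV[OF Y.\<rho>_pos[OF t tu]]] q_lim])
    qed (use q_lim s_lim Y.\<rho>_pos[OF t tu] t1 in auto)
    then show "(\<lambda>n. T.F (r (q n)) - T.u * ln (r (q n)))
        \<longlonglongrightarrow> Y.F (Y.\<rho> t) - t * ln (Y.\<rho> t) + (1 - t) * ln (1 - t) + t * ln t"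
      by (simp only: eq)
  qed
qed

end

section \<open>The derivative of the logarithmic determinant\<close>

text \<open>The terms with the derivative of \<open>\<rho>\<close> cancel, because \<open>F' = w / r\<close> equals \<open>t / \<rho> t\<close> at \<open>r = \<rho> t\<close>.\<close>

lemma (in positive_element) log_determinant_DERIV:
  assumes t: "0 < t" "t < u"
  shows "((\<lambda>t. F (\<rho> t) - t * ln (\<rho> t) + (1 - t) * ln (1 - t) + t * ln t)
    has_real_derivative - ln (S_transform E T (- t))) (at t)"
proof -
  have t1: "t < 1"
    using t u_le_1 by simp
  have \<rho>0: "0 < \<rho> t"
    by (rule \<rho>_pos[OF t])
  have DF: "((\<lambda>t. F (\<rho> t)) has_real_derivative (t / \<rho> t) * inverse (w' (\<rho> t))) (at t)"
    using DERIV_chain2[OF F_DERIV[OF \<rho>0] \<rho>_DERIV[OF t]] by (simp add: w_\<rho>[OF t])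
  have "ln (\<rho> t * (1 - t) / t) = ln (\<rho> t) + ln (1 - t) - ln t"
    using \<rho>0 t t1 by (simp add: ln_mult_pos ln_div)
  then show ?thesis
    using \<rho>0 t t1
    by (auto intro!: derivative_eq_intros DF \<rho>_DERIV simp: S_transform_eq)
qed

theorem corollary4:
  fixes M :: "('h::complex_hilbert \<Rightarrow>\<^sub>L 'h) set"
    and E :: "('h \<Rightarrow>\<^sub>L 'h) \<Rightarrow> complex"
    and Y :: "'h \<Rightarrow>\<^sub>L 'h"
    and P :: "real \<Rightarrow> ('h \<Rightarrow>\<^sub>L 'h)"
    and u :: real
  assumes "tracial_wstar_space M E"
    and "Y \<in> M" and "Y \<noteq> 0" and "self_adjoint Y" and "positive_op Y"
    and "u = 1 - measure (spectral_distribution E Y) {0}"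
    and "\<And>t. 0 < t \<Longrightarrow> t < u \<Longrightarrow>
           P t \<in> M \<and> projection (P t) \<and> free_pair E (P t) Y \<and> E (P t) = of_real t"
  shows "\<forall>t. 0 < t \<and> t < u \<longrightarrow>
      \<bar>E_log E (P t o\<^sub>L Y o\<^sub>L P t)\<bar> \<noteq> \<infinity> \<and>
      FK_det E (sqrt_op Y o\<^sub>L P t) > 0 \<and>
      S_transform E Y (-t) > 0 \<and>
      ((\<lambda>s. real_of_ereal (E_log E (P s o\<^sub>L Y o\<^sub>L P s)))
         has_real_derivative - ln (S_transform E Y (-t))) (at t) \<and>
      ((\<lambda>s. ln (FK_det E (sqrt_op Y o\<^sub>L P s)))
         has_real_derivative - (1/2) * ln (S_transform E Y (-t))) (at t)"
proof -
  interpret tracial_wstar_space M E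
    by fact
  interpret Y: positive_element M E Y "norm Y + 1"
    by (rule positive_elementI) fact+
  define L where "L t = Y.F (Y.\<rho> t) - t * ln (Y.\<rho> t) + (1 - t) * ln (1 - t) + t * ln t" for t
  have u: "u = Y.u"
    using assms(6) by (simp add: Y.u_def Y.\<mu>_def)
  have E_log: "E_log E (P t o\<^sub>L Y o\<^sub>L P t) = ereal (L t)" if t: "0 < t" "t < u" for t
  proof -
    interpret C: free_compression M E "P t" Y t
      using assms(2,5,7) t by unfold_locales auto
    show ?thesis
      using C.E_log_compression t by (simp add: L_def u C.T_def)
  qed
  have square: "adj (sqrt_op Y o\<^sub>L P t) o\<^sub>L (sqrt_op Y o\<^sub>L P t) = P t o\<^sub>L Y o\<^sub>L P t" if t: "0 < t" "t < u" for t
  proof -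
    have h: "hermitian (sqrt_op Y)" "hermitian (P t)"
      using positive_sqrt_op[OF assms(5)] assms(7)[OF t] by (auto simp: positive_op_iff projection_iff)
    have "adj (sqrt_op Y o\<^sub>L P t) o\<^sub>L (sqrt_op Y o\<^sub>L P t) = P t o\<^sub>L ((sqrt_op Y o\<^sub>L sqrt_op Y) o\<^sub>L P t)"
      using h by (simp add: adj_compose adj_hermitian compose_assoc)
    then show ?thesis
      by (simp add: sqrt_op_square[OF assms(5)] compose_assoc)
  qed
  have FK: "FK_det E (sqrt_op Y o\<^sub>L P t) = exp (L t / 2)" if "0 < t" "t < u" for t
    using E_log[OF that] by (simp add: FK_det_def square[OF that])
  show ?thesis
  proof (intro allI impI, elim conjE)
    fix t
    assume t: "0 < t" "t < u"
    have tu: "t < Y.u" and t1: "t < 1"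
      using t u Y.u_le_1 by auto
    have S: "0 < S_transform E Y (- t)"
      using Y.\<rho>_pos[OF t(1) tu] t t1 by (simp add: Y.S_transform_eq)
    have DL: "(L has_real_derivative - ln (S_transform E Y (- t))) (at t)"
      unfolding L_def[abs_def] by (rule Y.log_determinant_DERIV[OF t(1) tu])
    have D1: "((\<lambda>s. real_of_ereal (E_log E (P s o\<^sub>L Y o\<^sub>L P s)))
        has_real_derivative - ln (S_transform E Y (- t))) (at t)"
      by (rule has_field_derivative_transform_within_open[OF DL, of "{0<..<u}"])
        (use t E_log in auto)
    have "((\<lambda>s. L s / 2) has_real_derivative - ln (S_transform E Y (- t)) / 2) (at t)"
      by (rule DERIV_cdivide[OF DL])
    then have D2: "((\<lambda>s. ln (FK_det E (sqrt_op Y o\<^sub>L P s)))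
        has_real_derivative - ln (S_transform E Y (- t)) / 2) (at t)"
      by (rule has_field_derivative_transform_within_open[of _ _ _ "{0<..<u}"])
        (use t FK in auto)
    show "\<bar>E_log E (P t o\<^sub>L Y o\<^sub>L P t)\<bar> \<noteq> \<infinity> \<and>
      FK_det E (sqrt_op Y o\<^sub>L P t) > 0 \<and>
      S_transform E Y (-t) > 0 \<and>
      ((\<lambda>s. real_of_ereal (E_log E (P s o\<^sub>L Y o\<^sub>L P s)))
         has_real_derivative - ln (S_transform E Y (-t))) (at t) \<and>
      ((\<lambda>s. ln (FK_det E (sqrt_op Y o\<^sub>L P s)))
         has_real_derivative - (1/2) * ln (S_transform E Y (-t))) (at t)"
      using E_log[OF t] FK[OF t] S D1 D2 by simp
  qed
qed

end
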